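(* The pointwise product of any $f\in \mathcal H^1_a(\mathbb C_+)$ and any $g\in BMOA(\mathbb C_+)$ belongs to $\mathcal H^{\log}_a(\mathbb C_+)$. Moreover, every function in $\mathcal H^{\log}_a(\mathbb C_+)$ can be written as such a product, i.e. for every $h\in\mathcal H^{\log}_a(\mathbb C_+)$ there exist $f\in \mathcal H^1_a(\mathbb C_+)$ and $g\in BMOA(\mathbb C_+)$ with $h=fg$. In other words, $$\mathcal H^1_a(\mathbb C_+)\cdot BMOA(\mathbb C_+) = \mathcal H^{\log}_a(\mathbb C_+),$$ where the left-hand side denotes the set of all pointwise products $fg$ with $f\in \mathcal H^1_a(\mathbb C_+)$ and $g\in BMOA(\mathbb C_+)$.
   Context: $\mathbb C_+$ is the upper half-plane $\{x+iy: y>0\}$. $\mathcal H^1_a(\mathbb C_+)$ is the space of holomorphic functions $f$ on $\mathbb C_+$ such that $\|f\|_{\mathcal H^1_a}:=\sup_{y>0}\int_{-\infty}^{+\infty}|f(x+iy)|\,dx<\infty$. $BMOA(\mathbb C_+)$ is the space of holomorphic functions $g$ on $\mathbb C_+$ satisfying one of the following two equivalent conditions: (i) $|g'(x+iy)|^2 y\,dx\,dy$ is a Carleson measure on $\mathbb C_+$; (ii) $g(x+iy)=P_y*g_0(x)$, where $P_y$ is the Poisson kernel, $P_y(x)=\frac1\pi\frac{y}{x^2+y^2}$, and $g_0\in BMO(\mathbb R)$ has (distributional) Fourier transform supported in $[0,\infty)$. Elements are functions (not classes modulo constants). $L^{\log}(\mathbb R)$ is the space of measurable functions $f$ on $\mathbb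 R$ such that $\int_{\mathbb R}\frac{|f(x)|}{\log(e+|x|)+\log(e+|f(x)|)}\,dx<\infty$. Its "norm" is $$\|f\|_{L^{\log}}:=\inf\Big\{\lambda>0:\int_{\mathbb R}\theta(x,|f(x)|/\lambda)\,dx\le 1\Big\},\qquad \theta(x,t)=\frac{t}{1+\log_+(|x|)+\frac12\log_+(t)},$$ where $\log_+ s=\max(\log s,0)$ (and $\log_+0=0$). $\mathcal H^{\log}_a(\mathbb C_+)$ is the space of holomorphic functions $f$ on $\mathbb C_+$ such that $\|f\|_{\mathcal H^{\log}_a}:=\sup_{y>0}\|f(\cdot+iy)\|_{L^{\log}}<\infty$. *)

theory Defs
  imports "HOL-Complex_Analysis.Complex_Analysis"
begin

definition upper_half_plane :: "complex set" where
  "upper_half_plane = {z. 0 < Im z}"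

text \<open>
  A function on the upper half-plane is represented by a total function of type
  \<^typ>\<open>complex \<Rightarrow> complex\<close> whose values outside the half-plane are irrelevant: none of the
  three spaces below depends on them.  The (quasi-)norms take values in \<^typ>\<open>ennreal\<close>.
\<close>

definition hardy1_norm :: "(complex \<Rightarrow> complex) \<Rightarrow> ennreal" where
  "hardy1_norm f = (SUP y\<in>{0<..}. \<integral>\<^sup>+x. ennreal (cmod (f (Complex x y))) \<partial>lborel)"

definition hardy1 :: "(complex \<Rightarrow> complex) set" where
  "hardy1 = {f. f holomorphic_on upper_half_plane \<and> hardy1_norm f < \<infinity>}"

definition carleson_box :: "real \<Rightarrow> real \<Rightarrow> complex set" where
  "carleson_box a b = {z. a < Re z \<and> Re z < b \<and> 0 < Im z \<and> Im z < b - a}"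

definition carleson_measure :: "complex measure \<Rightarrow> bool" where
  "carleson_measure \<mu> \<longleftrightarrow>
     sets \<mu> = sets (restrict_space borel upper_half_plane) \<and>
     (\<exists>C\<ge>0. \<forall>a b. a < b \<longrightarrow> emeasure \<mu> (carleson_box a b) \<le> ennreal (C * (b - a)))"

text \<open>
  BMOA is defined by the Carleson measure condition on
  \<open>|g'(x + i y)|\<^sup>2 y dx dy\<close>; its elements are functions, not classes modulo constants.
\<close>

definition bmoa :: "(complex \<Rightarrow> complex) set" where
  "bmoa = {g. g holomorphic_on upper_half_plane \<and>
     carleson_measure (density (restrict_space lborel upper_half_plane)
       (\<lambda>z. ennreal ((cmod (deriv g z))\<^sup>2 * Im z)))}"

text \<open>Since \<^prop>\<open>ln (0::real) = 0\<close> in HOL, the convention that the positive part of the logarithm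
  vanishes at 0 is built in.\<close>

definition log_plus :: "real \<Rightarrow> real" where
  "log_plus s = max (ln s) 0"

definition theta :: "real \<Rightarrow> real \<Rightarrow> real" where
  "theta x t = t / (1 + log_plus \<bar>x\<bar> + log_plus t / 2)"

text \<open>
  The infimum is taken in \<^typ>\<open>ennreal\<close>, where the infimum of the empty set is \<open>\<infinity>\<close>.  For
  measurable \<open>f\<close> the value is therefore finite exactly when \<open>f\<close> belongs to the space of functions
  for which \<open>|f(x)| / (log (e + |x|) + log (e + |f(x)|))\<close> is integrable.
\<close>

definition Llog_norm :: "(real \<Rightarrow> complex) \<Rightarrow> ennreal" where
  "Llog_norm f = Inf {ennreal l | l. 0 < l \<and>
     (\<integral>\<^sup>+x. ennreal (theta x (cmod (f x) / l)) \<partial>lborel) \<le> 1}"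

definition hardy_log_norm :: "(complex \<Rightarrow> complex) \<Rightarrow> ennreal" where
  "hardy_log_norm f = (SUP y\<in>{0<..}. Llog_norm (\<lambda>x. f (Complex x y)))"

definition hardy_log :: "(complex \<Rightarrow> complex) set" where
  "hardy_log = {f. f holomorphic_on upper_half_plane \<and> hardy_log_norm f < \<infinity>}"

end

theory Submission
  imports Defs
begin

text \<open>
  Write \<open>\<theta>(x, t)\<close> for \<^const>\<open>theta\<close> and \<open>log\<^sub>+\<close> for \<^const>\<open>log_plus\<close>.

  \<^bold>\<open>Products.\<close>  Let \<open>f\<close> be in the Hardy space and \<open>g\<close> in BMOA.  At a point where \<open>|g|\<close> is at most
  \<open>K\<close> times the denominator of \<open>\<theta>(x, |f g|)\<close>, this quantity is at most \<open>K |f|\<close>; at any other point the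
  failure of that bound implies \<open>|f g| \<le> 2 exp (2 |g| / K) / (1 + x\<^sup>2)\<close>.  So it is enough that
  \<open>exp (c |g|)\<close> be integrable against \<open>dx / (1 + x\<^sup>2)\<close> for some \<open>c > 0\<close>, uniformly over the
  horizontal lines of height at most \<open>1\<close> (\<open>john_nirenberg\<close>).  On the higher lines the logarithmic growth of
  \<open>g\<close>, which comes from \<open>|g'| \<le> C / Im z\<close>, and the bound \<open>|f| \<le> C / Im z\<close> suffice.

  The exponential integrability is obtained directly from the Carleson condition.  The function
  \<open>\<phi>(z) = \<integral> |g'(w)|\<^sup>2 (1 - |\<tau>\<^sub>w(z)|\<^sup>2) dA(w)\<close>, where \<open>\<tau>\<^sub>w\<close> is the conformal map of the half-plane onto the
  disc that sends \<open>w\<close> to \<open>0\<close>, is bounded because of the Carleson condition.  The kernel satisfies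
  \<open>\<Delta>(1 - |\<tau>\<^sub>w|\<^sup>2) = - (1 - |\<tau>\<^sub>w|\<^sup>2)\<^sup>2 / (Im z)\<^sup>2\<close>, and with the mean value property of \<open>(g')\<^sup>2\<close> this gives
  \<open>\<Delta>\<phi> \<le> - c |g'|\<^sup>2\<close>.  After normalization to \<open>0 \<le> \<phi> \<le> 1\<close>, the function
  \<open>exp (Re (\<kappa> g)) (1 + \<phi> - \<phi>\<^sup>2 / 4)\<close> is superharmonic for small \<open>\<kappa>\<close>: the term \<open>\<Delta>\<phi>\<close> absorbs the
  Laplacian \<open>|\<kappa> g'|\<^sup>2 exp (Re (\<kappa> g))\<close> of the exponential, and the concavity of \<open>1 + \<phi> - \<phi>\<^sup>2 / 4\<close> absorbs the
  mixed gradient terms.  Comparison with the Poisson integral of its boundary values on a line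
  bounds the integral of \<open>exp (Re (\<kappa> g))\<close> over that line by its value at one point.

  \<^bold>\<open>Factorization.\<close>  Normalize \<open>h\<close> so that \<open>\<integral> \<theta>(x, |h(x + i y)|) dx \<le> 1\<close> for all \<open>y\<close>.  There is a
  holomorphic \<open>G\<close> with \<open>Re G \<ge> 0\<close> and \<open>|h| \<le> |G|\<^sup>2\<close> (\<open>hardy_log_majorant\<close>).  Put
  \<open>g = 1 + Ln (1 - i z) + Ln (1 + G)\<close>.  Both logarithms are taken of functions with positive real part, so
  \<open>Im g\<close> is bounded, and a holomorphic function with bounded imaginary part is in BMOA
  (\<open>bounded_Im_bmoa\<close>, a Green formula with polynomial weights).  On the other hand
  \<open>Re g \<ge> 1 + log\<^sub>+ |x| + log\<^sub>+ |h| / 2\<close>, which is precisely the denominator of \<open>\<theta>(x, |h|)\<close>.  Hence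
  \<open>|h / g| \<le> \<theta>(x, |h|)\<close>, and \<open>f = h / g\<close> lies in the Hardy space.

  The function \<open>G\<close> is found on the lines \<open>Im z = \<epsilon>\<close>.  Since \<open>\<surd>t \<le> 1 + (1 + log\<^sub>+ |x|) \<theta>(x, t)\<close>, the
  integrals of \<open>\<surd>|h|\<close> against \<open>dx / (1 + x\<^sup>2)\<close> over these lines are bounded.  The holomorphic function whose real part is the
  Poisson integral of \<open>\<surd>|h|\<close> dominates \<open>\<surd>|h|\<close> on the line, so that the maximum modulus principle for the
  quotient of \<open>h\<close> by its square gives the majorant above the line; Montel's theorem allows \<open>\<epsilon> \<rightarrow> 0\<close>.
\<close>

section \<open>Lebesgue measure on the complex plane\<close>

lemma Complex_measurable [measurable]: "(\<lambda>(x, y). Complex x y) \<in> borel \<Otimes>\<^sub>M borel \<rightarrow>\<^sub>M borel"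
proof -
  have "continuous_on UNIV (\<lambda>p::real \<times> real. Complex (fst p) (snd p))"
    by (intro continuous_intros)
  then show ?thesis
    by (simp add: borel_prod case_prod_beta' borel_measurable_continuous_onI)
qed

lemma measurable_Complex [measurable (raw)]:
  assumes [measurable]: "f \<in> borel_measurable M" "g \<in> borel_measurable M"
  shows "(\<lambda>x. Complex (f x) (g x)) \<in> borel_measurable M"
proof -
  have "(\<lambda>x. case (f x, g x) of (a, b) \<Rightarrow> Complex a b) \<in> borel_measurable M"
    by measurable
  then show ?thesis by simp
qed

lemma lborel_complex_eq: "lborel = distr (lborel \<Otimes>\<^sub>M lborel) borel (\<lambda>(x, y). Complex x y)"
proof (rule lborel_eqI)
  fix l u :: complex assume le: "\<And>b. b \<in> Basis \<Longrightarrow> l \<bullet> b \<le> u \<bullet> b"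
  have "Re l \<le> Re u" "Im l \<le> Im u" using le[of 1] le[of \<i>] by (auto simp: Basis_complex_def)
  moreover have "(\<lambda>(x, y). Complex x y) -` box l u = {Re l<..<Re u} \<times> {Im l<..<Im u}"
    by (auto simp: in_box_complex_iff)
  ultimately show "emeasure (distr (lborel \<Otimes>\<^sub>M lborel) borel (\<lambda>(x, y). Complex x y)) (box l u) =
      (\<Prod>b\<in>Basis. (u - l) \<bullet> b)"
    by (subst emeasure_distr)
      (auto simp: space_pair_measure lborel.emeasure_pair_measure_Times Basis_complex_def
        ennreal_mult)
qed simp

lemma nn_integral_complex_pair:
  fixes f :: "complex \<Rightarrow> ennreal"
  assumes [measurable]: "f \<in> borel_measurable borel"
  shows "(\<integral>\<^sup>+z. f z \<partial>lborel) = (\<integral>\<^sup>+p. f (Complex (fst p) (snd p)) \<partial>lborel)"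
proof -
  have "(\<integral>\<^sup>+z. f z \<partial>lborel) = (\<integral>\<^sup>+p. f (case p of (x, y) \<Rightarrow> Complex x y) \<partial>(lborel \<Otimes>\<^sub>M lborel))"
    by (subst lborel_complex_eq, subst nn_integral_distr) auto
  then show ?thesis
    by (simp add: case_prod_beta lborel_prod)
qed

lemma nn_integral_complex:
  fixes f :: "complex \<Rightarrow> ennreal"
  assumes [measurable]: "f \<in> borel_measurable borel"
  shows "(\<integral>\<^sup>+z. f z \<partial>lborel) = (\<integral>\<^sup>+x. \<integral>\<^sup>+y. f (Complex x y) \<partial>lborel \<partial>lborel)" (is ?A)
    and "(\<integral>\<^sup>+z. f z \<partial>lborel) = (\<integral>\<^sup>+y. \<integral>\<^sup>+x. f (Complex x y) \<partial>lborel \<partial>lborel)" (is ?B)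
proof -
  have *: "(\<integral>\<^sup>+z. f z \<partial>lborel) = (\<integral>\<^sup>+p. f (Complex (fst p) (snd p)) \<partial>(lborel \<Otimes>\<^sub>M lborel))"
    by (simp add: nn_integral_complex_pair lborel_prod)
  show ?A unfolding * by (subst lborel.nn_integral_fst[symmetric]) auto
  show ?B unfolding * by (subst lborel_pair.nn_integral_snd[symmetric]) auto
qed

section \<open>Area means of holomorphic functions\<close>

text \<open>
  Averages over squares take the place of averages over discs.  A square is a union of concentric
  square contours, and Fubini's theorem in Cartesian coordinates integrates Cauchy's formula over
  these contours.
\<close>
lemma norm_contour_integral_vertical:
  assumes "a < b" "continuous_on (closed_segment (Complex c a) (Complex c b)) f"
  shows "cmod (contour_integral (linepath (Complex c a) (Complex c b)) f)
           \<le> integral {a..b} (\<lambda>t. cmod (f (Complex c t)))"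
proof -
  have img: "Complex c ` {a..b} \<subseteq> closed_segment (Complex c a) (Complex c b)"
    using assms(1) by (subst closed_segment_same_Re) (auto simp: closed_segment_eq_real_ivl)
  have cont: "continuous_on {a..b} (\<lambda>t. f (Complex c t))"
    by (rule continuous_on_compose2[OF assms(2) _ img]) (intro continuous_intros)
  have "contour_integral (linepath (Complex c a) (Complex c b)) f = \<i> * integral {a..b} (\<lambda>x. f (Complex c x))"
    using assms(1) by (intro contour_integral_linepath_same_Re) auto
  moreover have "cmod (integral {a..b} (\<lambda>x. f (Complex c x))) \<le> integral {a..b} (\<lambda>t. cmod (f (Complex c t)))"
    by (intro integral_norm_bound_integral integrable_continuous_interval continuous_intros cont) auto
  ultimately show ?thesis by (simp add: norm_mult)
qed

lemma norm_contour_integral_horizontal: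
  assumes "a < b" "continuous_on (closed_segment (Complex a c) (Complex b c)) f"
  shows "cmod (contour_integral (linepath (Complex a c) (Complex b c)) f)
           \<le> integral {a..b} (\<lambda>t. cmod (f (Complex t c)))"
proof -
  have img: "(\<lambda>t. Complex t c) ` {a..b} \<subseteq> closed_segment (Complex a c) (Complex b c)"
    using assms(1) by (subst closed_segment_same_Im) (auto simp: closed_segment_eq_real_ivl)
  have cont: "continuous_on {a..b} (\<lambda>t. f (Complex t c))"
    by (rule continuous_on_compose2[OF assms(2) _ img]) (intro continuous_intros)
  have shift: "linepath (Complex a c) (Complex b c) = (+) (Complex 0 c) \<circ> linepath (of_real a) (of_real b)"
    by (rule ext) (simp add: linepath_def complex_eq_iff algebra_simps)
  have eq: "Complex 0 c + of_real t = Complex t c" "of_real t + Complex 0 c = Complex t c" for t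
    by (simp_all add: complex_eq_iff)
  have "contour_integral (linepath (Complex a c) (Complex b c)) f = integral {a..b} (\<lambda>x. f (Complex x c))"
    unfolding shift contour_integral_translate using assms(1)
    by (subst contour_integral_linepath_Reals_eq) (auto simp: eq)
  moreover have "cmod (integral {a..b} (\<lambda>x. f (Complex x c))) \<le> integral {a..b} (\<lambda>t. cmod (f (Complex t c)))"
    by (intro integral_norm_bound_integral integrable_continuous_interval continuous_intros cont) auto
  ultimately show ?thesis by simp
qed

abbreviation csquare :: "complex \<Rightarrow> real \<Rightarrow> complex set" where
  "csquare z r \<equiv> cbox (z - Complex r r) (z + Complex r r)"

lemma mem_csquare: "w \<in> csquare z r \<longleftrightarrow> \<bar>Re w - Re z\<bar> \<le> r \<and> \<bar>Im w - Im z\<bar> \<le> r"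
  by (auto simp: in_cbox_complex_iff abs_le_iff)
text \<open>Cauchy's formula on the boundary of the square of half-side \<open>r\<close>, where \<open>|w - z| \<ge> r\<close>.\<close>
lemma Cauchy_bound_square:
  assumes hol: "p holomorphic_on csquare z R" and r: "0 < r" "r \<le> R"
  shows "2 * pi * r * cmod (p z) \<le>
     integral {Im z - r..Im z + r} (\<lambda>t. cmod (p (Complex (Re z + r) t)))
   + integral {Im z - r..Im z + r} (\<lambda>t. cmod (p (Complex (Re z - r) t)))
   + integral {Re z - r..Re z + r} (\<lambda>t. cmod (p (Complex t (Im z + r))))
   + integral {Re z - r..Re z + r} (\<lambda>t. cmod (p (Complex t (Im z - r))))"
proof -
  define x y where "x = Re z" and "y = Im z"
  have z: "z = Complex x y" by (simp add: x_def y_def)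
  define q where "q = (\<lambda>w. p w / (w - z))"
  define B where "B = {w. (Re w \<in> {x - r, x + r} \<and> Im w \<in> {y - r..y + r}) \<or> (Im w \<in> {y - r, y + r} \<and> Re w \<in> {x - r..x + r})}"
  have BS: "B \<subseteq> csquare z R - {z}"
    using r by (auto simp: B_def in_cbox_complex_iff z)
  have contp: "continuous_on B p"
    using holomorphic_on_imp_continuous_on[OF hol] BS continuous_on_subset by blast
  then have contq: "continuous_on B q"
    unfolding q_def using BS by (intro continuous_intros) auto
  have qle: "cmod (q w) \<le> cmod (p w) / r" if "w \<in> B" for w
  proof -
    have "r \<le> cmod (w - z)"
      using that abs_Re_le_cmod[of "w - z"] abs_Im_le_cmod[of "w - z"] r by (auto simp: B_def z)
    then show ?thesis using r by (auto simp: q_def norm_divide intro!: divide_left_mono mult_pos_pos)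
  qed
  let ?a1 = "Complex (x - r) (y - r)" and ?a3 = "Complex (x + r) (y + r)"
  let ?a2 = "Complex (x + r) (y - r)" and ?a4 = "Complex (x - r) (y + r)"
  have path: "path_image (rectpath ?a1 ?a3) = B"
    using r by (subst path_image_rectpath) (auto simp: B_def)
  have "(q has_contour_integral (2*pi * \<i> * winding_number (rectpath ?a1 ?a3) z * p z)) (rectpath ?a1 ?a3)"
    unfolding q_def
  proof (rule Cauchy_integral_formula_convex_simple[OF convex_box(1)[of "z - Complex R R" "z + Complex R R"] hol])
    show "z \<in> interior (csquare z R)" using r by (simp add: in_box_complex_iff)
    show "path_image (rectpath ?a1 ?a3) \<subseteq> csquare z R - {z}" using path BS by simp
  qed simp_all
  also have "winding_number (rectpath ?a1 ?a3) z = 1"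
    using r by (intro winding_number_rectpath) (simp add: in_box_complex_iff z)
  finally have c: "contour_integral (rectpath ?a1 ?a3) q = 2 * pi * \<i> * p z"
    by (simp add: contour_integral_unique)
  have seg: "closed_segment ?a1 ?a2 \<subseteq> B" "closed_segment ?a2 ?a3 \<subseteq> B" "closed_segment ?a4 ?a3 \<subseteq> B" "closed_segment ?a1 ?a4 \<subseteq> B"
    using r by (auto simp: B_def closed_segment_same_Re closed_segment_same_Im closed_segment_eq_real_ivl)
  have ci: "q contour_integrable_on linepath ?a1 ?a2" "q contour_integrable_on linepath ?a2 ?a3"
      "q contour_integrable_on linepath ?a4 ?a3" "q contour_integrable_on linepath ?a1 ?a4"
      "q contour_integrable_on linepath ?a3 ?a4" "q contour_integrable_on linepath ?a4 ?a1"
    by (intro contour_integrable_continuous_linepath continuous_on_subset[OF contq] seg; simp add: closed_segment_commute seg)+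
  have "contour_integral (rectpath ?a1 ?a3) q = contour_integral (linepath ?a1 ?a2) q + contour_integral (linepath ?a2 ?a3) q
      - contour_integral (linepath ?a4 ?a3) q - contour_integral (linepath ?a1 ?a4) q"
    using ci contour_integral_reverse_linepath[of ?a4 ?a3 q] contour_integral_reverse_linepath[of ?a1 ?a4 q]
      continuous_on_subset[OF contq seg(3)] continuous_on_subset[OF contq seg(4)]
    by (simp add: rectpath_def Let_def)
  moreover have tri: "cmod (a1 + a2 - a3 - a4) \<le> cmod a1 + cmod a2 + cmod a3 + cmod a4" for a1 a2 a3 a4
    by (intro order_trans[OF norm_triangle_ineq4] add_mono order_trans[OF norm_triangle_ineq] order_refl)
  moreover have "cmod (contour_integral (rectpath ?a1 ?a3) q) = 2 * pi * cmod (p z)"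
    by (simp add: c norm_mult)
  ultimately have "2 * pi * cmod (p z) \<le> cmod (contour_integral (linepath ?a1 ?a2) q) + cmod (contour_integral (linepath ?a2 ?a3) q)
      + cmod (contour_integral (linepath ?a4 ?a3) q) + cmod (contour_integral (linepath ?a1 ?a4) q)"
    by metis
  also have "\<dots> \<le> integral {x - r..x + r} (\<lambda>t. cmod (q (Complex t (y - r)))) + integral {y - r..y + r} (\<lambda>t. cmod (q (Complex (x + r) t)))
      + integral {x - r..x + r} (\<lambda>t. cmod (q (Complex t (y + r)))) + integral {y - r..y + r} (\<lambda>t. cmod (q (Complex (x - r) t)))"
    using r seg by (intro add_mono norm_contour_integral_vertical norm_contour_integral_horizontal continuous_on_subset[OF contq]) auto
  also have "\<dots> \<le> integral {x - r..x + r} (\<lambda>t. cmod (p (Complex t (y - r))) / r) + integral {y - r..y + r} (\<lambda>t. cmod (p (Complex (x + r) t)) / r)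
      + integral {x - r..x + r} (\<lambda>t. cmod (p (Complex t (y + r))) / r) + integral {y - r..y + r} (\<lambda>t. cmod (p (Complex (x - r) t)) / r)"
  proof -
    have le: "integral {a..b} (\<lambda>t. cmod (q (h t))) \<le> integral {a..b} (\<lambda>t. cmod (p (h t)) / r)"
      if h: "continuous_on {a..b} h" and hB: "h ` {a..b} \<subseteq> B" for a b and h :: "real \<Rightarrow> complex"
      by (rule integral_le; (intro integrable_continuous_interval continuous_intros
            continuous_on_compose2[OF contp h hB] continuous_on_compose2[OF contq h hB])?) 
        (use qle hB r in \<open>auto simp: image_subset_iff\<close>)
    show ?thesis
      by (intro add_mono le continuous_intros) (use r in \<open>auto simp: B_def\<close>)
  qed
  finally have "2 * pi * cmod (p z) \<le> (integral {y - r..y + r} (\<lambda>t. cmod (p (Complex (x + r) t)))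
   + integral {y - r..y + r} (\<lambda>t. cmod (p (Complex (x - r) t)))
   + integral {x - r..x + r} (\<lambda>t. cmod (p (Complex t (y + r))))
   + integral {x - r..x + r} (\<lambda>t. cmod (p (Complex t (y - r))))) / r"
    by (simp add: add_divide_distrib algebra_simps)
  then show ?thesis
    using r by (simp add: pos_le_divide_eq x_def y_def mult.commute mult.left_commute)
qed

text \<open>
  Integrate the previous estimate over \<open>r \<in> [R/2, R]\<close>.  Each of the four sides then sweeps out a part of
  the square, and its contribution is at most the integral over the whole square.
\<close>
lemma area_mean_bound:
  assumes hol: "p holomorphic_on csquare z R" and R: "0 < R"
  shows "ennreal (R\<^sup>2 * cmod (p z)) \<le> 3 * (\<integral>\<^sup>+w. ennreal (cmod (p w)) * indicator (csquare z R) w \<partial>lborel)"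
proof -
  define x y where "x = Re z" and "y = Im z"
  define Q where "Q = (\<lambda>w. ennreal (cmod (p w)) * indicator (csquare z R) w)"
  have contp: "continuous_on (csquare z R) p"
    by (rule holomorphic_on_imp_continuous_on[OF hol])
  have Qeq: "Q = (\<lambda>w. ennreal (indicator (csquare z R) w *\<^sub>R cmod (p w)))"
    by (auto simp: Q_def indicator_def)
  have [measurable]: "Q \<in> borel_measurable borel"
    unfolding Qeq
    by (intro measurable_compose[OF borel_measurable_continuous_on_indicator measurable_ennreal])
       (auto intro!: continuous_intros contp)
  define T where "T = (\<integral>\<^sup>+w. Q w \<partial>lborel)"
  \<comment> \<open>\<open>Q\<close> vanishes off the square, so all integrals may run over the whole line.\<close>
  let ?S = "\<lambda>r t. Q (Complex (x + r) t) + Q (Complex (x - r) t) + Q (Complex t (y + r)) + Q (Complex t (y - r))"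
  have bound: "ennreal (pi * R * cmod (p z)) \<le> (\<integral>\<^sup>+t. ?S r t \<partial>lborel)" if r: "r \<in> {R/2..R}" for r
  proof -
    have r0: "0 < r" "r \<le> R" using r R by auto
    have int: "ennreal (integral {a..b} (\<lambda>t. cmod (p (h t)))) \<le> (\<integral>\<^sup>+t. Q (h t) \<partial>lborel)"
      if h: "continuous_on UNIV h" and hB: "h ` {a..b} \<subseteq> csquare z R" for a b and h :: "real \<Rightarrow> complex"
    proof -
      have "((\<lambda>t. cmod (p (h t))) has_integral integral {a..b} (\<lambda>t. cmod (p (h t)))) {a..b}"
        by (intro integrable_integral integrable_continuous_interval continuous_intros
          continuous_on_compose2[OF contp continuous_on_subset[OF h] hB]) auto
      then have "ennreal (integral {a..b} (\<lambda>t. cmod (p (h t)))) = (\<integral>\<^sup>+t. ennreal (cmod (p (h t))) * indicator {a..b} t \<partial>lborel)"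
        by (subst nn_integral_has_integral_lebesgue'[symmetric]) auto
      also have "\<dots> \<le> (\<integral>\<^sup>+t. Q (h t) \<partial>lborel)"
        using hB by (intro nn_integral_mono) (auto simp: Q_def indicator_def image_subset_iff)
      finally show ?thesis .
    qed
    have "ennreal (pi * R * cmod (p z)) \<le> ennreal (2 * pi * r * cmod (p z))"
      using r R by (intro ennreal_leI mult_right_mono) auto
    also have "\<dots> \<le> ennreal (integral {y - r..y + r} (\<lambda>t. cmod (p (Complex (x + r) t)))
   + integral {y - r..y + r} (\<lambda>t. cmod (p (Complex (x - r) t)))
   + integral {x - r..x + r} (\<lambda>t. cmod (p (Complex t (y + r))))
   + integral {x - r..x + r} (\<lambda>t. cmod (p (Complex t (y - r)))))"
      unfolding x_def y_def by (intro ennreal_leI Cauchy_bound_square[OF hol] r0)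
    also have "\<dots> = ennreal (integral {y - r..y + r} (\<lambda>t. cmod (p (Complex (x + r) t))))
   + ennreal (integral {y - r..y + r} (\<lambda>t. cmod (p (Complex (x - r) t))))
   + ennreal (integral {x - r..x + r} (\<lambda>t. cmod (p (Complex t (y + r)))))
   + ennreal (integral {x - r..x + r} (\<lambda>t. cmod (p (Complex t (y - r)))))"
    proof -
      have nn: "0 \<le> integral {a..b} (\<lambda>t. cmod (p (h t)))" for a b and h :: "real \<Rightarrow> complex"
        by (cases "(\<lambda>t. cmod (p (h t))) integrable_on {a..b}")
           (auto intro: integral_nonneg simp: not_integrable_integral)
      show ?thesis by (simp add: nn add_nonneg_nonneg)
    qed
    also have "\<dots> \<le> (\<integral>\<^sup>+t. Q (Complex (x + r) t) \<partial>lborel) + (\<integral>\<^sup>+t. Q (Complex (x - r) t) \<partial>lborel)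
        + (\<integral>\<^sup>+t. Q (Complex t (y + r)) \<partial>lborel) + (\<integral>\<^sup>+t. Q (Complex t (y - r)) \<partial>lborel)"
      by (intro add_mono int continuous_intros)
        (use r0 in \<open>auto simp: in_cbox_complex_iff x_def y_def\<close>)
    also have "\<dots> = (\<integral>\<^sup>+t. ?S r t \<partial>lborel)"
      by (simp add: nn_integral_add)
    finally show ?thesis .
  qed
  have T1: "(\<integral>\<^sup>+r. \<integral>\<^sup>+t. Q (Complex (x + r) t) \<partial>lborel \<partial>lborel) = T"
      "(\<integral>\<^sup>+r. \<integral>\<^sup>+t. Q (Complex (x - r) t) \<partial>lborel \<partial>lborel) = T"
    unfolding T_def using nn_integral_real_affine[of "\<lambda>r. \<integral>\<^sup>+t. Q (Complex r t) \<partial>lborel" 1 x]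
      nn_integral_real_affine[of "\<lambda>r. \<integral>\<^sup>+t. Q (Complex r t) \<partial>lborel" "-1" x]
    by (simp_all add: nn_integral_complex(1))
  have T2: "(\<integral>\<^sup>+r. \<integral>\<^sup>+t. Q (Complex t (y + r)) \<partial>lborel \<partial>lborel) = T"
      "(\<integral>\<^sup>+r. \<integral>\<^sup>+t. Q (Complex t (y - r)) \<partial>lborel \<partial>lborel) = T"
    unfolding T_def using nn_integral_real_affine[of "\<lambda>r. \<integral>\<^sup>+t. Q (Complex t r) \<partial>lborel" 1 y]
      nn_integral_real_affine[of "\<lambda>r. \<integral>\<^sup>+t. Q (Complex t r) \<partial>lborel" "-1" y]
    by (simp_all add: nn_integral_complex(2))
  have "ennreal (pi * R * cmod (p z)) * ennreal (R / 2) = (\<integral>\<^sup>+r. ennreal (pi * R * cmod (p z)) * indicator {R/2..R} r \<partial>lborel)"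
    using R by (subst nn_integral_cmult_indicator) (auto simp: field_simps)
  also have "\<dots> \<le> (\<integral>\<^sup>+r. \<integral>\<^sup>+t. ?S r t \<partial>lborel \<partial>lborel)"
    using bound by (intro nn_integral_mono) (auto simp: indicator_def)
  also have "\<dots> = T + T + T + T"
    by (simp add: nn_integral_add T1 T2)
  also have "\<dots> = 4 * T"
    by (metis (no_types, lifting) mult_2 numeral_Bit0 add.assoc distrib_right numeral_One mult_1)
  finally have main: "ennreal (pi * R * cmod (p z)) * ennreal (R / 2) \<le> 4 * T" .
  show ?thesis
  proof (cases T)
    case (real t)
    have "pi * R * cmod (p z) * (R / 2) \<le> 4 * t"
      using main R real by (simp add: ennreal_mult[symmetric] ennreal_numeral[symmetric] del: ennreal_numeral)
    moreover have "3 * (R\<^sup>2 * cmod (p z)) \<le> pi * (R\<^sup>2 * cmod (p z))"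
      using pi_gt3 by (intro mult_right_mono) auto
    ultimately have "R\<^sup>2 * cmod (p z) \<le> 3 * t"
      using real by (simp add: power2_eq_square field_simps)
    then have "ennreal (R\<^sup>2 * cmod (p z)) \<le> ennreal 3 * ennreal t"
      using real by (subst ennreal_mult[symmetric]) auto
    then show ?thesis using real by (simp add: T_def Q_def)
  next
    case top
    then show ?thesis by (simp add: T_def Q_def ennreal_mult_top)
  qed
qed

section \<open>The Carleson condition as an integral\<close>

lemma open_upper_half_plane [simp]: "open upper_half_plane"
  unfolding upper_half_plane_def by (rule open_halfspace_Im_gt)

lemma Complex_in_uhp [simp]: "Complex x y \<in> upper_half_plane \<longleftrightarrow> 0 < y"
  by (simp add: upper_half_plane_def)

lemma sets_carleson_box [measurable]: "carleson_box a b \<in> sets borel"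
proof -
  have "carleson_box a b = {z. a < Re z} \<inter> {z. Re z < b} \<inter> {z. 0 < Im z} \<inter> {z. Im z < b - a}"
    by (auto simp: carleson_box_def)
  then show ?thesis
    by (auto intro!: borel_open open_halfspace_Re_gt open_halfspace_Re_lt open_halfspace_Im_gt open_halfspace_Im_lt)
qed

lemma carleson_box_subset_uhp: "carleson_box a b \<subseteq> upper_half_plane"
  by (auto simp: carleson_box_def upper_half_plane_def)

lemma measurable_continuous_times_indicator:
  fixes f :: "complex \<Rightarrow> real"
  assumes "continuous_on U f" "open U" and A [measurable]: "A \<in> sets borel" and "A \<subseteq> U"
  shows "(\<lambda>z. ennreal (f z) * indicator A z) \<in> borel_measurable borel"
proof -
  have [measurable]: "(\<lambda>z. indicator U z *\<^sub>R f z) \<in> borel_measurable borel"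
    using assms by (intro borel_measurable_continuous_on_indicator) (auto intro: borel_open)
  have "(\<lambda>z. ennreal (indicator U z *\<^sub>R f z) * indicator A z) \<in> borel_measurable borel"
    by measurable
  also have "(\<lambda>z. ennreal (indicator U z *\<^sub>R f z) * indicator A z) = (\<lambda>z. ennreal (f z) * indicator A z)"
    using \<open>A \<subseteq> U\<close> by (auto simp: indicator_def fun_eq_iff)
  finally show ?thesis .
qed

text \<open>The form in which the Carleson condition is used: a bound for integrals over all of \<open>\<complex>\<close>.\<close>
lemma bmoa_iff:
  "g \<in> bmoa \<longleftrightarrow> g holomorphic_on upper_half_plane \<and>
    (\<exists>C\<ge>0. \<forall>a b. a < b \<longrightarrow>
       (\<integral>\<^sup>+z. ennreal ((cmod (deriv g z))\<^sup>2 * Im z) * indicator (carleson_box a b) z \<partial>lborel) \<le> ennreal (C * (b - a)))"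
proof (cases "g holomorphic_on upper_half_plane")
  case True
  let ?U = upper_half_plane
  let ?F = "\<lambda>z. ennreal ((cmod (deriv g z))\<^sup>2 * Im z)"
  let ?M = "restrict_space lborel ?U"
  have U: "?U \<inter> space lborel \<in> sets lborel" by (simp add: borel_open)
  have cont: "continuous_on ?U (deriv g)"
    by (intro holomorphic_on_imp_continuous_on holomorphic_deriv True) simp
  have S: "sets ?M = sets (restrict_space borel ?U)"
    by (rule sets_restrict_space_cong) simp
  have [measurable]: "(\<lambda>z. (cmod (deriv g z))\<^sup>2 * Im z) \<in> borel_measurable (restrict_space borel ?U)"
    by (intro borel_measurable_continuous_on_restrict continuous_intros cont)
  then have meas: "?F \<in> borel_measurable ?M"
    unfolding measurable_cong_sets[OF S refl] by measurable
  have "emeasure (density ?M ?F) (carleson_box a b) = (\<integral>\<^sup>+z. ?F z * indicator (carleson_box a b) z \<partial>lborel)" for a b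
  proof -
    have "carleson_box a b \<in> sets ?M"
      using carleson_box_subset_uhp[of a b] sets_carleson_box[of a b]
      by (auto simp: sets_restrict_space_iff[OF U])
    then have "emeasure (density ?M ?F) (carleson_box a b) = (\<integral>\<^sup>+z. ?F z * indicator (carleson_box a b) z * indicator ?U z \<partial>lborel)"
      by (simp add: emeasure_density[OF meas] nn_integral_restrict_space[OF U])
    also have "\<dots> = (\<integral>\<^sup>+z. ?F z * indicator (carleson_box a b) z \<partial>lborel)"
      using carleson_box_subset_uhp[of a b] by (intro nn_integral_cong) (auto simp: indicator_def)
    finally show ?thesis .
  qed
  moreover have "sets (density ?M ?F) = sets (restrict_space borel ?U)"
    using S by simp
  ultimately show ?thesis
    using True by (simp add: bmoa_def carleson_measure_def)
qed (simp add: bmoa_def)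

section \<open>Bounded imaginary part implies BMOA\<close>

text \<open>The Cauchy--Riemann equations, for functions given in the coordinates \<open>x\<close> and \<open>y\<close>.\<close>
lemma holomorphic_partial_derivatives:
  assumes "(G has_field_derivative D) (at (Complex x y))"
  shows "((\<lambda>t. Re (G (Complex t y))) has_real_derivative Re D) (at x)"
    and "((\<lambda>t. Im (G (Complex t y))) has_real_derivative Im D) (at x)"
    and "((\<lambda>t. Re (G (Complex x t))) has_real_derivative - Im D) (at y)"
    and "((\<lambda>t. Im (G (Complex x t))) has_real_derivative Re D) (at y)"
proof -
  have hx: "((\<lambda>t. Complex 0 y + of_real t) has_vector_derivative 1) (at x)"
    by (auto intro!: derivative_eq_intros)
  have hy: "((\<lambda>t. of_real x + of_real t * \<i>) has_vector_derivative \<i>) (at y)"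
    by (auto intro!: derivative_eq_intros)
  have eq: "Complex 0 y + of_real t = Complex t y" "of_real x + of_real t * \<i> = Complex x t" for t
    by (simp_all add: complex_eq_iff)
  have gx: "((\<lambda>t. G (Complex t y)) has_vector_derivative D) (at x)"
    using field_vector_diff_chain_at[OF hx, of G D] assms by (simp add: eq o_def)
  have gy: "((\<lambda>t. G (Complex x t)) has_vector_derivative (\<i> * D)) (at y)"
    using field_vector_diff_chain_at[OF hy, of G D] assms by (simp add: eq o_def)
  note c = bounded_linear.has_vector_derivative[OF bounded_linear_Re] bounded_linear.has_vector_derivative[OF bounded_linear_Im]
  show "((\<lambda>t. Re (G (Complex t y))) has_real_derivative Re D) (at x)"
    "((\<lambda>t. Im (G (Complex t y))) has_real_derivative Im D) (at x)"
    "((\<lambda>t. Re (G (Complex x t))) has_real_derivative - Im D) (at y)"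
    "((\<lambda>t. Im (G (Complex x t))) has_real_derivative Re D) (at y)"
    using c(1)[OF gx] c(2)[OF gx] c(1)[OF gy] c(2)[OF gy] by (simp_all add: has_real_derivative_iff_has_vector_derivative)
qed

text \<open>
  Green's formula for \<open>P = (Im G)\<^sup>2\<close>, whose Laplacian is \<open>2 |G'|\<^sup>2\<close>, against a product weight \<open>X(x) w(y)\<close>.
  The weight \<open>X\<close> vanishes to second order at both ends, and \<open>w\<close> to second order at the top but only to
  first order at the bottom; this is the origin of the one boundary term.
\<close>
lemma energy_identity:
  fixes X X' X'' w w' w'' :: "real \<Rightarrow> real"
  assumes hol: "G holomorphic_on U" and U: "open U" and sub: "\<And>x y. x \<in> {a..b} \<Longrightarrow> y \<in> {c..d} \<Longrightarrow> Complex x y \<in> U"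
    and ab: "a \<le> b" "c \<le> d"
    and X: "\<And>x. (X has_real_derivative X' x) (at x)" "\<And>x. (X' has_real_derivative X'' x) (at x)"
       "X a = 0" "X b = 0" "X' a = 0" "X' b = 0"
    and w: "\<And>x. (w has_real_derivative w' x) (at x)" "\<And>x. (w' has_real_derivative w'' x) (at x)"
       "w c = 0" "w d = 0" "w' d = 0"
    and cont: "continuous_on UNIV X''" "continuous_on UNIV w''"
  shows "integral (cbox (a, c) (b, d)) (\<lambda>(x, y). X x * w y * (2 * (cmod (deriv G (Complex x y)))\<^sup>2))
       = integral {a..b} (\<lambda>x. X x * w' c * (Im (G (Complex x c)))\<^sup>2)
       + integral (cbox (a, c) (b, d)) (\<lambda>(x, y). (X'' x * w y + X x * w'' y) * (Im (G (Complex x y)))\<^sup>2)"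
proof -
  define G1 where "G1 = deriv G"
  define G2 where "G2 = deriv G1"
  have hol1: "G1 holomorphic_on U" unfolding G1_def by (intro holomorphic_deriv hol U)
  have hol2: "G2 holomorphic_on U" unfolding G2_def by (intro holomorphic_deriv hol1 U)
  have D: "(G has_field_derivative G1 z) (at z)" "(G1 has_field_derivative G2 z) (at z)" if "z \<in> U" for z
    unfolding G2_def using holomorphic_derivI[OF hol1 U that] holomorphic_derivI[OF hol U that]
    by (simp_all add: G1_def[symmetric])
  \<comment> \<open>\<open>P\<close> and its partial derivatives, from \<open>G1 = G'\<close> and \<open>G2 = G''\<close>.\<close>
  let ?P = "\<lambda>x y. (Im (G (Complex x y)))\<^sup>2"
  let ?Px = "\<lambda>x y. 2 * Im (G (Complex x y)) * Im (G1 (Complex x y))"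
  let ?Py = "\<lambda>x y. 2 * Im (G (Complex x y)) * Re (G1 (Complex x y))"
  let ?Pxx = "\<lambda>x y. 2 * (Im (G1 (Complex x y)))\<^sup>2 + 2 * Im (G (Complex x y)) * Im (G2 (Complex x y))"
  let ?Pyy = "\<lambda>x y. 2 * (Re (G1 (Complex x y)))\<^sup>2 - 2 * Im (G (Complex x y)) * Im (G2 (Complex x y))"
  have dP: "((\<lambda>t. ?P t y) has_real_derivative ?Px x y) (at x)" "((\<lambda>t. ?Px t y) has_real_derivative ?Pxx x y) (at x)"
     "((\<lambda>t. ?P x t) has_real_derivative ?Py x y) (at y)" "((\<lambda>t. ?Py x t) has_real_derivative ?Pyy x y) (at y)"
    if "x \<in> {a..b}" "y \<in> {c..d}" for x y
  proof -
    note h = holomorphic_partial_derivatives[OF D(1)[OF sub[OF that]]]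
    note h1 = holomorphic_partial_derivatives[OF D(2)[OF sub[OF that]]]
    have sq: "((\<lambda>t. (v t)\<^sup>2) has_real_derivative 2 * v s * v') (at s)" if "(v has_real_derivative v') (at s)" for v v' and s :: real
      using that by (auto intro!: derivative_eq_intros)
    have mul: "((\<lambda>t. 2 * v t * u t) has_real_derivative 2 * v' * u s + 2 * v s * u') (at s)"
      if "(v has_real_derivative v') (at s)" "(u has_real_derivative u') (at s)" for v v' u u' and s :: real
      using that by (auto intro!: derivative_eq_intros)
    show "((\<lambda>t. ?P t y) has_real_derivative ?Px x y) (at x)" by (rule sq[OF h(2)])
    show "((\<lambda>t. ?P x t) has_real_derivative ?Py x y) (at y)" by (rule sq[OF h(4)])
    show "((\<lambda>t. ?Px t y) has_real_derivative ?Pxx x y) (at x)"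
      by (rule DERIV_cong[OF mul[OF h(2) h1(2)]]) (simp add: power2_eq_square)
    show "((\<lambda>t. ?Py x t) has_real_derivative ?Pyy x y) (at y)"
      by (rule DERIV_cong[OF mul[OF h(4) h1(3)]]) (simp add: power2_eq_square)
  qed
  have byparts: "((\<lambda>s. u s * p'' s - u'' s * p s) has_integral (u r * p' r - u' r * p r) - (u l * p' l - u' l * p l)) {l..r}"
    if "l \<le> r" "\<And>s. (u has_real_derivative u' s) (at s)" "\<And>s. (u' has_real_derivative u'' s) (at s)"
      "\<And>s. s \<in> {l..r} \<Longrightarrow> (p has_real_derivative p' s) (at s)" "\<And>s. s \<in> {l..r} \<Longrightarrow> (p' has_real_derivative p'' s) (at s)"
    for u u' u'' p p' p'' :: "real \<Rightarrow> real" and l r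
  proof (rule fundamental_theorem_of_calculus[OF that(1)])
    fix s assume s: "s \<in> {l..r}"
    have "((\<lambda>s. u s * p' s - u' s * p s) has_real_derivative u s * p'' s - u'' s * p s) (at s)"
      by (rule DERIV_cong[OF DERIV_diff[OF DERIV_mult[OF that(2) that(5)[OF s]] DERIV_mult[OF that(3) that(4)[OF s]]]]) (simp add: algebra_simps)
    then show "((\<lambda>s. u s * p' s - u' s * p s) has_vector_derivative u s * p'' s - u'' s * p s) (at s within {l..r})"
      by (simp add: has_real_derivative_iff_has_vector_derivative has_vector_derivative_at_within)
  qed
  have contX: "continuous_on S X" "continuous_on S X'" "continuous_on S X''" for S
    using X cont by (meson DERIV_isCont continuous_at_imp_continuous_on continuous_on_subset subset_UNIV)+
  have contw: "continuous_on S w" "continuous_on S w'" "continuous_on S w''" for S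
    using w cont by (meson DERIV_isCont continuous_at_imp_continuous_on continuous_on_subset subset_UNIV)+
  let ?B = "cbox (a, c) (b, d)"
  have contG: "continuous_on U G" "continuous_on U G1" "continuous_on U G2"
    using hol hol1 hol2 by (auto intro: holomorphic_on_imp_continuous_on)
  have cc: "continuous_on ?B (\<lambda>p. g (Complex (fst p) (snd p)))" if "continuous_on U g" for g :: "complex \<Rightarrow> complex"
    by (rule continuous_on_compose2[OF that]) (auto intro!: continuous_intros sub)
  have cx: "continuous_on ?B (\<lambda>p. f (fst p))" "continuous_on ?B (\<lambda>p. f (snd p))" if "\<And>S. continuous_on S f" for f :: "real \<Rightarrow> real"
    by (rule continuous_on_compose2[OF that[of UNIV]]; auto intro!: continuous_intros)+
  note CI = continuous_intros cc[OF contG(1)] cc[OF contG(2)] cc[OF contG(3)] cx[OF contX(1)] cx[OF contX(3)] cx[OF contw(1)] cx[OF contw(3)]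
  define A1 where "A1 = (\<lambda>p::real \<times> real. w (snd p) * (X (fst p) * ?Pxx (fst p) (snd p) - X'' (fst p) * ?P (fst p) (snd p)))"
  define A2 where "A2 = (\<lambda>p::real \<times> real. X (fst p) * (w (snd p) * ?Pyy (fst p) (snd p) - w'' (snd p) * ?P (fst p) (snd p)))"
  have cA: "continuous_on ?B A1" "continuous_on ?B A2"
    unfolding A1_def A2_def by (intro CI)+
  have I1: "integral ?B A1 = 0"
  proof -
    have z: "integral {a..b} (\<lambda>x. A1 (x, y)) = 0" if y: "y \<in> {c..d}" for y
    proof -
      have "((\<lambda>x. X x * ?Pxx x y - X'' x * ?P x y) has_integral (X b * ?Px b y - X' b * ?P b y) - (X a * ?Px a y - X' a * ?P a y)) {a..b}"
        by (rule byparts[OF ab(1) X(1,2) dP(1,2)[OF _ y]])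
      then have "((\<lambda>x. w y * (X x * ?Pxx x y - X'' x * ?P x y)) has_integral w y * 0) {a..b}"
        by (intro has_integral_mult_right) (simp add: X)
      then show ?thesis unfolding A1_def fst_conv snd_conv mult_zero_right by (rule integral_unique)
    qed
    have "integral ?B A1 = integral {a..b} (\<lambda>x. integral {c..d} (\<lambda>y. A1 (x, y)))"
      using integral_prod_continuous[OF cA(1)] by simp
    also have "\<dots> = integral {c..d} (\<lambda>y. integral {a..b} (\<lambda>x. A1 (x, y)))"
      using integral_swap_continuous[of a c b d "\<lambda>x y. A1 (x, y)"] cA(1) by simp
    also have "\<dots> = integral {c..d} (\<lambda>y. 0)" using z by (intro integral_cong) auto
    finally show ?thesis by simp
  qed
  have I2: "integral ?B A2 = integral {a..b} (\<lambda>x. X x * w' c * ?P x c)"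
  proof -
    have z: "integral {c..d} (\<lambda>y. A2 (x, y)) = X x * w' c * ?P x c" if x: "x \<in> {a..b}" for x
    proof -
      have "((\<lambda>y. w y * ?Pyy x y - w'' y * ?P x y) has_integral (w d * ?Py x d - w' d * ?P x d) - (w c * ?Py x c - w' c * ?P x c)) {c..d}"
        by (rule byparts[OF ab(2) w(1,2) dP(3,4)[OF x]])
      then have "((\<lambda>y. X x * (w y * ?Pyy x y - w'' y * ?P x y)) has_integral X x * (w' c * ?P x c)) {c..d}"
        by (intro has_integral_mult_right) (simp add: w)
      then show ?thesis unfolding A2_def fst_conv snd_conv mult.assoc[of _ _ "(_::real)\<^sup>2"] by (rule integral_unique)
    qed
    have "integral ?B A2 = integral {a..b} (\<lambda>x. integral {c..d} (\<lambda>y. A2 (x, y)))"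
      using integral_prod_continuous[OF cA(2)] by simp
    also have "\<dots> = integral {a..b} (\<lambda>x. X x * w' c * ?P x c)" using z by (intro integral_cong) auto
    finally show ?thesis .
  qed
  define A3 where "A3 = (\<lambda>p::real \<times> real. (X'' (fst p) * w (snd p) + X (fst p) * w'' (snd p)) * ?P (fst p) (snd p))"
  have cA3: "continuous_on ?B A3" unfolding A3_def by (intro CI)
  have "integral ?B (\<lambda>p. A1 p + A2 p + A3 p) = integral ?B A1 + integral ?B A2 + integral ?B A3"
    using cA cA3 by (simp add: integral_add integrable_continuous integrable_add)
  moreover have "(\<lambda>p. A1 p + A2 p + A3 p) = (\<lambda>(x, y). X x * w y * (2 * (cmod (G1 (Complex x y)))\<^sup>2))"
    by (auto simp: A1_def A2_def A3_def cmod_power2 fun_eq_iff algebra_simps)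
  ultimately show ?thesis using I1 I2 by (simp add: A3_def case_prod_beta' G1_def)
qed

text \<open>
  The energy identity with polynomial weights adapted to the box, of side \<open>L = b - a\<close>: \<open>X\<close> lives on an
  interval twice as long and is bounded below on the box, and \<open>w\<close> is comparable to \<open>Im z - e\<close> there.
  Cutting the box off at height \<open>2 e\<close> makes \<open>Im z - e\<close> comparable to \<open>Im z\<close>; the bound does not depend
  on \<open>e\<close>.
\<close>
lemma bounded_Im_energy:
  assumes hol: "G holomorphic_on upper_half_plane" and M: "\<And>z. z \<in> upper_half_plane \<Longrightarrow> \<bar>Im (G z)\<bar> \<le> M"
    and ab: "a < b" and e: "0 < e"
  shows "(\<integral>\<^sup>+z. ennreal ((cmod (deriv G z))\<^sup>2 * Im z) * indicator (carleson_box a b \<inter> {z. 2 * e \<le> Im z}) z \<partial>lborel)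
     \<le> ennreal (555 * M\<^sup>2 * (b - a))"
proof -
  define L where "L = b - a"
  define m where "m = (a + b) / 2"
  have L: "0 < L" using ab by (simp add: L_def)
  define X where "X = (\<lambda>x. (1 - ((x - m) / L)\<^sup>2)\<^sup>2)"
  define X' where "X' = (\<lambda>x. - (4 / L) * ((x - m) / L) * (1 - ((x - m) / L)\<^sup>2))"
  define X'' where "X'' = (\<lambda>x. (12 * ((x - m) / L)\<^sup>2 - 4) / L\<^sup>2)"
  define w where "w = (\<lambda>y. (y - e) * (e + 2 * L - y)\<^sup>2 / (4 * L\<^sup>2))"
  define w' where "w' = (\<lambda>y. ((e + 2 * L - y)\<^sup>2 - 2 * (y - e) * (e + 2 * L - y)) / (4 * L\<^sup>2))"
  define w'' where "w'' = (\<lambda>y. (2 * (y - e) - 4 * (e + 2 * L - y)) / (4 * L\<^sup>2))"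
  let ?B = "cbox (m - L, e) (m + L, e + 2 * L)"
  let ?P = "\<lambda>x y. (Im (G (Complex x y)))\<^sup>2"
  have dX: "(X has_real_derivative X' x) (at x)" "(X' has_real_derivative X'' x) (at x)" for x
    unfolding X_def X'_def X''_def using L
    by (auto intro!: derivative_eq_intros simp: field_simps power2_eq_square)
  have dw: "(w has_real_derivative w' x) (at x)" "(w' has_real_derivative w'' x) (at x)" for x
    unfolding w_def w'_def w''_def using L
    by (auto intro!: derivative_eq_intros simp: field_simps power2_eq_square)
  have b0: "X (m - L) = 0" "X (m + L) = 0" "X' (m - L) = 0" "X' (m + L) = 0" "w e = 0" "w (e + 2 * L) = 0" "w' (e + 2 * L) = 0" "w' e = 1"
    using L by (simp_all add: X_def X'_def w_def w'_def power2_eq_square)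
  have cX'': "continuous_on UNIV X''" unfolding X''_def by (intro continuous_intros) (use L in auto)
  have cw'': "continuous_on UNIV w''" unfolding w''_def by (intro continuous_intros) (use L in auto)
  have sub: "Complex x y \<in> upper_half_plane" if "y \<in> {e..e + 2 * L}" for x y
    using that e by auto
  have P: "0 \<le> ?P x y" "?P x y \<le> M\<^sup>2" if "y \<in> {e..e + 2 * L}" for x y
    using order_trans[OF M[OF sub[OF that]] abs_ge_self] by (simp_all add: abs_le_square_iff[symmetric])
  have sbound: "((x - m) / L)\<^sup>2 \<le> 1" if "x \<in> {m - L..m + L}" for x
  proof -
    have "\<bar>(x - m) / L\<bar> \<le> \<bar>1\<bar>" using that L by (auto simp: abs_le_iff field_simps)
    then show ?thesis by (subst (asm) abs_le_square_iff) simp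
  qed
  have X01: "0 \<le> X x" "X x \<le> 1" "\<bar>X'' x\<bar> \<le> 8 / L\<^sup>2" if "x \<in> {m - L..m + L}" for x
  proof -
    define q where "q = ((x - m) / L)\<^sup>2"
    have q: "0 \<le> q" "q \<le> 1" using sbound[OF that] by (simp_all add: q_def)
    have "\<bar>12 * q - 4\<bar> \<le> 8" using q by (simp add: abs_le_iff)
    then have "\<bar>12 * q - 4\<bar> / L\<^sup>2 \<le> 8 / L\<^sup>2" by (rule divide_right_mono) simp
    then show "\<bar>X'' x\<bar> \<le> 8 / L\<^sup>2" by (simp add: X''_def q_def[symmetric])
    show "0 \<le> X x" "X x \<le> 1" using q by (simp_all add: X_def q_def[symmetric] power_le_one)
  qed
  have w01: "0 \<le> w y" "w y \<le> 2 * L" "\<bar>w'' y\<bar> \<le> 2 / L" if "y \<in> {e..e + 2 * L}" for y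
  proof -
    have "(e + 2 * L - y)\<^sup>2 \<le> (2 * L)\<^sup>2" using that L by (intro power_mono) auto
    then have "(y - e) * (e + 2 * L - y)\<^sup>2 \<le> (2 * L) * (2 * L)\<^sup>2"
      using that L by (intro mult_mono) auto
    then show "w y \<le> 2 * L" using L by (simp add: w_def field_simps power2_eq_square)
    show "0 \<le> w y" using that by (simp add: w_def)
    have "\<bar>2 * (y - e) - 4 * (e + 2 * L - y)\<bar> \<le> 8 * L" using that L by (auto simp: abs_le_iff)
    then show "\<bar>w'' y\<bar> \<le> 2 / L" using L by (simp add: w''_def field_simps power2_eq_square)
  qed
  define E where "E = (\<lambda>(x, y). X x * w y * (2 * (cmod (deriv G (Complex x y)))\<^sup>2))"
  have contG: "continuous_on upper_half_plane G" "continuous_on upper_half_plane (deriv G)"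
    using holomorphic_on_imp_continuous_on[OF holomorphic_deriv[OF hol open_upper_half_plane]]
      holomorphic_on_imp_continuous_on[OF hol] by auto
  have cc: "continuous_on ?B (\<lambda>p. g (Complex (fst p) (snd p)))" if "continuous_on upper_half_plane g" for g :: "complex \<Rightarrow> complex"
    by (rule continuous_on_compose2[OF that]) (use e in \<open>auto intro!: continuous_intros\<close>)
  have cE: "continuous_on ?B E"
    unfolding E_def case_prod_beta' X_def w_def by (intro continuous_intros cc contG) (use L in auto)
  have id: "integral ?B E = integral {m - L..m + L} (\<lambda>x. X x * w' e * ?P x e)
       + integral ?B (\<lambda>(x, y). (X'' x * w y + X x * w'' y) * ?P x y)"
    unfolding E_def using L b0
    by (intro energy_identity[OF hol open_upper_half_plane sub _ _ dX _ _ _ _ dw _ _ _ cX'' cw'']) auto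
  have i1: "integral {m - L..m + L} (\<lambda>x. X x * w' e * ?P x e) \<le> integral {m - L..m + L} (\<lambda>x. M\<^sup>2)"
  proof (rule integral_le)
    show "(\<lambda>x. X x * w' e * ?P x e) integrable_on {m - L..m + L}"
      unfolding X_def by (intro integrable_continuous_interval continuous_intros continuous_on_compose2[OF contG(1)])
        (use L e in auto)
    show "X x * w' e * ?P x e \<le> M\<^sup>2" if "x \<in> {m - L..m + L}" for x
      using mult_mono[OF X01(2)[OF that] P(2)[of e x]] X01(1)[OF that] L b0 by simp
  qed auto
  have i2: "integral ?B (\<lambda>(x, y). (X'' x * w y + X x * w'' y) * ?P x y) \<le> integral ?B (\<lambda>_. 18 / L * M\<^sup>2)"
  proof (rule integral_le)
    show "(\<lambda>(x, y). (X'' x * w y + X x * w'' y) * ?P x y) integrable_on ?B"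
      unfolding X_def w_def X''_def w''_def case_prod_beta' by (intro integrable_continuous continuous_intros cc contG) (use L in auto)
    show "(case p of (x, y) \<Rightarrow> (X'' x * w y + X x * w'' y) * ?P x y) \<le> 18 / L * M\<^sup>2" if "p \<in> ?B" for p
    proof -
      obtain x y where p: "p = (x, y)" by force
      have xy: "x \<in> {m - L..m + L}" "y \<in> {e..e + 2 * L}" using that p by auto
      have "\<bar>X'' x * w y\<bar> \<le> 8 / L\<^sup>2 * (2 * L)"
        unfolding abs_mult using X01(3)[OF xy(1)] w01(1,2)[OF xy(2)] by (intro mult_mono) auto
      moreover have "\<bar>X x * w'' y\<bar> \<le> 1 * (2 / L)"
        unfolding abs_mult using X01(1,2)[OF xy(1)] w01(3)[OF xy(2)] by (intro mult_mono) auto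
      ultimately have "X'' x * w y + X x * w'' y \<le> 18 / L"
        using L by (simp add: power2_eq_square)
      then have "(X'' x * w y + X x * w'' y) * ?P x y \<le> 18 / L * M\<^sup>2"
        using P[OF xy(2)] L by (intro mult_mono) auto
      then show ?thesis by (simp only: p case_prod_conv)
    qed
  qed auto
  have "integral ?B E \<le> 2 * L * M\<^sup>2 + 4 * L\<^sup>2 * (18 / L * M\<^sup>2)"
  proof -
    have "integral {m - L..m + L} (\<lambda>x. M\<^sup>2) = 2 * L * M\<^sup>2" using L by simp
    moreover have "integral ?B (\<lambda>_. 18 / L * M\<^sup>2) = 4 * L\<^sup>2 * (18 / L * M\<^sup>2)"
      using L by (simp add: content_Pair power2_eq_square)
    ultimately show ?thesis using id i1 i2 by linarith
  qed
  also have "4 * L\<^sup>2 * (18 / L * M\<^sup>2) = 72 * M\<^sup>2 * L" using L by (simp add: power2_eq_square)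
  finally have IE: "integral ?B E \<le> 74 * M\<^sup>2 * L" by (simp add: mult.commute mult.left_commute)
  have E0: "0 \<le> E p" if "p \<in> ?B" for p
    using that X01(1) w01(1) by (cases p) (auto simp: E_def)
  have pt: "(cmod (deriv G (Complex x y)))\<^sup>2 * y \<le> 15 / 2 * E (x, y) \<and> (x, y) \<in> ?B"
    if xy: "Complex x y \<in> carleson_box a b" "2 * e \<le> y" for x y
  proof -
    have x: "a < x" "x < b" and y: "0 < y" "y < L" using xy by (auto simp: carleson_box_def L_def)
    have B: "(x, y) \<in> ?B" using x y xy e by (auto simp: L_def m_def field_simps)
    have "\<bar>x - m\<bar> \<le> L / 2" using x by (simp add: L_def m_def abs_le_iff field_simps)
    then have "\<bar>(x - m) / L\<bar> \<le> 1 / 2" using L by (simp add: abs_divide field_simps)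
    then have "((x - m) / L)\<^sup>2 \<le> (1/2)\<^sup>2" by (subst abs_le_square_iff[symmetric]) simp
    then have "(3/4)\<^sup>2 \<le> X x" unfolding X_def by (intro power_mono) (auto simp: power2_eq_square)
    moreover have "y / 8 \<le> w y"
    proof -
      have "L\<^sup>2 \<le> (e + 2 * L - y)\<^sup>2" using y e by (intro power_mono) (use L in auto)
      then have "(y / 2) * L\<^sup>2 \<le> (y - e) * (e + 2 * L - y)\<^sup>2" using xy y by (intro mult_mono) auto
      then show ?thesis using L by (simp add: w_def field_simps)
    qed
    moreover have "0 \<le> X x" by (simp add: X_def)
    ultimately have "(3/4)\<^sup>2 * (y / 8) \<le> X x * w y" using y by (intro mult_mono) auto
    then have "y \<le> 15 * (X x * w y)" using y by (simp add: power2_eq_square)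
    then have "(cmod (deriv G (Complex x y)))\<^sup>2 * y \<le> (cmod (deriv G (Complex x y)))\<^sup>2 * (15 * (X x * w y))"
      by (intro mult_left_mono) auto
    then show ?thesis using B by (simp add: E_def algebra_simps)
  qed
  have meas: "(\<lambda>z. ennreal ((cmod (deriv G z))\<^sup>2 * Im z) * indicator (carleson_box a b \<inter> {z. 2 * e \<le> Im z}) z) \<in> borel_measurable borel"
    using carleson_box_subset_uhp[of a b]
    by (intro measurable_continuous_times_indicator[OF _ open_upper_half_plane] continuous_intros contG sets.Int
        sets_carleson_box borel_closed[OF closed_halfspace_Im_ge]) auto
  have "(\<integral>\<^sup>+z. ennreal ((cmod (deriv G z))\<^sup>2 * Im z) * indicator (carleson_box a b \<inter> {z. 2 * e \<le> Im z}) z \<partial>lborel)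
     = (\<integral>\<^sup>+p. ennreal ((cmod (deriv G (Complex (fst p) (snd p))))\<^sup>2 * snd p) * indicator (carleson_box a b \<inter> {z. 2 * e \<le> Im z}) (Complex (fst p) (snd p)) \<partial>lborel)"
    by (subst nn_integral_complex_pair[OF meas]) simp
  also have "\<dots> \<le> (\<integral>\<^sup>+p. ennreal (15 / 2 * E p) * indicator ?B p \<partial>lborel)"
    using pt by (intro nn_integral_mono) (auto simp: indicator_def split: prod.splits intro!: ennreal_leI)
  also have "\<dots> = ennreal (15 / 2 * integral ?B E)"
    using E0 by (intro nn_integral_has_integral_lebesgue' has_integral_mult_right integrable_integral integrable_continuous cE) auto
  also have "\<dots> \<le> ennreal (555 * M\<^sup>2 * (b - a))"
    using IE by (intro ennreal_leI) (simp add: L_def[symmetric] mult.commute mult.left_commute)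
  finally show ?thesis .
qed

text \<open>Let the cut-off height in the preceding bound tend to \<open>0\<close>.\<close>
lemma bounded_Im_bmoa:
  assumes hol: "G holomorphic_on upper_half_plane" and M: "\<And>z. z \<in> upper_half_plane \<Longrightarrow> \<bar>Im (G z)\<bar> \<le> M"
  shows "G \<in> bmoa"
  unfolding bmoa_iff
proof (intro conjI exI[of _ "555 * M\<^sup>2"] allI impI hol)
  fix a b :: real assume ab: "a < b"
  let ?f = "\<lambda>z. ennreal ((cmod (deriv G z))\<^sup>2 * Im z)"
  let ?A = "\<lambda>n::nat. carleson_box a b \<inter> {z. 2 * inverse (real (Suc n)) \<le> Im z}"
  have contG: "continuous_on upper_half_plane (deriv G)"
    using holomorphic_on_imp_continuous_on[OF holomorphic_deriv[OF hol open_upper_half_plane]]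
      holomorphic_on_imp_continuous_on[OF hol] by auto
  have imono: "(indicator A z :: ennreal) \<le> indicator B z" if "z \<in> A \<Longrightarrow> z \<in> B" for A B and z :: complex
    using that by (auto simp: indicator_def)
  have "(\<lambda>z. ?f z * indicator (carleson_box a b) z) = (\<lambda>z. SUP n. ?f z * indicator (?A n) z)"
  proof
    fix z
    have "\<exists>n. 2 * inverse (real (Suc n)) \<le> Im z" if "z \<in> carleson_box a b"
    proof -
      have "0 < Im z / 2" using that by (simp add: carleson_box_def)
      from reals_Archimedean[OF this] obtain n where "inverse (real (Suc n)) < Im z / 2" by blast
      then show ?thesis by (intro exI[of _ n]) simp
    qed
    then obtain n where n: "z \<in> carleson_box a b \<Longrightarrow> z \<in> ?A n" by blast
    show "?f z * indicator (carleson_box a b) z = (SUP n. ?f z * indicator (?A n) z)"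
    proof (rule antisym)
      show "?f z * indicator (carleson_box a b) z \<le> (SUP n. ?f z * indicator (?A n) z)"
        using n by (intro SUP_upper2[of n]) (auto simp: indicator_def)
      show "(SUP n. ?f z * indicator (?A n) z) \<le> ?f z * indicator (carleson_box a b) z"
        by (intro SUP_least) (auto simp: indicator_def)
    qed
  qed
  then have "(\<integral>\<^sup>+z. ?f z * indicator (carleson_box a b) z \<partial>lborel) = (\<integral>\<^sup>+z. (SUP n. ?f z * indicator (?A n) z) \<partial>lborel)"
    by simp
  also have "\<dots> = (SUP n. \<integral>\<^sup>+z. ?f z * indicator (?A n) z \<partial>lborel)"
  proof (rule nn_integral_monotone_convergence_SUP)
    show "incseq (\<lambda>n z. ?f z * indicator (?A n) z)"
    proof (intro incseq_SucI le_funI mult_left_mono)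
      fix n :: nat and z
      have "inverse (real (Suc (Suc n))) \<le> inverse (real (Suc n))" by (simp add: field_simps)
      then have "z \<in> ?A (Suc n)" if "z \<in> ?A n"
        using that \<open>inverse (real (Suc (Suc n))) \<le> inverse (real (Suc n))\<close>
        unfolding Int_iff mem_Collect_eq by linarith
      then show "(indicator (?A n) z :: ennreal) \<le> indicator (?A (Suc n)) z"
        by (rule imono)
    qed simp
    show "(\<lambda>z. ?f z * indicator (?A n) z) \<in> borel_measurable lborel" for n
      unfolding measurable_lborel2 using carleson_box_subset_uhp[of a b]
      by (intro measurable_continuous_times_indicator[OF _ open_upper_half_plane] continuous_intros contG sets.Int
        sets_carleson_box borel_closed[OF closed_halfspace_Im_ge]) auto
  qed
  also have "\<dots> \<le> ennreal (555 * M\<^sup>2 * (b - a))"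
    by (intro SUP_least bounded_Im_energy[OF hol M ab]) auto
  finally show "(\<integral>\<^sup>+z. ?f z * indicator (carleson_box a b) z \<partial>lborel) \<le> ennreal (555 * M\<^sup>2 * (b - a))" .
qed simp

section \<open>A minimum principle\<close>

lemma second_derivative_test_min:
  fixes f f' :: "real \<Rightarrow> real"
  assumes ab: "a < t" "t < b"
    and f: "\<And>s. a < s \<Longrightarrow> s < b \<Longrightarrow> (f has_real_derivative f' s) (at s)"
    and f': "(f' has_real_derivative D) (at t)"
    and min: "\<And>s. a < s \<Longrightarrow> s < b \<Longrightarrow> f t \<le> f s"
  shows "0 \<le> D"
proof (rule ccontr)
  assume "\<not> 0 \<le> D"
  then have D: "D < 0" by simp
  have f0: "f' t = 0"
  proof (rule DERIV_local_min[OF f[OF ab]])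
    show "0 < min (t - a) (b - t)" using ab by simp
    show "\<forall>y. \<bar>t - y\<bar> < min (t - a) (b - t) \<longrightarrow> f t \<le> f y" by (intro allI impI min) auto
  qed
  obtain d where d: "0 < d" "\<And>h. 0 < h \<Longrightarrow> h < d \<Longrightarrow> f' (t + h) < f' t"
    using DERIV_neg_dec_right[OF f' D] by auto
  define s where "s = t + min d (b - t) / 2"
  have s: "t < s" "s < b" "s < t + d" using d(1) ab by (auto simp: s_def min_def field_simps)
  obtain z where z: "t < z" "z < s" "f s - f t = (s - t) * f' z"
    using MVT2[OF s(1), of f f'] f ab s by auto
  have "f' z < 0" using d(2)[of "z - t"] z s f0 by auto
  then have "f s < f t" using z s by (smt (verit) mult_pos_neg)
  with min[of s] s ab show False by auto
qed

text \<open>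
  Only second derivatives along the two coordinate directions enter.  Adding \<open>\<epsilon> (m\<^sup>2 - x\<^sup>2)\<close>, which is
  nonnegative on the rectangle, makes the Laplacian strictly negative; at an interior minimum both second
  derivatives would be nonnegative, so the minimum is on the boundary.
\<close>
lemma superharmonic_minimum_principle:
  fixes V Vx Vxx Vy Vyy :: "real \<Rightarrow> real \<Rightarrow> real"
  assumes cont: "continuous_on (cbox (a, c) (b, d)) (\<lambda>(x, y). V x y)"
    and Vx: "\<And>x y. a < x \<Longrightarrow> x < b \<Longrightarrow> c < y \<Longrightarrow> y < d \<Longrightarrow> ((\<lambda>t. V t y) has_real_derivative Vx x y) (at x)"
    and Vxx: "\<And>x y. a < x \<Longrightarrow> x < b \<Longrightarrow> c < y \<Longrightarrow> y < d \<Longrightarrow> ((\<lambda>t. Vx t y) has_real_derivative Vxx x y) (at x)"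
    and Vy: "\<And>x y. a < x \<Longrightarrow> x < b \<Longrightarrow> c < y \<Longrightarrow> y < d \<Longrightarrow> ((\<lambda>t. V x t) has_real_derivative Vy x y) (at y)"
    and Vyy: "\<And>x y. a < x \<Longrightarrow> x < b \<Longrightarrow> c < y \<Longrightarrow> y < d \<Longrightarrow> ((\<lambda>t. Vy x t) has_real_derivative Vyy x y) (at y)"
    and le: "\<And>x y. a < x \<Longrightarrow> x < b \<Longrightarrow> c < y \<Longrightarrow> y < d \<Longrightarrow> Vxx x y + Vyy x y \<le> 0"
    and bd: "\<And>x y. a \<le> x \<Longrightarrow> x \<le> b \<Longrightarrow> c \<le> y \<Longrightarrow> y \<le> d \<Longrightarrow> x = a \<or> x = b \<or> y = c \<or> y = d \<Longrightarrow> 0 \<le> V x y"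
    and xy: "a \<le> x" "x \<le> b" "c \<le> y" "y \<le> d"
  shows "0 \<le> V x y"
proof -
  define m where "m = \<bar>a\<bar> + \<bar>b\<bar>"
  have m: "s\<^sup>2 \<le> m\<^sup>2" if "a \<le> s" "s \<le> b" for s
    using that by (subst abs_le_square_iff[symmetric]) (auto simp: m_def)
  have pert: "0 \<le> V x y + \<epsilon> * (m\<^sup>2 - x\<^sup>2)" if \<epsilon>: "0 < \<epsilon>" for \<epsilon>
  proof -
    define U where "U = (\<lambda>x y. V x y + \<epsilon> * (m\<^sup>2 - x\<^sup>2))"
    have cU: "continuous_on (cbox (a, c) (b, d)) (\<lambda>(x, y). U x y)"
      using cont unfolding U_def case_prod_beta' by (intro continuous_intros)
    have "(x, y) \<in> cbox (a, c) (b, d)" using xy by simp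
    then have "cbox (a, c) (b, d) \<noteq> {}" by blast
    then obtain p where p: "p \<in> cbox (a, c) (b, d)" "\<And>q. q \<in> cbox (a, c) (b, d) \<Longrightarrow> (\<lambda>(x, y). U x y) p \<le> (\<lambda>(x, y). U x y) q"
      using continuous_attains_inf[OF compact_cbox _ cU] by blast
    obtain x0 y0 where p0: "p = (x0, y0)" by force
    have in0: "a \<le> x0" "x0 \<le> b" "c \<le> y0" "y0 \<le> d" using p(1) p0 by auto
    have min: "U x0 y0 \<le> U s t" if "a \<le> s" "s \<le> b" "c \<le> t" "t \<le> d" for s t
      using p(2)[of "(s, t)"] that p0 by auto
    have "0 \<le> U x0 y0"
    proof (cases "x0 = a \<or> x0 = b \<or> y0 = c \<or> y0 = d")
      case True
      then show ?thesis using bd[OF in0] m[OF in0(1,2)] \<epsilon> by (simp add: U_def)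
    next
      case False
      then have i0: "a < x0" "x0 < b" "c < y0" "y0 < d" using in0 by auto
      have "0 \<le> Vxx x0 y0 - 2 * \<epsilon>"
      proof (rule second_derivative_test_min[OF i0(1,2), of "\<lambda>s. U s y0" "\<lambda>s. Vx s y0 - 2 * \<epsilon> * s"])
        show "((\<lambda>s. U s y0) has_real_derivative Vx s y0 - 2 * \<epsilon> * s) (at s)" if "a < s" "s < b" for s
          unfolding U_def by (rule derivative_eq_intros Vx that i0 refl)+ simp
        show "((\<lambda>s. Vx s y0 - 2 * \<epsilon> * s) has_real_derivative Vxx x0 y0 - 2 * \<epsilon>) (at x0)"
          by (rule derivative_eq_intros Vxx i0 refl)+ simp
        show "U x0 y0 \<le> U s y0" if "a < s" "s < b" for s using min that i0 by auto
      qed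
      moreover have "0 \<le> Vyy x0 y0"
      proof (rule second_derivative_test_min[OF i0(3,4), of "\<lambda>s. U x0 s" "\<lambda>s. Vy x0 s"])
        show "((\<lambda>s. U x0 s) has_real_derivative Vy x0 s) (at s)" if "c < s" "s < d" for s
          unfolding U_def by (rule derivative_eq_intros Vy that i0 refl)+ simp
        show "(Vy x0 has_real_derivative Vyy x0 y0) (at y0)" by (rule Vyy[OF i0])
        show "U x0 y0 \<le> U x0 s" if "c < s" "s < d" for s using min that i0 by auto
      qed
      ultimately show ?thesis using le[OF i0] \<epsilon> by simp
    qed
    also have "U x0 y0 \<le> U x y" by (rule min[OF xy])
    finally show ?thesis by (simp add: U_def)
  qed
  have "((\<lambda>\<epsilon>. V x y + \<epsilon> * (m\<^sup>2 - x\<^sup>2)) \<longlongrightarrow> V x y + 0 * (m\<^sup>2 - x\<^sup>2)) (at_right 0)"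
    by (intro tendsto_intros)
  then have "0 \<le> V x y + 0 * (m\<^sup>2 - x\<^sup>2)"
    by (rule tendsto_lowerbound) (auto simp: eventually_at_right_less pert intro: eventually_mono[OF eventually_at_right_less[of 0]])
  then show ?thesis by simp
qed

section \<open>Schwarz and Poisson integrals on the half-plane\<close>

text \<open>
  The Schwarz integral is the holomorphic function whose real part is the Poisson integral of \<open>\<phi>\<close>.  The
  term \<open>t / (1 + t\<^sup>2)\<close> makes it real at \<open>\<i>\<close> and lets its size be controlled by the Poisson integral at \<open>\<i>\<close>
  alone, whatever the interval of integration.
\<close>
definition schwarz_integral :: "(real \<Rightarrow> real) \<Rightarrow> real \<Rightarrow> complex \<Rightarrow> complex" where
  "schwarz_integral \<phi> N z =
     integral {-N..N} (\<lambda>t. of_real (\<phi> t) * (1 / (of_real t - z) - of_real (t / (1 + t\<^sup>2)))) / (of_real pi * \<i>)"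

definition poisson_integral :: "(real \<Rightarrow> real) \<Rightarrow> real \<Rightarrow> complex \<Rightarrow> real" where
  "poisson_integral \<phi> N z = integral {-N..N} (\<lambda>t. \<phi> t * (Im z / ((t - Re z)\<^sup>2 + (Im z)\<^sup>2))) / pi"

lemma uhp_neq_of_real: "z \<in> upper_half_plane \<Longrightarrow> of_real t - z \<noteq> 0"
  by (auto simp: upper_half_plane_def complex_eq_iff)

lemma schwarz_holomorphic:
  assumes "continuous_on UNIV \<phi>"
  shows "schwarz_integral \<phi> N holomorphic_on upper_half_plane"
proof -
  have c: "continuous_on S (\<lambda>p. \<phi> (f p))" if "continuous_on S f" for S and f :: "'a::topological_space \<Rightarrow> real"
    by (rule continuous_on_compose2[OF assms that]) auto
  have pos: "1 + t\<^sup>2 \<noteq> 0" for t :: real by (metis add_pos_nonneg less_numeral_extra(1,3) zero_le_power2)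
  have "(\<lambda>z. integral (cbox (-N) N) (\<lambda>t. of_real (\<phi> t) * (1 / (of_real t - z) - of_real (t / (1 + t\<^sup>2))))) holomorphic_on upper_half_plane"
  proof (rule leibniz_rule_holomorphic)
    show "((\<lambda>z. of_real (\<phi> t) * (1 / (of_real t - z) - of_real (t / (1 + t\<^sup>2)))) has_field_derivative
       of_real (\<phi> t) * (1 / (of_real t - z)\<^sup>2)) (at z within upper_half_plane)" if "z \<in> upper_half_plane" for z t
      using uhp_neq_of_real[OF that, of t]
      by (auto intro!: derivative_eq_intros simp: power2_eq_square)
    show "(\<lambda>t. of_real (\<phi> t) * (1 / (of_real t - z) - of_real (t / (1 + t\<^sup>2)))) integrable_on cbox (-N) N" if "z \<in> upper_half_plane" for z
      by (intro integrable_continuous continuous_intros c) (use uhp_neq_of_real[OF that] pos in auto)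
    show "continuous_on (upper_half_plane \<times> cbox (- N) N) (\<lambda>(z, t). of_real (\<phi> t) * (1 / (of_real t - z)\<^sup>2))"
      unfolding case_prod_beta' by (intro continuous_intros c) (auto dest: uhp_neq_of_real)
    show "convex upper_half_plane"
      unfolding upper_half_plane_def by (rule convex_halfspace_Im_gt)
  qed
  then show ?thesis
    unfolding schwarz_integral_def[abs_def] by (intro holomorphic_intros) auto
qed

text \<open>The size estimate rests on \<open>1 / (t - z) - t / (1 + t\<^sup>2) = (1 + z\<^sup>2 + z (t - z)) / ((t - z) (1 + t\<^sup>2))\<close>.\<close>
lemma schwarz_integral_props:
  assumes c: "continuous_on UNIV \<phi>" and z: "z \<in> upper_half_plane"
  shows Re_schwarz: "Re (schwarz_integral \<phi> N z) = poisson_integral \<phi> N z"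
    and norm_schwarz: "(\<And>t. 0 \<le> \<phi> t) \<Longrightarrow> cmod (schwarz_integral \<phi> N z) \<le> (cmod z + cmod (1 + z\<^sup>2) / Im z) * poisson_integral \<phi> N \<i>"
proof -
  have c': "continuous_on S \<phi>" for S using c continuous_on_subset by blast
  have pos: "0 < 1 + t\<^sup>2" for t :: real by (simp add: add_pos_nonneg)
  let ?f = "\<lambda>z t. of_real (\<phi> t) * (1 / (of_real t - z) - of_real (t / (1 + t\<^sup>2)))"
  have int: "?f z integrable_on {-N..N}" if "z \<in> upper_half_plane" for z
    by (intro integrable_continuous_interval continuous_intros c') (use uhp_neq_of_real[OF that] pos in \<open>auto simp: less_imp_neq[symmetric]\<close>)
  have Im_f: "Im (?f z t) = \<phi> t * (Im z / ((t - Re z)\<^sup>2 + (Im z)\<^sup>2))" for z t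
    by (simp add: Im_divide)
  have Im_int: "Im (integral {-N..N} (?f z)) = pi * poisson_integral \<phi> N z" if "z \<in> upper_half_plane" for z
  proof -
    have "Im (integral {-N..N} (?f z)) = integral {-N..N} (\<lambda>t. Im (?f z t))"
      using integral_linear[OF int[OF that] bounded_linear_Im] by (simp add: o_def)
    then show ?thesis by (simp only: Im_f poisson_integral_def) simp
  qed
  have div: "Re (w / (of_real pi * \<i>)) = Im w / pi" "Im (w / (of_real pi * \<i>)) = - Re w / pi" for w
    by (simp_all add: Re_divide Im_divide power2_eq_square)
  show "Re (schwarz_integral \<phi> N z) = poisson_integral \<phi> N z"
    unfolding schwarz_integral_def div Im_int[OF z] by simp
  show "cmod (schwarz_integral \<phi> N z) \<le> (cmod z + cmod (1 + z\<^sup>2) / Im z) * poisson_integral \<phi> N \<i>"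
    if \<phi>0: "\<And>t. 0 \<le> \<phi> t"
  proof -
    have y: "0 < Im z" using z by (simp add: upper_half_plane_def)
    define \<kappa> where "\<kappa> = cmod z + cmod (1 + z\<^sup>2) / Im z"
    have ptw: "cmod (?f z t) \<le> \<phi> t * (1 / (1 + t\<^sup>2)) * \<kappa>" for t
    proof -
      define T where "T = complex_of_real t"
      have T2: "1 + T\<^sup>2 = of_real (1 + t\<^sup>2)" by (simp add: T_def)
      have nz: "T - z \<noteq> 0" "1 + T\<^sup>2 \<noteq> 0"
        using uhp_neq_of_real[OF z, of t] pos[of t] unfolding T2 of_real_eq_0_iff by (auto simp: T_def)
      have "1 / (T - z) - T / (1 + T\<^sup>2) = (1 + z\<^sup>2 + z * (T - z)) / (T - z) / (1 + T\<^sup>2)"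
        using nz by (simp add: divide_simps) (simp add: power2_eq_square algebra_simps)
      also have "(1 + z\<^sup>2 + z * (T - z)) / (T - z) = (1 + z\<^sup>2) / (T - z) + z"
        using nz by (simp add: divide_simps)
      finally have eq: "1 / (T - z) - T / (1 + T\<^sup>2) = ((1 + z\<^sup>2) / (T - z) + z) / (1 + T\<^sup>2)" .
      have n1: "cmod (1 + T\<^sup>2) = 1 + t\<^sup>2"
        unfolding T2 norm_of_real using pos[of t] by simp
      have "Im z \<le> cmod (T - z)" using abs_Im_le_cmod[of "T - z"] by (simp add: T_def)
      then have "cmod ((1 + z\<^sup>2) / (T - z)) \<le> cmod (1 + z\<^sup>2) / Im z"
        using y by (auto simp: norm_divide intro!: divide_left_mono mult_pos_pos)
      then have "cmod ((1 + z\<^sup>2) / (T - z) + z) \<le> \<kappa>"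
        using norm_triangle_ineq[of "(1 + z\<^sup>2) / (T - z)" z] by (simp add: \<kappa>_def)
      then have "cmod (1 / (T - z) - T / (1 + T\<^sup>2)) \<le> \<kappa> / (1 + t\<^sup>2)"
        unfolding eq norm_divide[of _ "1 + T\<^sup>2"] n1 using pos[of t] by (intro divide_right_mono) auto
      then have "\<phi> t * cmod (1 / (T - z) - T / (1 + T\<^sup>2)) \<le> \<phi> t * (\<kappa> / (1 + t\<^sup>2))"
        using \<phi>0 by (intro mult_left_mono) auto
      then show ?thesis using \<phi>0[of t] by (simp add: norm_mult T_def)
    qed
    have "cmod (integral {-N..N} (?f z)) \<le> integral {-N..N} (\<lambda>t. \<phi> t * (1 / (1 + t\<^sup>2)) * \<kappa>)"
      by (intro integral_norm_bound_integral int z integrable_continuous_interval continuous_intros c' ptw)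
        (use pos in \<open>auto simp: less_imp_neq[symmetric]\<close>)
    also have "\<dots> = \<kappa> * (pi * poisson_integral \<phi> N \<i>)"
      unfolding integral_mult_left poisson_integral_def by (simp add: add.commute)
    finally have "cmod (integral {-N..N} (?f z)) / pi \<le> \<kappa> * poisson_integral \<phi> N \<i>"
      by (simp add: divide_le_eq mult.commute mult.left_commute)
    then show ?thesis unfolding schwarz_integral_def \<kappa>_def
      by (simp add: norm_divide norm_mult)
  qed
qed

text \<open>The Poisson kernel has the antiderivative \<open>arctan ((t - x) / y)\<close>.\<close>
lemma poisson_kernel_mass:
  assumes "0 < y" "a \<le> b"
  shows "((\<lambda>t. y / ((t - x)\<^sup>2 + y\<^sup>2)) has_integral (arctan ((b - x) / y) - arctan ((a - x) / y))) {a..b}"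
proof (rule fundamental_theorem_of_calculus[OF assms(2)])
  fix t
  have "((\<lambda>t. arctan ((t - x) / y)) has_real_derivative y / ((t - x)\<^sup>2 + y\<^sup>2)) (at t within {a..b})"
    using assms(1) by (auto intro!: derivative_eq_intros simp: divide_simps power2_eq_square add_pos_pos add_nonneg_pos) 
  then show "((\<lambda>t. arctan ((t - x) / y)) has_vector_derivative y / ((t - x)\<^sup>2 + y\<^sup>2)) (at t within {a..b})"
    by (simp add: has_real_derivative_iff_has_vector_derivative)
qed

lemma arctan_ge: "0 < u \<Longrightarrow> pi / 2 - 1 / u \<le> arctan u"
  using arctan_inverse[of u] arctan_le_self[of "1 / u"] by (simp add: sgn_if inverse_eq_divide)

lemma arctan_le_pi_half: "arctan u \<le> pi / 2" "- (pi / 2) \<le> arctan u"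
  using arctan_bounded[of u] by auto

lemma poisson_integral_bounds:
  assumes c: "continuous_on UNIV \<phi>" and bd: "\<And>t. 0 \<le> \<phi> t" and y: "0 < Im z" and N: "0 < N"
  shows "0 \<le> poisson_integral \<phi> N z"
    and "(\<And>t. t \<in> {-N..N} \<Longrightarrow> \<phi> t * (Im z / ((t - Re z)\<^sup>2 + (Im z)\<^sup>2)) \<le> B) \<Longrightarrow> poisson_integral \<phi> N z \<le> 2 * N * B / pi"
proof -
  have c': "continuous_on S \<phi>" for S using c continuous_on_subset by blast
  have pos: "0 < (t - Re z)\<^sup>2 + (Im z)\<^sup>2" for t using y by (simp add: add_nonneg_pos)
  have int: "(\<lambda>t. \<phi> t * (Im z / ((t - Re z)\<^sup>2 + (Im z)\<^sup>2))) integrable_on {-N..N}"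
    by (intro integrable_continuous_interval continuous_intros c') (use y in auto)
  show "0 \<le> poisson_integral \<phi> N z"
    unfolding poisson_integral_def using pos y bd
    by (intro divide_nonneg_pos integral_nonneg int mult_nonneg_nonneg divide_nonneg_pos) auto
  show "poisson_integral \<phi> N z \<le> 2 * N * B / pi"
    if "\<And>t. t \<in> {-N..N} \<Longrightarrow> \<phi> t * (Im z / ((t - Re z)\<^sup>2 + (Im z)\<^sup>2)) \<le> B"
  proof -
    have "integral {-N..N} (\<lambda>t. \<phi> t * (Im z / ((t - Re z)\<^sup>2 + (Im z)\<^sup>2))) \<le> integral {-N..N} (\<lambda>_. B)"
      by (intro integral_le int that) auto
    then show ?thesis using N by (simp add: poisson_integral_def divide_right_mono)
  qed
qed

text \<open>
  Poisson integrals of compactly supported continuous functions attain their boundary values uniformly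
  in \<open>x\<close>.  Near \<open>x\<close> uniform continuity is used; away from \<open>x\<close> the kernel is at most \<open>y / \<delta>\<^sup>2\<close>; and the
  mass of the kernel outside a large interval is at most \<open>2 y\<close>.
\<close>
lemma poisson_boundary_uniform:
  assumes c: "continuous_on UNIV \<phi>" and bd: "\<And>t. 0 \<le> \<phi> t" "\<And>t. \<phi> t \<le> M"
    and supp: "\<And>t. N \<le> \<bar>t\<bar> \<Longrightarrow> \<phi> t = 0" and N: "0 < N" and e: "0 < e"
  obtains d where "0 < d" "\<And>x y. 0 < y \<Longrightarrow> y < d \<Longrightarrow> \<bar>poisson_integral \<phi> N (Complex x y) - \<phi> x\<bar> < e"
proof -
  have c': "continuous_on S \<phi>" for S using c continuous_on_subset by blast
  define A where "A = N + 2"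
  have M0: "0 \<le> M" using bd[of 0] by linarith
  have "uniformly_continuous_on {-A..A} \<phi>"
    by (intro compact_uniformly_continuous c') auto
  then obtain \<delta>0 where \<delta>0: "0 < \<delta>0" "\<And>s t. s \<in> {-A..A} \<Longrightarrow> t \<in> {-A..A} \<Longrightarrow> \<bar>s - t\<bar> < \<delta>0 \<Longrightarrow> \<bar>\<phi> s - \<phi> t\<bar> < e / 4"
    unfolding uniformly_continuous_on_def dist_real_def using e by (metis divide_pos_pos zero_less_numeral)
  define \<delta> where "\<delta> = min \<delta>0 1"
  have \<delta>: "0 < \<delta>" "\<delta> \<le> 1" "\<delta> \<le> \<delta>0" using \<delta>0 by (auto simp: \<delta>_def)
  define C where "C = 2 * A * M / \<delta>\<^sup>2 + 2 * M + 1"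
  have C1: "0 < C" using M0 \<delta> N by (simp add: C_def A_def add_nonneg_pos)
  define d where "d = e / C"
  have d0: "0 < d" using e C1 by (simp add: d_def)
  show ?thesis
  proof (rule that[OF d0])
    fix x y :: real assume y: "0 < y" "y < d"
    define k where "k = (\<lambda>t. y / ((t - x)\<^sup>2 + y\<^sup>2))"
    have pos: "0 < (t - x)\<^sup>2 + y\<^sup>2" for t using y by (simp add: add_nonneg_pos)
    have k0: "0 \<le> k t" for t using y pos[of t] by (simp add: k_def)
    have ck: "continuous_on S k" for S
      unfolding k_def by (intro continuous_intros) (use y in auto)
    have kfar: "k t \<le> y / \<delta>\<^sup>2" if "\<delta> \<le> \<bar>t - x\<bar>" for t
    proof -
      have "\<delta>\<^sup>2 \<le> (t - x)\<^sup>2" using that \<delta> by (subst abs_le_square_iff[symmetric]) auto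
      then have "\<delta>\<^sup>2 \<le> (t - x)\<^sup>2 + y\<^sup>2" using zero_le_power2[of y] by linarith
      then show ?thesis using \<delta> y pos[of t] by (auto simp: k_def intro!: divide_left_mono)
    qed
    have Cy: "C * y < e" using y C1 by (simp add: d_def field_simps)
    have Q: "poisson_integral \<phi> N (Complex x y) = integral {-N..N} (\<lambda>t. \<phi> t * k t) / pi"
      by (simp add: poisson_integral_def k_def)
    have A0: "0 < A" using N by (simp add: A_def)
    have C2: "2 * A * M * y / \<delta>\<^sup>2 + 2 * M * y \<le> C * y" using y by (simp add: C_def distrib_right)
    show "\<bar>poisson_integral \<phi> N (Complex x y) - \<phi> x\<bar> < e"
    proof (cases "\<bar>x\<bar> \<le> N + 1")
      case False
      have "poisson_integral \<phi> N (Complex x y) \<le> 2 * N * (M * (y / \<delta>\<^sup>2)) / pi"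
      proof (rule poisson_integral_bounds(2)[OF c bd(1) _ N])
        fix t assume "t \<in> {-N..N}"
        then have "k t \<le> y / \<delta>\<^sup>2" using False \<delta> by (intro kfar) auto
        then have "\<phi> t * k t \<le> M * (y / \<delta>\<^sup>2)"
          using bd k0[of t] M0 by (intro mult_mono) auto
        then show "\<phi> t * (Im (Complex x y) / ((t - Re (Complex x y))\<^sup>2 + (Im (Complex x y))\<^sup>2)) \<le> M * (y / \<delta>\<^sup>2)"
          by (simp only: k_def complex.sel)
      qed (use y in simp)
      also have "\<dots> \<le> 2 * N * (M * (y / \<delta>\<^sup>2)) / 1"
        using pi_gt3 N M0 y \<delta> by (intro divide_left_mono) auto
      also have "\<dots> \<le> 2 * A * M * y / \<delta>\<^sup>2"
      proof -
        have "2 * N * (M * (y / \<delta>\<^sup>2)) \<le> 2 * A * (M * (y / \<delta>\<^sup>2))"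
          using M0 y by (intro mult_right_mono mult_left_mono) (auto simp: A_def)
        then show ?thesis by (simp add: mult.assoc)
      qed
      also have "\<dots> < e"
      proof -
        have "0 \<le> 2 * M * y" using M0 y by simp
        then show ?thesis using C2 Cy by linarith
      qed
      finally have "poisson_integral \<phi> N (Complex x y) < e" .
      moreover have "\<phi> x = 0" using False by (intro supp) auto
      ultimately show ?thesis using poisson_integral_bounds(1)[OF c bd(1), of "Complex x y" N] y N by simp
    next
      case True
      have "(\<lambda>t. \<phi> t * k t) integrable_on {-N..N}" by (intro integrable_continuous_interval continuous_intros c' ck)
      then have "((\<lambda>t. \<phi> t * k t) has_integral integral {-N..N} (\<lambda>t. \<phi> t * k t)) {-A..A}"
        by (intro has_integral_on_superset[OF integrable_integral]) (auto simp: A_def intro!: supp)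
      moreover have mass: "(k has_integral (arctan ((A - x) / y) - arctan ((-A - x) / y))) {-A..A}" (is "(_ has_integral ?m) _")
        unfolding k_def using A0 y by (intro poisson_kernel_mass) auto
      ultimately have h1: "((\<lambda>t. \<phi> t * k t - \<phi> x * k t) has_integral (integral {-N..N} (\<lambda>t. \<phi> t * k t) - \<phi> x * ?m)) {-A..A}"
        by (intro has_integral_diff has_integral_mult_right)
      have h2: "((\<lambda>t. e / 4 * k t + M * (y / \<delta>\<^sup>2)) has_integral (e / 4 * ?m + (A - - A) * (M * (y / \<delta>\<^sup>2)))) {-A..A}"
        using A0 has_integral_const_real[of "M * (y / \<delta>\<^sup>2)" "-A" A] by (intro has_integral_add has_integral_mult_right mass) auto
      have h3: "norm (\<phi> t * k t - \<phi> x * k t) \<le> e / 4 * k t + M * (y / \<delta>\<^sup>2)" if "t \<in> {-A..A}" for t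
      proof (cases "\<bar>t - x\<bar> < \<delta>")
        case True
        moreover have "x \<in> {-A..A}" using \<open>\<bar>x\<bar> \<le> N + 1\<close> by (auto simp: A_def abs_le_iff)
        ultimately have "\<bar>\<phi> t - \<phi> x\<bar> \<le> e / 4" using \<delta>0(2)[OF that, of x] \<delta> by linarith
        then have "\<bar>\<phi> t - \<phi> x\<bar> * k t \<le> e / 4 * k t" using k0 by (intro mult_right_mono) auto
        moreover have "0 \<le> M * (y / \<delta>\<^sup>2)" using M0 y by simp
        moreover have "\<bar>\<phi> t * k t - \<phi> x * k t\<bar> = \<bar>\<phi> t - \<phi> x\<bar> * k t" by (metis abs_mult abs_of_nonneg k0 left_diff_distrib)
        ultimately show ?thesis by simp
      next
        case False
        have "\<bar>\<phi> t - \<phi> x\<bar> \<le> M" using bd(1)[of t] bd(2)[of t] bd(1)[of x] bd(2)[of x] by (simp add: abs_le_iff)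
        then have "\<bar>\<phi> t - \<phi> x\<bar> * k t \<le> M * (y / \<delta>\<^sup>2)" using kfar[of t] False k0[of t] M0 by (intro mult_mono) auto
        moreover have "0 \<le> e / 4 * k t" using k0[of t] e by simp
        moreover have "\<bar>\<phi> t * k t - \<phi> x * k t\<bar> = \<bar>\<phi> t - \<phi> x\<bar> * k t" by (metis abs_mult abs_of_nonneg k0 left_diff_distrib)
        ultimately show ?thesis by simp
      qed
      have I: "\<bar>integral {-N..N} (\<lambda>t. \<phi> t * k t) - \<phi> x * ?m\<bar> \<le> e / 4 * ?m + (A - - A) * (M * (y / \<delta>\<^sup>2))"
        using integral_norm_bound_integral[OF has_integral_integrable[OF h1] has_integral_integrable[OF h2] h3]
        by (simp only: integral_unique[OF h1] integral_unique[OF h2] real_norm_def)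
      have AA: "(A - - A) * (M * (y / \<delta>\<^sup>2)) = 2 * A * M * y / \<delta>\<^sup>2" by simp
      have m1: "?m \<le> pi" using arctan_le_pi_half[of "(A - x) / y"] arctan_le_pi_half[of "(-A - x) / y"] by linarith
      have m2: "pi - 2 * y \<le> ?m"
      proof -
        have a: "1 \<le> A - x" "1 \<le> A + x" using True by (auto simp: A_def)
        have "pi / 2 - y / (A - x) \<le> arctan ((A - x) / y)" "pi / 2 - y / (A + x) \<le> arctan ((A + x) / y)"
          using arctan_ge[of "(A - x) / y"] arctan_ge[of "(A + x) / y"] a y by simp_all
        moreover have "y / (A - x) \<le> y / 1" "y / (A + x) \<le> y / 1" using a y by (intro divide_left_mono; simp)+
        moreover have "arctan ((-A - x) / y) = - arctan ((A + x) / y)"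
        proof -
          have "(-A - x) / y = - ((A + x) / y)" by (simp add: diff_divide_distrib add_divide_distrib)
          then show ?thesis by (simp only: arctan_minus)
        qed
        ultimately show ?thesis by linarith
      qed
      have "\<bar>\<phi> x * ?m - \<phi> x * pi\<bar> = \<phi> x * (pi - ?m)"
      proof -
        have "0 \<le> \<phi> x * (pi - ?m)" using m1 bd(1)[of x] by (intro mult_nonneg_nonneg) auto
        moreover have "\<phi> x * ?m - \<phi> x * pi = - (\<phi> x * (pi - ?m))" by (simp only: right_diff_distrib minus_diff_eq)
        ultimately show ?thesis by (simp only: abs_minus_cancel abs_of_nonneg)
      qed
      also have "\<dots> \<le> M * (2 * y)" using m1 m2 bd[of x] M0 by (intro mult_mono) auto
      finally have J: "\<bar>\<phi> x * ?m - \<phi> x * pi\<bar> \<le> 2 * M * y" by simp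
      have "e / 4 * ?m \<le> e / 4 * pi" using m1 e by (intro mult_left_mono) auto
      with I[unfolded AA] J C2 Cy have "\<bar>integral {-N..N} (\<lambda>t. \<phi> t * k t) - \<phi> x * pi\<bar> < e / 4 * pi + e"
        by linarith
      also have "\<dots> \<le> e * pi"
      proof -
        have "e * 3 \<le> e * pi" using pi_gt3 e by (intro mult_left_mono) auto
        then show ?thesis using e by linarith
      qed
      finally have "\<bar>integral {-N..N} (\<lambda>t. \<phi> t * k t) - \<phi> x * pi\<bar> / pi < e"
        by (simp add: divide_less_eq)
      moreover have "\<bar>integral {-N..N} (\<lambda>t. \<phi> t * k t) - \<phi> x * pi\<bar> / pi = \<bar>integral {-N..N} (\<lambda>t. \<phi> t * k t) / pi - \<phi> x\<bar>"
      proof -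
        have "integral {-N..N} (\<lambda>t. \<phi> t * k t) / pi - \<phi> x = (integral {-N..N} (\<lambda>t. \<phi> t * k t) - \<phi> x * pi) / pi"
          by (simp add: diff_divide_distrib)
        then show ?thesis by (simp only: abs_divide abs_of_pos[OF pi_gt_zero])
      qed
      ultimately show ?thesis unfolding Q by simp
    qed
  qed
qed

section \<open>Carleson potentials\<close>

lemma nn_integral_cbox_continuous:
  fixes f :: "'a::euclidean_space \<Rightarrow> real"
  assumes "continuous_on (cbox a b) f" "\<And>w. w \<in> cbox a b \<Longrightarrow> 0 \<le> f w"
  shows "(\<integral>\<^sup>+w. ennreal (f w) * indicator (cbox a b) w \<partial>lborel) = ennreal (integral (cbox a b) f)"
  by (intro nn_integral_has_integral_lebesgue' assms integrable_integral integrable_continuous)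

lemma area_mean_bound_integral:
  assumes hol: "p holomorphic_on csquare z R" and R: "0 < R"
  shows "R\<^sup>2 * cmod (p z) \<le> 3 * integral (csquare z R) (\<lambda>w. cmod (p w))"
proof -
  have c: "continuous_on (csquare z R) (\<lambda>w. cmod (p w))"
    by (intro continuous_intros holomorphic_on_imp_continuous_on hol)
  have nn: "0 \<le> integral (csquare z R) (\<lambda>w. cmod (p w))"
    by (intro integral_nonneg integrable_continuous c) auto
  have "ennreal (R\<^sup>2 * cmod (p z)) \<le> ennreal (3 * integral (csquare z R) (\<lambda>w. cmod (p w)))"
    using area_mean_bound[OF hol R] nn by (simp add: nn_integral_cbox_continuous[OF c] ennreal_mult')
  then show ?thesis using nn by simp
qed

lemma csquare_half_subset_uhp:
  assumes "0 < Im z" "R \<le> Im z / 2"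
  shows "csquare z R \<subseteq> upper_half_plane"
  using assms by (auto simp: in_cbox_complex_iff upper_half_plane_def)

text \<open>
  With \<open>z = x + i y\<close> this is \<open>|z - cnj w|\<^sup>2\<close>, the denominator of
  \<open>1 - |\<tau>\<^sub>w(z)|\<^sup>2 = 4 Im z Im w / |z - cnj w|\<^sup>2\<close>, where \<open>\<tau>\<^sub>w(z) = (z - w) / (z - cnj w)\<close>.
\<close>
abbreviation kden :: "real \<Rightarrow> real \<Rightarrow> complex \<Rightarrow> real" where
  "kden x y w \<equiv> (x - Re w)\<^sup>2 + (y + Im w)\<^sup>2"

text \<open>A BMOA function with a fixed Carleson constant \<open>A\<close>.\<close>
locale carleson_function =
  fixes g :: "complex \<Rightarrow> complex" and A :: real
  assumes hol: "g holomorphic_on upper_half_plane" and A0: "0 \<le> A"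
    and carleson: "\<And>a b. a < b \<Longrightarrow>
       (\<integral>\<^sup>+z. ennreal ((cmod (deriv g z))\<^sup>2 * Im z) * indicator (carleson_box a b) z \<partial>lborel) \<le> ennreal (A * (b - a))"
begin

lemma hol_deriv: "deriv g holomorphic_on upper_half_plane"
  by (intro holomorphic_deriv hol) simp

lemma cont_deriv: "S \<subseteq> upper_half_plane \<Longrightarrow> continuous_on S (deriv g)"
  using holomorphic_on_imp_continuous_on[OF hol_deriv] continuous_on_subset by blast

lemma measurable_energy:
  assumes [measurable]: "S \<in> sets borel" and "S \<subseteq> upper_half_plane"
  shows "(\<lambda>z. ennreal ((cmod (deriv g z))\<^sup>2 * Im z) * indicator S z) \<in> borel_measurable borel"
  by (rule measurable_continuous_times_indicator[OF _ open_upper_half_plane])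
    (use assms in \<open>auto intro!: continuous_intros cont_deriv\<close>)

text \<open>
  The area mean over a square of half-side \<open>Im z / 2\<close> is controlled by a Carleson box of size
  \<open>2 Im z\<close>, since \<open>Im w\<close> is comparable to \<open>Im z\<close> on the square.
\<close>
lemma bloch:
  assumes z: "0 < Im z"
  shows "(cmod (deriv g z))\<^sup>2 \<le> 48 * A / (Im z)\<^sup>2"
proof -
  define y where "y = Im z"
  have y: "0 < y" using z by (simp add: y_def)
  let ?sq = "csquare z (y / 2)"
  let ?box = "carleson_box (Re z - y) (Re z + y)"
  have sub: "?sq \<subseteq> upper_half_plane" using z by (intro csquare_half_subset_uhp) (auto simp: y_def)
  have holp: "(\<lambda>w. (deriv g w)\<^sup>2) holomorphic_on ?sq"
    by (intro holomorphic_intros holomorphic_on_subset[OF hol_deriv sub])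
  have "ennreal ((y / 2)\<^sup>2 * cmod ((deriv g z)\<^sup>2)) \<le> 3 * (\<integral>\<^sup>+w. ennreal (cmod ((deriv g w)\<^sup>2)) * indicator ?sq w \<partial>lborel)"
    using y by (intro area_mean_bound[OF holp]) auto
  also have "(\<integral>\<^sup>+w. ennreal (cmod ((deriv g w)\<^sup>2)) * indicator ?sq w \<partial>lborel)
      \<le> (\<integral>\<^sup>+w. ennreal (2 / y) * (ennreal ((cmod (deriv g w))\<^sup>2 * Im w) * indicator ?box w) \<partial>lborel)"
  proof (rule nn_integral_mono)
    fix w
    have "ennreal (cmod ((deriv g w)\<^sup>2)) \<le> ennreal (2 / y) * ennreal ((cmod (deriv g w))\<^sup>2 * Im w) \<and> w \<in> ?box" if w: "w \<in> ?sq"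
    proof -
      have w': "y / 2 \<le> Im w" "Im w \<le> 3 / 2 * y" "\<bar>Re w - Re z\<bar> \<le> y / 2"
        using w unfolding mem_csquare y_def abs_le_iff by linarith+
      then have "w \<in> ?box" unfolding carleson_box_def mem_Collect_eq using y by (intro conjI; linarith)
      moreover have "(cmod (deriv g w))\<^sup>2 * 1 \<le> (cmod (deriv g w))\<^sup>2 * (2 / y * Im w)"
        using w' y by (intro mult_left_mono) (auto simp: field_simps)
      ultimately show ?thesis using y w' by (auto simp: norm_power mult_ac intro!: ennreal_leI simp flip: ennreal_mult)
    qed
    then show "ennreal (cmod ((deriv g w)\<^sup>2)) * indicator ?sq w \<le> ennreal (2 / y) * (ennreal ((cmod (deriv g w))\<^sup>2 * Im w) * indicator ?box w)"
      by (auto simp: indicator_def)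
  qed
  also have "\<dots> = ennreal (2 / y) * (\<integral>\<^sup>+w. ennreal ((cmod (deriv g w))\<^sup>2 * Im w) * indicator ?box w \<partial>lborel)"
    by (intro nn_integral_cmult) (use measurable_energy[OF sets_carleson_box carleson_box_subset_uhp] in simp)
  also have "\<dots> \<le> ennreal (2 / y) * ennreal (A * (Re z + y - (Re z - y)))"
    using y by (intro mult_left_mono carleson) auto
  also have "\<dots> = ennreal (4 * A)"
    using y A0 by (subst ennreal_mult[symmetric]) (auto simp: field_simps)
  finally have "ennreal ((y / 2)\<^sup>2 * cmod ((deriv g z)\<^sup>2)) \<le> 3 * ennreal (4 * A)"
    by (simp add: mult_left_mono)
  also have "\<dots> = ennreal (12 * A)"
    using ennreal_mult[of 3 "4 * A"] A0 by simp
  finally have "(y / 2)\<^sup>2 * cmod ((deriv g z)\<^sup>2) \<le> 12 * A" using A0 by simp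
  then show ?thesis using y by (simp add: y_def[symmetric] norm_mult field_simps power2_eq_square)
qed

text \<open>
  The kernel is at most \<open>16 / (4\<^sup>k y) Im w\<close> off the box of half-width \<open>2\<^sup>k\<^sup>-\<^sup>1 y\<close> above \<open>x\<close>.  The
  energy of the box of half-width \<open>2\<^sup>k y\<close> is at most \<open>2\<^sup>k\<^sup>+\<^sup>1 A y\<close>, and the sum over \<open>k\<close> is geometric.
\<close>
lemma kernel_energy_bound:
  assumes y: "0 < y"
  shows "(\<integral>\<^sup>+w. ennreal ((cmod (deriv g w))\<^sup>2 * (4 * y * Im w / kden x y w)) * indicator upper_half_plane w \<partial>lborel)
     \<le> ennreal (64 * A)"
proof -
  let ?box = "\<lambda>k::nat. carleson_box (x - 2 ^ k * y) (x + 2 ^ k * y)"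
  let ?e = "\<lambda>w. ennreal ((cmod (deriv g w))\<^sup>2 * Im w)"
  let ?c = "\<lambda>k::nat. 16 / 4 ^ k / y"
  \<comment> \<open>Only the smallest box that contains \<open>w\<close> is needed for a given \<open>w\<close>.\<close>
  have ptw: "ennreal ((cmod (deriv g w))\<^sup>2 * (4 * y * Im w / kden x y w)) * indicator upper_half_plane w
      \<le> (\<Sum>k. ennreal (?c k) * (?e w * indicator (?box k) w))" for w
  proof (cases "w \<in> upper_half_plane")
    case True
    define v where "v = Im w"
    define D where "D = (x - Re w)\<^sup>2 + (y + v)\<^sup>2"
    have v: "0 < v" using True by (simp add: v_def upper_half_plane_def)
    have D: "0 < D" using v y by (auto simp: D_def intro!: add_nonneg_pos)
    have "\<exists>k. w \<in> ?box k"
    proof -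
      obtain k where k: "\<bar>Re w - x\<bar> / y + v / y < 2 ^ k" using real_arch_pow[of 2] by auto
      then have k: "\<bar>Re w - x\<bar> + v < 2 ^ k * y" using y by (simp add: field_simps)
      moreover have "0 < 2 ^ k * y" using y by simp
      ultimately have "x - 2 ^ k * y < Re w" "Re w < x + 2 ^ k * y" "v < x + 2 ^ k * y - (x - 2 ^ k * y)"
        using v by linarith+
      then show ?thesis using v by (intro exI[of _ k]) (simp add: carleson_box_def v_def[symmetric])
    qed
    then obtain k where k: "w \<in> ?box k" "\<And>j. j < k \<Longrightarrow> w \<notin> ?box j"
      using LeastI_ex[of "\<lambda>k. w \<in> ?box k"] not_less_Least[of _ "\<lambda>k. w \<in> ?box k"] by blast
    have "4 * y / D \<le> ?c k"
    proof (cases k)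
      case 0
      have "y\<^sup>2 \<le> (y + v)\<^sup>2" using y v by (intro power_mono) auto
      then have "y\<^sup>2 \<le> D" by (auto simp: D_def intro: order_trans)
      then have "4 * y / D \<le> 4 * y / y\<^sup>2" using y D by (intro divide_left_mono) auto
      also have "\<dots> \<le> 16 / y" using y by (simp add: power2_eq_square divide_right_mono)
      finally show ?thesis using 0 by simp
    next
      case (Suc j)
      have "w \<notin> ?box j" using k(2) Suc by simp
      then have "2 ^ j * y \<le> \<bar>x - Re w\<bar> \<or> 2 ^ j * y \<le> y + v"
      proof (rule contrapos_np)
        assume "\<not> (2 ^ j * y \<le> \<bar>x - Re w\<bar> \<or> 2 ^ j * y \<le> y + v)"
        then have "\<bar>x - Re w\<bar> < 2 ^ j * y" "y + v < 2 ^ j * y" by auto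
        then show "w \<in> ?box j"
          unfolding carleson_box_def mem_Collect_eq v_def[symmetric] using v y by (intro conjI; linarith)
      qed
      then have "(2 ^ j * y)\<^sup>2 \<le> D"
      proof
        assume "2 ^ j * y \<le> \<bar>x - Re w\<bar>"
        then have "(2 ^ j * y)\<^sup>2 \<le> \<bar>x - Re w\<bar>\<^sup>2" using y by (intro power_mono) auto
        then show ?thesis unfolding D_def power2_abs using zero_le_power2[of "y + v"] by linarith
      next
        assume "2 ^ j * y \<le> y + v"
        then have "(2 ^ j * y)\<^sup>2 \<le> (y + v)\<^sup>2" using y by (intro power_mono) auto
        then show ?thesis by (auto simp: D_def intro: order_trans)
      qed
      then have "4 * y / D \<le> 4 * y / (2 ^ j * y)\<^sup>2" using y D by (intro divide_left_mono) auto
      also have "\<dots> = ?c k" 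
      proof -
        have "(2 ^ j * y)\<^sup>2 = 4 ^ j * y\<^sup>2" by (simp add: power_mult_distrib flip: power_mult power2_eq_square)
             (simp add: power_mult mult.commute[of _ 2])
        then show ?thesis using y Suc by (simp add: power2_eq_square)
      qed
      finally show ?thesis .
    qed
    then have "(cmod (deriv g w))\<^sup>2 * v * (4 * y / D) \<le> (cmod (deriv g w))\<^sup>2 * v * ?c k"
      using v by (intro mult_left_mono) auto
    then have "ennreal ((cmod (deriv g w))\<^sup>2 * (4 * y * Im w / kden x y w)) \<le> ennreal (?c k * ((cmod (deriv g w))\<^sup>2 * Im w))"
      by (intro ennreal_leI) (simp add: D_def v_def mult_ac)
    also have "\<dots> = ennreal (?c k) * (?e w * indicator (?box k) w)"
      using k(1) y v by (subst ennreal_mult) (auto simp: v_def)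
    also have "\<dots> \<le> (\<Sum>k. ennreal (?c k) * (?e w * indicator (?box k) w))"
      using sum_le_suminf[of "\<lambda>k. ennreal (?c k) * (?e w * indicator (?box k) w)" "{k}"] by simp
    finally show ?thesis using True by simp
  qed simp
  have m: "(\<lambda>w. ?e w * indicator (?box k) w) \<in> borel_measurable lborel" for k
    using measurable_energy[OF sets_carleson_box carleson_box_subset_uhp] by simp
  have "(\<integral>\<^sup>+w. ennreal ((cmod (deriv g w))\<^sup>2 * (4 * y * Im w / kden x y w)) * indicator upper_half_plane w \<partial>lborel)
     \<le> (\<integral>\<^sup>+w. (\<Sum>k. ennreal (?c k) * (?e w * indicator (?box k) w)) \<partial>lborel)"
    by (intro nn_integral_mono ptw)
  also have "\<dots> = (\<Sum>k. ennreal (?c k) * (\<integral>\<^sup>+w. ?e w * indicator (?box k) w \<partial>lborel))"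
    using m by (subst nn_integral_suminf) (auto simp: nn_integral_cmult)
  also have "\<dots> \<le> (\<Sum>k. ennreal (32 * A * (1 / 2) ^ k))"
  proof (rule suminf_le)
    fix k :: nat
    have "ennreal (?c k) * (\<integral>\<^sup>+w. ?e w * indicator (?box k) w \<partial>lborel) \<le> ennreal (?c k) * ennreal (A * (x + 2 ^ k * y - (x - 2 ^ k * y)))"
      using y by (intro mult_left_mono carleson) auto
    also have "\<dots> = ennreal (?c k * (A * (2 * 2 ^ k * y)))"
      using y A0 by (subst ennreal_mult[symmetric]) (auto simp: algebra_simps)
    also have "?c k * (A * (2 * 2 ^ k * y)) = 32 * A * (1 / 2) ^ k"
    proof -
      have "(4::real) ^ k = 2 ^ k * 2 ^ k" by (simp flip: power_mult_distrib)
      then show ?thesis using y by (simp add: field_simps)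
    qed
    finally show "ennreal (?c k) * (\<integral>\<^sup>+w. ?e w * indicator (?box k) w \<partial>lborel) \<le> ennreal (32 * A * (1 / 2) ^ k)" .
  qed auto
  also have "\<dots> = ennreal (64 * A)"
  proof -
    have "(\<lambda>k. 32 * A * (1 / 2 :: real) ^ k) sums (32 * A * (1 / (1 - 1 / 2)))"
      by (intro sums_mult geometric_sums) auto
    then show ?thesis using A0 by (subst suminf_ennreal2) (auto simp: sums_iff)
  qed
  finally show ?thesis .
qed

text \<open>
  The integral of \<open>|g'(w)|\<^sup>2 (1 - |\<tau>\<^sub>w(z)|\<^sup>2)\<close>, with \<open>w\<close> restricted to a compact rectangle so that it may be
  differentiated under the integral sign, and its partial derivatives of first and second order.
\<close>
definition potential :: "complex \<Rightarrow> complex \<Rightarrow> real \<Rightarrow> real \<Rightarrow> real" where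
  "potential a b x y = integral (cbox a b) (\<lambda>w. (cmod (deriv g w))\<^sup>2 * (4 * Im w * y / kden x y w))"

definition potential_x :: "complex \<Rightarrow> complex \<Rightarrow> real \<Rightarrow> real \<Rightarrow> real" where
  "potential_x a b x y = integral (cbox a b) (\<lambda>w. (cmod (deriv g w))\<^sup>2 *
     (- 8 * y * Im w * (x - Re w) / (kden x y w)\<^sup>2))"

definition potential_xx :: "complex \<Rightarrow> complex \<Rightarrow> real \<Rightarrow> real \<Rightarrow> real" where
  "potential_xx a b x y = integral (cbox a b) (\<lambda>w. (cmod (deriv g w))\<^sup>2 *
     (- 8 * y * Im w / (kden x y w)\<^sup>2 + 32 * y * Im w * (x - Re w)\<^sup>2 / (kden x y w) ^ 3))"

definition potential_y :: "complex \<Rightarrow> complex \<Rightarrow> real \<Rightarrow> real \<Rightarrow> real" where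
  "potential_y a b x y = integral (cbox a b) (\<lambda>w. (cmod (deriv g w))\<^sup>2 *
     (4 * Im w / kden x y w - 8 * Im w * (y * (y + Im w)) / (kden x y w)\<^sup>2))"

definition potential_yy :: "complex \<Rightarrow> complex \<Rightarrow> real \<Rightarrow> real \<Rightarrow> real" where
  "potential_yy a b x y = integral (cbox a b) (\<lambda>w. (cmod (deriv g w))\<^sup>2 *
     (- 8 * Im w * (y + Im w) / (kden x y w)\<^sup>2 
      - (8 * Im w * (2 * y + Im w) / (kden x y w)\<^sup>2
        - 32 * Im w * (y * (y + Im w)) * (y + Im w) / (kden x y w) ^ 3)))"

lemma kernel_integral_derivative:
  fixes k k' :: "real \<Rightarrow> complex \<Rightarrow> real"
  assumes ab: "cbox a b \<subseteq> upper_half_plane" and U: "open U" "convex U" "s0 \<in> U"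
    and d: "\<And>s w. s \<in> U \<Longrightarrow> w \<in> cbox a b \<Longrightarrow> ((\<lambda>s. k s w) has_real_derivative k' s w) (at s)"
    and ck: "\<And>s. s \<in> U \<Longrightarrow> continuous_on (cbox a b) (k s)"
    and ck': "continuous_on (U \<times> cbox a b) (\<lambda>p. k' (fst p) (snd p))"
  shows "((\<lambda>s. integral (cbox a b) (\<lambda>w. (cmod (deriv g w))\<^sup>2 * k s w)) has_real_derivative
           integral (cbox a b) (\<lambda>w. (cmod (deriv g w))\<^sup>2 * k' s0 w)) (at s0)"
proof -
  have "((\<lambda>s. integral (cbox a b) (\<lambda>w. (cmod (deriv g w))\<^sup>2 * k s w)) has_real_derivative
           integral (cbox a b) (\<lambda>w. (cmod (deriv g w))\<^sup>2 * k' s0 w)) (at s0 within U)"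
  proof (rule leibniz_rule_field_derivative[OF _ _ _ U(3,2)])
    show "((\<lambda>s. (cmod (deriv g w))\<^sup>2 * k s w) has_real_derivative (cmod (deriv g w))\<^sup>2 * k' s w) (at s within U)"
      if "s \<in> U" "w \<in> cbox a b" for s w
      using has_field_derivative_at_within[OF DERIV_cmult[OF d[OF that]]] .
    show "(\<lambda>w. (cmod (deriv g w))\<^sup>2 * k s w) integrable_on cbox a b" if "s \<in> U" for s
      by (intro integrable_continuous continuous_intros cont_deriv[OF ab] ck that)
    have "continuous_on (U \<times> cbox a b) (\<lambda>p. deriv g (snd p))"
      by (rule continuous_on_compose2[OF cont_deriv[OF ab]]) (auto intro!: continuous_intros)
    then show "continuous_on (U \<times> cbox a b) (\<lambda>(s, w). (cmod (deriv g w))\<^sup>2 * k' s w)"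
      unfolding case_prod_beta' by (intro continuous_intros ck')
  qed
  then show ?thesis by (simp only: at_within_open[OF U(3,1)])
qed

lemma quotient_derivative:
  assumes "(e has_real_derivative e') (at s)" "(d has_real_derivative d') (at s)" "d s \<noteq> 0"
  shows "((\<lambda>s. c * e s / d s) has_real_derivative (c * e' / d s - c * e s * d' / (d s)\<^sup>2)) (at s)"
    and "((\<lambda>s. c * e s / (d s)\<^sup>2) has_real_derivative (c * e' / (d s)\<^sup>2 - 2 * c * e s * d' / (d s) ^ 3)) (at s)"
proof -
  show "((\<lambda>s. c * e s / d s) has_real_derivative (c * e' / d s - c * e s * d' / (d s)\<^sup>2)) (at s)"
    by (rule DERIV_cong[OF DERIV_divide[OF DERIV_cmult[OF assms(1)] assms(2,3)]])
      (use assms(3) in \<open>simp add: field_simps power2_eq_square\<close>)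
  have "((\<lambda>s. (d s)\<^sup>2) has_real_derivative 2 * d s * d') (at s)"
    using assms(2) by (auto intro!: derivative_eq_intros)
  from DERIV_divide[OF DERIV_cmult[OF assms(1)] this]
  show "((\<lambda>s. c * e s / (d s)\<^sup>2) has_real_derivative (c * e' / (d s)\<^sup>2 - 2 * c * e s * d' / (d s) ^ 3)) (at s)"
    by (rule DERIV_cong) (use assms(3) in \<open>simp_all add: field_simps power2_eq_square power3_eq_cube\<close>)
qed

lemma kernel_denominator:
  "((\<lambda>x. (x - \<alpha>)\<^sup>2 + \<beta>) has_real_derivative 2 * (x - \<alpha>)) (at x)"
  "((\<lambda>y. \<beta> + (y + \<alpha>)\<^sup>2) has_real_derivative 2 * (y + \<alpha>)) (at y)"
  for \<alpha> \<beta> x y :: real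
  by (auto intro!: derivative_eq_intros)

lemma kernel_denominator_pos:
  assumes "cbox a b \<subseteq> upper_half_plane" "0 < y" "w \<in> cbox a b"
  shows "0 < Im w" "0 < kden x y w" "kden x y w \<noteq> 0"
proof -
  show v: "0 < Im w" using assms by (auto simp: upper_half_plane_def)
  show pos: "0 < kden x y w" using v assms(2) by (auto intro!: add_nonneg_pos)
  show "kden x y w \<noteq> 0" by (rule less_imp_neq[OF pos, symmetric])
qed

lemma potential_derivatives:
  assumes ab: "cbox a b \<subseteq> upper_half_plane" and y: "0 < y"
  shows "((\<lambda>x. potential a b x y) has_real_derivative potential_x a b x y) (at x)"
    and "((\<lambda>x. potential_x a b x y) has_real_derivative potential_xx a b x y) (at x)"
    and "((\<lambda>y. potential a b x y) has_real_derivative potential_y a b x y) (at y)"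
    and "((\<lambda>y. potential_y a b x y) has_real_derivative potential_yy a b x y) (at y)"
proof -
  note nz = kernel_denominator_pos(3)[OF ab]
  show "((\<lambda>x. potential a b x y) has_real_derivative potential_x a b x y) (at x)"
    unfolding potential_def potential_x_def
  proof (rule kernel_integral_derivative[OF ab open_UNIV convex_UNIV UNIV_I])
    show "((\<lambda>s. 4 * Im w * y / kden s y w) has_real_derivative - 8 * y * Im w * (s - Re w) / (kden s y w)\<^sup>2) (at s)"
      if "w \<in> cbox a b" for s w
      by (rule DERIV_cong[OF quotient_derivative(1)[OF DERIV_const kernel_denominator(1) nz[OF y that]]]) (simp add: mult_ac)
  qed (auto intro!: continuous_intros dest: nz[OF y])
  show "((\<lambda>x. potential_x a b x y) has_real_derivative potential_xx a b x y) (at x)"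
    unfolding potential_x_def potential_xx_def
  proof (rule kernel_integral_derivative[OF ab open_UNIV convex_UNIV UNIV_I])
    show "((\<lambda>s. - 8 * y * Im w * (s - Re w) / (kden s y w)\<^sup>2) has_real_derivative
       - 8 * y * Im w / (kden s y w)\<^sup>2 + 32 * y * Im w * (s - Re w)\<^sup>2 / (kden s y w) ^ 3) (at s)"
      if "w \<in> cbox a b" for s w
    proof -
      have ar: "c * (1 - 0) / q - 2 * c * e * (2 * e) / r = c / q + (- 4 * c) * e\<^sup>2 / r" for c e q r :: real
        by (simp add: power2_eq_square algebra_simps)
      show ?thesis
        by (rule DERIV_cong[OF quotient_derivative(2)[OF DERIV_diff[OF DERIV_ident DERIV_const] kernel_denominator(1) nz[OF y that]]])
          (subst ar, simp)
    qed
  qed (auto intro!: continuous_intros dest: nz[OF y])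
  show "((\<lambda>y. potential a b x y) has_real_derivative potential_y a b x y) (at y)"
    unfolding potential_def potential_y_def
  proof (rule kernel_integral_derivative[OF ab open_greaterThan convex_real_interval(3)])
    show "((\<lambda>s. 4 * Im w * s / kden x s w) has_real_derivative
       (4 * Im w / kden x s w - 8 * Im w * (s * (s + Im w)) / (kden x s w)\<^sup>2)) (at s)"
      if "s \<in> {0<..}" "w \<in> cbox a b" for s w
      by (rule DERIV_cong[OF quotient_derivative(1)[OF DERIV_ident kernel_denominator(2) nz[OF _ that(2)]]]) (use that in \<open>simp_all add: mult_ac\<close>)
    show "y \<in> {0<..}" using y by simp
  qed (auto intro!: continuous_intros dest: nz[rotated])
  show "((\<lambda>y. potential_y a b x y) has_real_derivative potential_yy a b x y) (at y)"
    unfolding potential_y_def potential_yy_def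
  proof (rule kernel_integral_derivative[OF ab open_greaterThan convex_real_interval(3)])
    show "((\<lambda>s. 4 * Im w / kden x s w - 8 * Im w * (s * (s + Im w)) / (kden x s w)\<^sup>2) has_real_derivative
     (- 8 * Im w * (s + Im w) / (kden x s w)\<^sup>2 
      - (8 * Im w * (2 * s + Im w) / (kden x s w)\<^sup>2
        - 32 * Im w * (s * (s + Im w)) * (s + Im w) / (kden x s w) ^ 3))) (at s)"
      if "s \<in> {0<..}" "w \<in> cbox a b" for s w
    proof (rule DERIV_diff)
      have n: "kden x s w \<noteq> 0" using nz that by auto
      show "((\<lambda>s. 4 * Im w / kden x s w) has_real_derivative - 8 * Im w * (s + Im w) / (kden x s w)\<^sup>2) (at s)"
        using DERIV_cong[OF quotient_derivative(1)[OF DERIV_const[of 1] kernel_denominator(2) n, of "4 * Im w"]] by (simp add: mult_ac)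
      have e: "((\<lambda>s. s * (s + Im w)) has_real_derivative 2 * s + Im w) (at s)"
        by (auto intro!: derivative_eq_intros)
      show "((\<lambda>s. 8 * Im w * (s * (s + Im w)) / (kden x s w)\<^sup>2) has_real_derivative
         8 * Im w * (2 * s + Im w) / (kden x s w)\<^sup>2
        - 32 * Im w * (s * (s + Im w)) * (s + Im w) / (kden x s w) ^ 3) (at s)"
      proof -
        have ar: "c * e' / q - 2 * c * e * (2 * f) / r = c * e' / q - 4 * c * e * f / r" for c e e' f q r :: real
          by simp
        show ?thesis
          by (rule DERIV_cong[OF quotient_derivative(2)[OF e kernel_denominator(2) n]]) (subst ar, simp)
      qed
    qed
    show "y \<in> {0<..}" using y by simp
  qed (auto intro!: continuous_intros dest: nz[rotated])
qed

lemma potential_bounds: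
  assumes ab: "cbox a b \<subseteq> upper_half_plane" and y: "0 < y"
  shows "0 \<le> potential a b x y" "potential a b x y \<le> 64 * A"
proof -
  note D = kernel_denominator_pos[OF ab y]
  have c: "continuous_on (cbox a b) (\<lambda>w. (cmod (deriv g w))\<^sup>2 * (4 * Im w * y / kden x y w))"
    by (intro continuous_intros cont_deriv[OF ab]) (use D(3) in auto)
  have nn: "0 \<le> (cmod (deriv g w))\<^sup>2 * (4 * Im w * y / kden x y w)" if "w \<in> cbox a b" for w
    using D(1,2)[OF that] y by (intro mult_nonneg_nonneg divide_nonneg_pos) auto
  show "0 \<le> potential a b x y"
    unfolding potential_def by (intro integral_nonneg integrable_continuous c nn)
  have "ennreal (potential a b x y) = (\<integral>\<^sup>+w. ennreal ((cmod (deriv g w))\<^sup>2 * (4 * Im w * y / kden x y w)) * indicator (cbox a b) w \<partial>lborel)"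
    unfolding potential_def by (rule nn_integral_cbox_continuous[OF c nn, symmetric])
  also have "\<dots> \<le> (\<integral>\<^sup>+w. ennreal ((cmod (deriv g w))\<^sup>2 * (4 * y * Im w / kden x y w)) * indicator upper_half_plane w \<partial>lborel)"
    using ab by (intro nn_integral_mono) (auto simp: indicator_def mult.commute mult.left_commute)
  also have "\<dots> \<le> ennreal (64 * A)" by (rule kernel_energy_bound[OF y])
  finally show "potential a b x y \<le> 64 * A" using A0 by simp
qed

text \<open>
  The Laplacian of the kernel is \<open>- 16 (Im w)\<^sup>2 / |z - cnj w|\<^sup>4\<close>, which on the square of half-side
  \<open>y / 2\<close> around \<open>z\<close> is at most \<open>- 1 / (11 y\<^sup>2)\<close>.  The area mean of \<open>(g')\<^sup>2\<close> over this square finishes.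
\<close>
lemma potential_Laplacian:
  assumes ab: "cbox a b \<subseteq> upper_half_plane" and y: "0 < y"
    and sq: "csquare (Complex x y) (y / 2) \<subseteq> cbox a b"
  shows "potential_xx a b x y + potential_yy a b x y \<le> - (cmod (deriv g (Complex x y)))\<^sup>2 / 132"
proof -
  note D = kernel_denominator_pos[OF ab y]
  let ?p = "\<lambda>w. (cmod (deriv g w))\<^sup>2"
  let ?D = "\<lambda>w. (x - Re w)\<^sup>2 + (y + Im w)\<^sup>2"
  let ?sq = "csquare (Complex x y) (y / 2)"
  have cp: "continuous_on S ?p" if "S \<subseteq> cbox a b" for S
    by (intro continuous_intros cont_deriv) (use ab that in auto)
  have cL: "continuous_on S (\<lambda>w. ?p w * (16 * (Im w)\<^sup>2 / (?D w)\<^sup>2))" if "S \<subseteq> cbox a b" for S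
    by (intro continuous_intros cp[OF that]) (use D(3) that in \<open>auto dest: subsetD\<close>)
  have "potential_xx a b x y + potential_yy a b x y = integral (cbox a b) (\<lambda>w. ?p w * 
      (- 8 * y * Im w / (?D w)\<^sup>2 + 32 * y * Im w * (x - Re w)\<^sup>2 / (?D w) ^ 3)
      + ?p w * (- 8 * Im w * (y + Im w) / (?D w)\<^sup>2 
      - (8 * Im w * (2 * y + Im w) / (?D w)\<^sup>2 - 32 * Im w * (y * (y + Im w)) * (y + Im w) / (?D w) ^ 3)))"
    unfolding potential_xx_def potential_yy_def
    by (intro integral_add[symmetric] integrable_continuous continuous_intros cp) (use D(3) in auto)
  also have "\<dots> = integral (cbox a b) (\<lambda>w. - (?p w * (16 * (Im w)\<^sup>2 / (?D w)\<^sup>2)))"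
  proof (intro integral_cong)
    fix w assume w: "w \<in> cbox a b"
    have ar: "p * (- 8 * y * v / d\<^sup>2 + 32 * y * v * e / d ^ 3)
      + p * (- 8 * v * (y + v) / d\<^sup>2 - (8 * v * (2 * y + v) / d\<^sup>2 - 32 * v * (y * (y + v)) * (y + v) / d ^ 3))
      = - (p * (16 * v\<^sup>2 / d\<^sup>2))" if "d = e + (y + v)\<^sup>2" "d \<noteq> 0" for p v d e :: real
    proof -
      have "32 * y * v * e / d ^ 3 + 32 * v * (y * (y + v)) * (y + v) / d ^ 3 = 32 * y * v * d / d ^ 3"
        unfolding that(1) by (simp add: power2_eq_square algebra_simps flip: add_divide_distrib)
      also have "\<dots> = 32 * y * v / d\<^sup>2" using that(2) by (simp add: power2_eq_square power3_eq_cube)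
      finally have 1: "32 * y * v * e / d ^ 3 + 32 * v * (y * (y + v)) * (y + v) / d ^ 3 = 32 * y * v / d\<^sup>2" .
      have "- 8 * y * v / d\<^sup>2 - 8 * v * (y + v) / d\<^sup>2 - 8 * v * (2 * y + v) / d\<^sup>2 + 32 * y * v / d\<^sup>2 = - (16 * v\<^sup>2 / d\<^sup>2)"
        by (simp add: power2_eq_square algebra_simps flip: add_divide_distrib diff_divide_distrib minus_divide_left)
      with 1 have "(- 8 * y * v / d\<^sup>2 + 32 * y * v * e / d ^ 3) + (- 8 * v * (y + v) / d\<^sup>2 - (8 * v * (2 * y + v) / d\<^sup>2 - 32 * v * (y * (y + v)) * (y + v) / d ^ 3)) = - (16 * v\<^sup>2 / d\<^sup>2)"
        (is "?X + ?Y = ?Z") by linarith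
      then have "p * (?X + ?Y) = p * ?Z" by (rule arg_cong)
      then show ?thesis unfolding mult_minus_right[of p] distrib_left[of p ?X ?Y] .
    qed
    show "?p w * (- 8 * y * Im w / (?D w)\<^sup>2 + 32 * y * Im w * (x - Re w)\<^sup>2 / (?D w) ^ 3)
      + ?p w * (- 8 * Im w * (y + Im w) / (?D w)\<^sup>2 
      - (8 * Im w * (2 * y + Im w) / (?D w)\<^sup>2 - 32 * Im w * (y * (y + Im w)) * (y + Im w) / (?D w) ^ 3))
      = - (?p w * (16 * (Im w)\<^sup>2 / (?D w)\<^sup>2))"
      by (rule ar[OF refl D(3)[OF w]])
  qed
  also have "\<dots> = - integral (cbox a b) (\<lambda>w. ?p w * (16 * (Im w)\<^sup>2 / (?D w)\<^sup>2))"
    by (rule integral_neg)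
  finally have eq: "potential_xx a b x y + potential_yy a b x y = - integral (cbox a b) (\<lambda>w. ?p w * (16 * (Im w)\<^sup>2 / (?D w)\<^sup>2))" .
  have low: "1 / (11 * y\<^sup>2) \<le> 16 * (Im w)\<^sup>2 / (?D w)\<^sup>2" if w: "w \<in> ?sq" for w
  proof -
    have w': "y / 2 \<le> Im w" "Im w \<le> 3 / 2 * y" "\<bar>x - Re w\<bar> \<le> y / 2"
      using w unfolding mem_csquare complex.sel by linarith+
    have "(x - Re w)\<^sup>2 \<le> (y / 2)\<^sup>2" using w'(3) y by (subst abs_le_square_iff[symmetric]) auto
    moreover have "(y + Im w)\<^sup>2 \<le> (5 / 2 * y)\<^sup>2" using w' y by (intro power_mono) auto
    ultimately have "?D w \<le> 13 / 2 * y\<^sup>2" by (simp add: power2_eq_square)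
    then have "(?D w)\<^sup>2 \<le> (13 / 2 * y\<^sup>2)\<^sup>2" using D(2) sq w by (intro power_mono) (auto intro: less_imp_le)
    moreover have "(y / 2)\<^sup>2 \<le> (Im w)\<^sup>2" using w' y by (intro power_mono) auto
    ultimately have "16 * (y / 2)\<^sup>2 / (13 / 2 * y\<^sup>2)\<^sup>2 \<le> 16 * (Im w)\<^sup>2 / (?D w)\<^sup>2"
      using D(2)[OF subsetD[OF sq w]] by (intro frac_le zero_less_power mult_left_mono) auto
    moreover have "1 / (11 * y\<^sup>2) \<le> 16 * (y / 2)\<^sup>2 / (13 / 2 * y\<^sup>2)\<^sup>2"
      using y by (simp add: power2_eq_square divide_simps)
    ultimately show ?thesis by linarith
  qed
  have "integral ?sq (\<lambda>w. 1 / (11 * y\<^sup>2) * ?p w) \<le> integral ?sq (\<lambda>w. ?p w * (16 * (Im w)\<^sup>2 / (?D w)\<^sup>2))"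
  proof (rule integral_le)
    show "(\<lambda>w. 1 / (11 * y\<^sup>2) * ?p w) integrable_on ?sq" by (intro integrable_continuous continuous_intros cp sq)
    show "(\<lambda>w. ?p w * (16 * (Im w)\<^sup>2 / (?D w)\<^sup>2)) integrable_on ?sq" by (intro integrable_continuous cL sq)
    show "1 / (11 * y\<^sup>2) * ?p w \<le> ?p w * (16 * (Im w)\<^sup>2 / (?D w)\<^sup>2)" if "w \<in> ?sq" for w
      using mult_left_mono[OF low[OF that], of "?p w"] by (simp add: mult.commute)
  qed
  also have "\<dots> \<le> integral (cbox a b) (\<lambda>w. ?p w * (16 * (Im w)\<^sup>2 / (?D w)\<^sup>2))"
    by (intro integral_subset_le sq integrable_continuous cL order_refl) auto
  finally have 1: "1 / (11 * y\<^sup>2) * integral ?sq ?p \<le> integral (cbox a b) (\<lambda>w. ?p w * (16 * (Im w)\<^sup>2 / (?D w)\<^sup>2))"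
    by (simp only: integral_mult_right)
  have "(y / 2)\<^sup>2 * cmod ((deriv g (Complex x y))\<^sup>2) \<le> 3 * integral ?sq (\<lambda>w. cmod ((deriv g w)\<^sup>2))"
    using sq ab y by (intro area_mean_bound_integral holomorphic_intros holomorphic_on_subset[OF hol_deriv]) auto
  then have "?p (Complex x y) / 132 \<le> 1 / (11 * y\<^sup>2) * integral ?sq ?p"
    using y by (simp add: norm_power power2_eq_square[of y] field_simps)
  with 1 eq show ?thesis by linarith
qed

end

section \<open>Exponential integrability on lines\<close>

text \<open>
  First and second derivative, along a coordinate direction, of \<open>exp u (1 + f - f\<^sup>2 / 4)\<close>.
\<close>
lemma exp_times_concave_derivatives:
  fixes u u' u'' f f' f'' :: "real \<Rightarrow> real"
  assumes u: "(u has_real_derivative u' s) (at s)" and f: "(f has_real_derivative f' s) (at s)"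
  shows "((\<lambda>s. exp (u s) * (1 + f s - (f s)\<^sup>2 / 4)) has_real_derivative
           exp (u s) * (u' s * (1 + f s - (f s)\<^sup>2 / 4) + (1 - f s / 2) * f' s)) (at s)"
    and "(u' has_real_derivative c) (at s) \<Longrightarrow> (f' has_real_derivative d) (at s) \<Longrightarrow>
      ((\<lambda>s. exp (u s) * (u' s * (1 + f s - (f s)\<^sup>2 / 4) + (1 - f s / 2) * f' s)) has_real_derivative
       exp (u s) * ((u' s)\<^sup>2 * (1 + f s - (f s)\<^sup>2 / 4) + 2 * u' s * (1 - f s / 2) * f' s
          + c * (1 + f s - (f s)\<^sup>2 / 4) - (f' s)\<^sup>2 / 2 + (1 - f s / 2) * d)) (at s)"
proof -
  have k: "((\<lambda>s. 1 + f s - (f s)\<^sup>2 / 4) has_real_derivative (1 - f s / 2) * f' s) (at s)"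
    using f by (auto intro!: derivative_eq_intros simp: algebra_simps)
  have e: "((\<lambda>s. exp (u s)) has_real_derivative exp (u s) * u' s) (at s)"
    using u by (auto intro!: derivative_eq_intros)
  show "((\<lambda>s. exp (u s) * (1 + f s - (f s)\<^sup>2 / 4)) has_real_derivative
           exp (u s) * (u' s * (1 + f s - (f s)\<^sup>2 / 4) + (1 - f s / 2) * f' s)) (at s)"
    by (rule DERIV_cong[OF DERIV_mult[OF e k]]) (simp add: algebra_simps)
  assume u': "(u' has_real_derivative c) (at s)" and f': "(f' has_real_derivative d) (at s)"
  have l: "((\<lambda>s. 1 - f s / 2) has_real_derivative - f' s / 2) (at s)"
    using f by (auto intro!: derivative_eq_intros)
  show "((\<lambda>s. exp (u s) * (u' s * (1 + f s - (f s)\<^sup>2 / 4) + (1 - f s / 2) * f' s)) has_real_derivative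
       exp (u s) * ((u' s)\<^sup>2 * (1 + f s - (f s)\<^sup>2 / 4) + 2 * u' s * (1 - f s / 2) * f' s
          + c * (1 + f s - (f s)\<^sup>2 / 4) - (f' s)\<^sup>2 / 2 + (1 - f s / 2) * d)) (at s)"
    by (rule DERIV_cong[OF DERIV_mult[OF e DERIV_add[OF DERIV_mult[OF u' k] DERIV_mult[OF l f']]]])
      (simp add: algebra_simps power2_eq_square[of "u' s"] power2_eq_square[of "f' s"])
qed

text \<open>
  The sign of the Laplacian of \<open>exp u (1 + f - f\<^sup>2 / 4)\<close>, divided by \<open>exp u\<close>, for harmonic \<open>u\<close>, with \<open>(a1, a2)\<close> and \<open>(f1, f2)\<close> the gradients of \<open>u\<close> and
  \<open>f\<close>, \<open>k = 1 + f - f\<^sup>2 / 4\<close>, \<open>m = 1 - f / 2\<close> its derivative and \<open>L\<close> the Laplacian of \<open>f\<close>.  The mixed term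
  is absorbed by \<open>- |\<nabla>f|\<^sup>2 / 2\<close>, which comes from the concavity of \<open>k\<close>, and the remainder by \<open>m L\<close>.
\<close>
lemma Laplacian_inequality:
  fixes k m a1 a2 f1 f2 L q :: real
  assumes k: "k \<le> 7 / 4" and m: "1 / 2 \<le> m" "m \<le> 1" and L: "L \<le> - r" "0 \<le> r"
    and a: "15 / 2 * (a1\<^sup>2 + a2\<^sup>2) \<le> r"
  shows "(a1\<^sup>2 * k + 2 * a1 * m * f1 - f1\<^sup>2 / 2) + (a2\<^sup>2 * k + 2 * a2 * m * f2 - f2\<^sup>2 / 2) + m * L \<le> 0"
proof -
  have c: "2 * a * m * f \<le> 2 * a\<^sup>2 + f\<^sup>2 / 2" for a f :: real
  proof -
    have "2 * (a * m) * f \<le> 2 * (a * m)\<^sup>2 + f\<^sup>2 / 2"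
      using zero_le_power2[of "2 * (a * m) - f"] by (simp add: power2_eq_square algebra_simps)
    moreover have "(a * m)\<^sup>2 \<le> a\<^sup>2 * 1"
      unfolding power_mult_distrib using m by (intro mult_left_mono power_le_one) auto
    ultimately show ?thesis by (simp add: mult_ac)
  qed
  have "a1\<^sup>2 * k \<le> a1\<^sup>2 * (7 / 4)" "a2\<^sup>2 * k \<le> a2\<^sup>2 * (7 / 4)"
    using k by (intro mult_left_mono; simp)+
  moreover have "m * L \<le> - r / 2"
  proof -
    have "m * L \<le> m * (- r)" using L m by (intro mult_left_mono) auto
    moreover have "1 / 2 * r \<le> m * r" using L m by (intro mult_right_mono) auto
    ultimately show ?thesis by simp
  qed
  moreover have "(X1 + Y1 - F1 / 2) + (X2 + Y2 - F2 / 2) + Z \<le> 0"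
    if "X1 \<le> B1 * (7 / 4)" "X2 \<le> B2 * (7 / 4)" "Z \<le> - r / 2" "Y1 \<le> 2 * B1 + F1 / 2" "Y2 \<le> 2 * B2 + F2 / 2"
      "15 / 2 * (B1 + B2) \<le> r" for X1 X2 Y1 Y2 F1 F2 Z B1 B2 :: real
  proof -
    have "15 / 4 * B1 + 15 / 4 * B2 \<le> r / 2" using that(6) by simp
    moreover have "X1 + Y1 - F1 / 2 \<le> 15 / 4 * B1" using that(1,4) by simp
    moreover have "X2 + Y2 - F2 / 2 \<le> 15 / 4 * B2" using that(2,5) by simp
    ultimately show ?thesis using that(3) by simp
  qed
  ultimately show ?thesis using c[of a1 f1] c[of a2 f2] a by blast
qed

context carleson_function
begin

text \<open>A bound for the potentials, made positive so that they can be divided by it.\<close>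
definition exp_constant :: real where "exp_constant = 64 * A + 1"

lemma exp_constant_pos: "1 \<le> exp_constant"
  using A0 by (simp add: exp_constant_def)

text \<open>
  The comparison is made on a large rectangle.  There the superharmonic function
  \<open>W = exp (Re (\<kappa> g)) (1 + f - f\<^sup>2 / 4)\<close>, with \<open>f\<close> the normalized potential, exceeds the Poisson integral \<open>Q\<close>
  of \<open>\<phi>\<close> up to a small error: at the bottom because \<open>\<phi> \<le> exp (Re (\<kappa> g)) \<le> W\<close>, and on the other sides because
  \<open>Q\<close> is small there, \<open>\<phi>\<close> having compact support, and \<open>W \<ge> 0\<close>.
\<close>
lemma poisson_exp_bound:
  assumes \<eta>: "0 < \<eta>" and \<kappa>: "1100 * exp_constant * (cmod \<kappa>)\<^sup>2 \<le> 1" and N: "0 < N" and e: "0 < e"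
    and c\<phi>: "continuous_on UNIV \<phi>" and \<phi>0: "\<And>t. 0 \<le> \<phi> t" and \<phi>M: "\<And>t. \<phi> t \<le> M"
    and supp: "\<And>t. N \<le> \<bar>t\<bar> \<Longrightarrow> \<phi> t = 0" and \<phi>u: "\<And>t. \<phi> t \<le> exp (Re (\<kappa> * g (Complex t \<eta>)))"
  shows "poisson_integral \<phi> N \<i> \<le> 2 * exp (Re (\<kappa> * g (Complex 0 (1 + \<eta>)))) + 2 * e"
proof -
  define K where "K = exp_constant"
  have K: "1 \<le> K" "0 < K" using exp_constant_pos by (auto simp: K_def)
  define G where "G = (\<lambda>z. \<kappa> * g z)"
  have holG: "G holomorphic_on upper_half_plane" unfolding G_def by (intro holomorphic_intros hol)
  define G1 where "G1 = (\<lambda>z. \<kappa> * deriv g z)"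
  have holG1: "G1 holomorphic_on upper_half_plane" unfolding G1_def by (intro holomorphic_intros hol_deriv)
  have dG: "(G has_field_derivative G1 z) (at z)" if "z \<in> upper_half_plane" for z
    unfolding G_def G1_def using holomorphic_derivI[OF hol open_upper_half_plane that] by (intro DERIV_cmult)
  have dG1: "(G1 has_field_derivative deriv G1 z) (at z)" if "z \<in> upper_half_plane" for z
    using holomorphic_derivI[OF holG1 open_upper_half_plane that] .
  define u where "u = (\<lambda>x y. Re (G (Complex x y)))"
  have M0: "0 \<le> M" using \<phi>0[of 0] \<phi>M[of 0] by linarith
  obtain d where d: "0 < d" "\<And>x y. 0 < y \<Longrightarrow> y < d \<Longrightarrow> \<bar>poisson_integral \<phi> N (Complex x y) - \<phi> x\<bar> < e"
    using poisson_boundary_uniform[OF c\<phi> \<phi>0 \<phi>M supp N e] by blast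
  have cu0: "continuous_on S (\<lambda>p. u (fst p) (snd p))" if "S \<subseteq> {p. 0 < snd p}" for S
  proof -
    have "continuous_on S (\<lambda>p. G (Complex (fst p) (snd p)))"
      by (rule continuous_on_compose2[OF holomorphic_on_imp_continuous_on[OF holG]]) (use that in \<open>auto intro!: continuous_intros\<close>)
    then show ?thesis unfolding u_def by (intro continuous_intros)
  qed
  have cu: "continuous_on S (\<lambda>p. exp (u (fst p) (snd p)))" if "S \<subseteq> {p. 0 < snd p}" for S
    by (intro continuous_intros cu0 that)
  have "uniformly_continuous_on (cbox (-N, \<eta>) (N, \<eta> + 1)) (\<lambda>p. exp (u (fst p) (snd p)))"
    by (intro compact_uniformly_continuous cu) (use \<eta> in auto)
  then obtain d' where d': "0 < d'" "\<And>p q. p \<in> cbox (-N, \<eta>) (N, \<eta> + 1) \<Longrightarrow> q \<in> cbox (-N, \<eta>) (N, \<eta> + 1) \<Longrightarrow> dist p q < d'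
      \<Longrightarrow> dist (exp (u (fst p) (snd p))) (exp (u (fst q) (snd q))) < e"
    unfolding uniformly_continuous_on_def using e by blast
  \<comment> \<open>The bottom of the rectangle lies at height \<open>\<eta> + s\<close>, where \<open>Q\<close> is already close to \<open>\<phi>\<close>.\<close>
  define s where "s = min (min d d') 1 / 2"
  have s: "0 < s" "s < d" "s < d'" "s < 1" using d d' by (auto simp: s_def min_def)
  \<comment> \<open>The half-width \<open>n\<close> is such that \<open>Q \<le> e\<close> on the lateral sides and on the top.\<close>
  define n where "n = Max {2 * N, 2 * \<eta>, 2 + \<eta>, 4 * N * M / e, 1}"
  have n: "2 * N \<le> n" "2 * \<eta> \<le> n" "2 + \<eta> \<le> n" "4 * N * M / e \<le> n" "1 \<le> n"
    unfolding n_def by (intro Max_ge; simp)+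
  \<comment> \<open>The potential is taken over a larger rectangle, so that it contains the square around each point of the smaller one.\<close>
  let ?a = "Complex (- 2 * n) (\<eta> / 2)" and ?b = "Complex (2 * n) (2 * n)"
  have ab: "cbox ?a ?b \<subseteq> upper_half_plane" using \<eta> by (auto simp: in_cbox_complex_iff upper_half_plane_def)
  define f where "f = (\<lambda>x y. potential ?a ?b x y / K)"
  have f01: "0 \<le> f x y" "f x y \<le> 1" if "0 < y" for x y
    using potential_bounds[OF ab that, of x] K by (auto simp: f_def K_def exp_constant_def divide_le_eq)
  define k where "k = (\<lambda>x y. 1 + f x y - (f x y)\<^sup>2 / 4)"
  have k: "1 \<le> k x y" "k x y \<le> 7 / 4" if "0 < y" for x y
  proof -
    have "(f x y)\<^sup>2 \<le> f x y" using f01[OF that, of x] by (simp add: power2_eq_square mult_left_le)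
    then show "1 \<le> k x y" using f01[OF that, of x] by (simp add: k_def)
    have "0 \<le> (1 - f x y) * (3 - f x y)" using f01[OF that, of x] by (intro mult_nonneg_nonneg) auto
    then show "k x y \<le> 7 / 4" by (simp add: k_def power2_eq_square algebra_simps)
  qed
  define S where "S = (\<lambda>z. schwarz_integral \<phi> N (z - Complex 0 \<eta>))"
  let ?U = "{z. \<eta> < Im z}"
  have oU: "open ?U" by (rule open_halfspace_Im_gt)
  have holS: "S holomorphic_on ?U"
    unfolding S_def
    by (rule holomorphic_on_compose_gen[OF _ schwarz_holomorphic[OF c\<phi>], unfolded o_def])
       (auto intro!: holomorphic_intros simp: upper_half_plane_def)
  have holS1: "deriv S holomorphic_on ?U" by (intro holomorphic_deriv holS oU)
  define Q where "Q = (\<lambda>x y. Re (S (Complex x y)))"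
  have Q: "Q x y = poisson_integral \<phi> N (Complex x (y - \<eta>))" if "\<eta> < y" for x y
  proof -
    have "Complex x y - Complex 0 \<eta> = Complex x (y - \<eta>)" by (simp add: complex_eq_iff)
    then show ?thesis using Re_schwarz[OF c\<phi>, of "Complex x (y - \<eta>)"] that by (simp add: Q_def S_def)
  qed
  define V where "V = (\<lambda>x y. exp (u x y) * k x y - Q x y + 2 * e)"
  have W0: "exp (u x y) \<le> exp (u x y) * k x y" if "0 < y" for x y
    using mult_left_mono[OF k(1)[OF that, of x], of "exp (u x y)"] by simp
  have Qsmall: "Q x y \<le> e" if xy: "\<bar>x\<bar> = n \<or> y = n" "\<eta> < y" for x y
  proof -
    have y: "0 < y - \<eta>" using xy by simp
    have ptw: "\<phi> t * ((y - \<eta>) / ((t - x)\<^sup>2 + (y - \<eta>)\<^sup>2)) \<le> M * (2 / n)" if t: "t \<in> {-N..N}" for t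
    proof -
      have D: "0 < (t - x)\<^sup>2 + (y - \<eta>)\<^sup>2" using y by (intro add_nonneg_pos) auto
      have "(y - \<eta>) / ((t - x)\<^sup>2 + (y - \<eta>)\<^sup>2) \<le> 2 / n"
      proof (cases "y = n")
        case True
        have "n / 2 * (y - \<eta>) \<le> (y - \<eta>) * (y - \<eta>)" using True n y by (intro mult_right_mono) auto
        also have "\<dots> \<le> (t - x)\<^sup>2 + (y - \<eta>)\<^sup>2" by (simp add: power2_eq_square)
        finally show ?thesis using D n by (simp add: field_simps)
      next
        case False
        then have "\<bar>x\<bar> = n" using xy by simp
        then have q: "n / 2 \<le> \<bar>t - x\<bar>" using t n(1) unfolding atLeastAtMost_iff by linarith
        have "n / 2 * (y - \<eta>) \<le> \<bar>t - x\<bar> * (y - \<eta>)" using q y by (intro mult_right_mono) auto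
        also have "\<dots> \<le> \<bar>t - x\<bar>\<^sup>2 + (y - \<eta>)\<^sup>2"
        proof -
          have "0 \<le> \<bar>t - x\<bar> * (y - \<eta>)" using y by simp
          then show ?thesis using sum_squares_bound[of "\<bar>t - x\<bar>" "y - \<eta>"] by linarith
        qed
        finally show ?thesis using D n by (simp add: field_simps)
      qed
      then show ?thesis using \<phi>0[of t] \<phi>M[of t] D y M0 by (intro mult_mono) auto
    qed
    have "Q x y \<le> 2 * N * (M * (2 / n)) / pi"
      unfolding Q[OF xy(2)] by (rule poisson_integral_bounds(2)[OF c\<phi> \<phi>0 _ N]) (use y ptw in auto)
    also have "\<dots> \<le> 2 * N * (M * (2 / n)) / 1"
      using pi_gt3 N M0 n by (intro divide_left_mono) auto
    also have "\<dots> \<le> e" using n e by (simp add: field_simps)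
    finally show ?thesis .
  qed
  have Vpos: "0 \<le> V 0 (1 + \<eta>)"
  proof (rule superharmonic_minimum_principle[of "-n" "\<eta> + s" n n V])
    let ?B = "cbox (- n, \<eta> + s) (n, n)"
    have "continuous_on ?B (\<lambda>p. S (Complex (fst p) (snd p)))"
      by (rule continuous_on_compose2[OF holomorphic_on_imp_continuous_on[OF holS]]) (use s in \<open>auto intro!: continuous_intros\<close>)
    moreover have "continuous_on ?B (\<lambda>p. f (fst p) (snd p))"
    proof -
      have nz: "(fst p - Re w)\<^sup>2 + (snd p + Im w)\<^sup>2 \<noteq> 0" if "p \<in> ?B" "w \<in> cbox ?a ?b" for p :: "real \<times> real" and w
        using kernel_denominator_pos(3)[OF ab _ that(2), of "snd p" "fst p"] that(1) s \<eta> by (cases p) auto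
      have "continuous_on (?B \<times> cbox ?a ?b) (\<lambda>q. deriv g (snd q))"
        by (rule continuous_on_compose2[OF cont_deriv[OF ab]]) (auto intro!: continuous_intros)
      then have "continuous_on ?B (\<lambda>p. integral (cbox ?a ?b) (\<lambda>w. (cmod (deriv g w))\<^sup>2 * (4 * Im w * snd p / ((fst p - Re w)\<^sup>2 + (snd p + Im w)\<^sup>2))))"
        by (intro integral_continuous_on_param) (unfold case_prod_beta', intro continuous_intros, use nz in auto)
      then show ?thesis unfolding f_def potential_def using K by (intro continuous_intros) auto
    qed
    moreover have "continuous_on ?B (\<lambda>p. u (fst p) (snd p))" by (rule cu0) (use s \<eta> in auto)
    ultimately show "continuous_on ?B (\<lambda>(x, y). V x y)"
      unfolding V_def k_def Q_def case_prod_beta' by (intro continuous_intros) auto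
  next
    fix x y assume xy: "-n < x" "x < n" "\<eta> + s < y" "y < n"
    have y: "0 < y" and z: "Complex x y \<in> upper_half_plane" "Complex x y \<in> ?U" using xy s \<eta> by auto
    note hu = holomorphic_partial_derivatives[OF dG[OF z(1)]]
    note hu1 = holomorphic_partial_derivatives[OF dG1[OF z(1)]]
    note hS = holomorphic_partial_derivatives[OF holomorphic_derivI[OF holS oU z(2)]]
    note hS1 = holomorphic_partial_derivatives[OF holomorphic_derivI[OF holS1 oU z(2)]]
    note pd = DERIV_cdivide[OF potential_derivatives(1)[OF ab y], where c=K] DERIV_cdivide[OF potential_derivatives(2)[OF ab y], where c=K]
       DERIV_cdivide[OF potential_derivatives(3)[OF ab y], where c=K] DERIV_cdivide[OF potential_derivatives(4)[OF ab y], where c=K]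
    let ?px = "potential_x ?a ?b x y / K" and ?py = "potential_y ?a ?b x y / K"
    let ?pxx = "potential_xx ?a ?b x y / K" and ?pyy = "potential_yy ?a ?b x y / K"
    let ?z = "Complex x y"
    let ?ux = "Re (G1 ?z)" and ?uy = "- Im (G1 ?z)" and ?uxx = "Re (deriv G1 ?z)" and ?S2 = "Re (deriv (deriv S) ?z)"
    let ?m = "1 - f x y / 2"
    have d1: "((\<lambda>t. u t y) has_real_derivative ?ux) (at x)"
      "((\<lambda>t. u x t) has_real_derivative ?uy) (at y)"
      unfolding u_def by (rule hu)+
    have d2: "((\<lambda>t. f t y) has_real_derivative ?px) (at x)"
      "((\<lambda>t. f x t) has_real_derivative ?py) (at y)"
      unfolding f_def by (rule pd)+
    have d3: "((\<lambda>t. Q t y) has_real_derivative Re (deriv S ?z)) (at x)"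
      "((\<lambda>t. Q x t) has_real_derivative - Im (deriv S ?z)) (at y)"
      unfolding Q_def by (rule hS)+
    note ex = exp_times_concave_derivatives[of "\<lambda>t. u t y" "\<lambda>t. Re (G1 (Complex t y))" x "\<lambda>t. f t y" "\<lambda>t. potential_x ?a ?b t y / K",
         OF d1(1) d2(1)]
    note ey = exp_times_concave_derivatives[of "\<lambda>t. u x t" "\<lambda>t. - Im (G1 (Complex x t))" y "\<lambda>t. f x t" "\<lambda>t. potential_y ?a ?b x t / K",
         OF d1(2) d2(2)]
    show "((\<lambda>t. V t y) has_real_derivative
        exp (u x y) * (?ux * k x y + ?m * ?px) - Re (deriv S ?z)) (at x)"
      unfolding V_def k_def by (rule DERIV_cong[OF DERIV_add[OF DERIV_diff[OF ex(1) d3(1)] DERIV_const]]) simp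
    show "((\<lambda>t. exp (u t y) * (Re (G1 (Complex t y)) * k t y + (1 - f t y / 2) * (potential_x ?a ?b t y / K)) - Re (deriv S (Complex t y))) has_real_derivative
        exp (u x y) * (?ux\<^sup>2 * k x y + 2 * ?ux * ?m * ?px
          + ?uxx * k x y - ?px\<^sup>2 / 2 + ?m * ?pxx) - ?S2) (at x)"
      unfolding k_def by (rule DERIV_diff[OF ex(2)[OF hu1(1) pd(2)] hS1(1)])
    show "((\<lambda>t. V x t) has_real_derivative
        exp (u x y) * (?uy * k x y + ?m * ?py) - (- Im (deriv S ?z))) (at y)"
      unfolding V_def k_def by (rule DERIV_cong[OF DERIV_add[OF DERIV_diff[OF ey(1) d3(2)] DERIV_const]]) simp
    show "((\<lambda>t. exp (u x t) * (- Im (G1 (Complex x t)) * k x t + (1 - f x t / 2) * (potential_y ?a ?b x t / K)) - (- Im (deriv S (Complex x t)))) has_real_derivative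
        exp (u x y) * ((?uy)\<^sup>2 * k x y + 2 * (?uy) * ?m * ?py
          + (- ?uxx) * k x y - ?py\<^sup>2 / 2 + ?m * ?pyy) - (- ?S2)) (at y)"
      unfolding k_def by (rule DERIV_diff[OF ey(2)[OF DERIV_minus[OF hu1(4)] pd(4)] DERIV_minus[OF hS1(4)]])
    define p where "p = (cmod (deriv g ?z))\<^sup>2"
    have sq: "csquare ?z (y / 2) \<subseteq> cbox ?a ?b"
    proof
      fix w assume "w \<in> csquare ?z (y / 2)"
      then have "\<bar>Re w - x\<bar> \<le> y / 2" "\<bar>Im w - y\<bar> \<le> y / 2" unfolding mem_csquare by auto
      then have "- 2 * n \<le> Re w" "Re w \<le> 2 * n" "\<eta> / 2 \<le> Im w" "Im w \<le> 2 * n" using xy s y by linarith+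
      then show "w \<in> cbox ?a ?b" by (simp add: in_cbox_complex_iff)
    qed
    have "(potential_xx ?a ?b x y + potential_yy ?a ?b x y) / K \<le> (- p / 132) / K"
      unfolding p_def by (intro divide_right_mono potential_Laplacian[OF ab y sq]) (use K in auto)
    then have L: "?pxx + ?pyy \<le> - (p / (132 * K))"
      by (simp add: add_divide_distrib)
    have "?ux\<^sup>2 + (?uy)\<^sup>2 = (cmod \<kappa>)\<^sup>2 * p"
      unfolding power2_minus cmod_power2[symmetric] by (simp only: p_def G1_def norm_mult power_mult_distrib)
    moreover have "15 / 2 * ((cmod \<kappa>)\<^sup>2 * p) \<le> p / (132 * K)"
    proof -
      have "990 * (K * (cmod \<kappa>)\<^sup>2) \<le> 1" 
      proof -
        have "0 \<le> K * (cmod \<kappa>)\<^sup>2" using K by simp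
        moreover have "1100 * (K * (cmod \<kappa>)\<^sup>2) \<le> 1" using \<kappa> by (simp add: K_def mult.assoc)
        ultimately show ?thesis by linarith
      qed
      then have "(990 * (K * (cmod \<kappa>)\<^sup>2)) * p \<le> 1 * p" by (intro mult_right_mono) (auto simp: p_def)
      then show ?thesis using K by (simp add: field_simps)
    qed
    ultimately have a: "15 / 2 * (?ux\<^sup>2 + (?uy)\<^sup>2) \<le> p / (132 * K)" by simp
    have "(?ux\<^sup>2 * k x y + 2 * ?ux * ?m * ?px - ?px\<^sup>2 / 2)
      + ((?uy)\<^sup>2 * k x y + 2 * (?uy) * ?m * ?py - ?py\<^sup>2 / 2)
      + ?m * (?pxx + ?pyy) \<le> 0"
      by (rule Laplacian_inequality[OF k(2)[OF y] _ _ L _ a]) (use f01[OF y, of x] K in \<open>auto simp: p_def\<close>)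
    then have "exp (u x y) * ((?ux\<^sup>2 * k x y + 2 * ?ux * ?m * ?px - ?px\<^sup>2 / 2)
      + ((?uy)\<^sup>2 * k x y + 2 * (?uy) * ?m * ?py - ?py\<^sup>2 / 2)
      + ?m * (?pxx + ?pyy)) \<le> 0"
      by (intro mult_nonneg_nonpos) auto
    then show "exp (u x y) * (?ux\<^sup>2 * k x y + 2 * ?ux * ?m * ?px
          + ?uxx * k x y - ?px\<^sup>2 / 2 + ?m * ?pxx) - ?S2
        + (exp (u x y) * ((?uy)\<^sup>2 * k x y + 2 * (?uy) * ?m * ?py
          + (- ?uxx) * k x y - ?py\<^sup>2 / 2 + ?m * ?pyy) - (- ?S2)) \<le> 0"
      by (simp only: distrib_left) (simp add: algebra_simps)
  next
    fix x y assume xy: "-n \<le> x" "x \<le> n" "\<eta> + s \<le> y" "y \<le> n" and b: "x = - n \<or> x = n \<or> y = \<eta> + s \<or> y = n"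
    have y: "\<eta> < y" "0 < y" using xy s \<eta> by auto
    have W: "0 < exp (u x y)" "exp (u x y) \<le> exp (u x y) * k x y" using W0[OF y(2)] by auto
    show "0 \<le> V x y"
    proof (cases "y = \<eta> + s")
      case False
      then have "\<bar>x\<bar> = n \<or> y = n" using b n by auto
      from Qsmall[OF this y(1)] show ?thesis unfolding V_def using W e by linarith
    next
      case True
      have "Q x y \<le> \<phi> x + e" using d(2)[of s x] s Q[OF y(1), of x] True by simp
      moreover have "\<phi> x \<le> exp (u x y) + e"
      proof (cases "\<bar>x\<bar> \<le> N")
        case xN: True
        have "dist (x, \<eta>) (x, y) < d'" using True s by (simp add: dist_Pair_Pair dist_real_def)
        then have "dist (exp (u x \<eta>)) (exp (u x y)) < e"
          using d'(2)[of "(x, \<eta>)" "(x, y)"] xN True s by (auto simp: abs_le_iff)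
        moreover have "\<phi> x \<le> exp (u x \<eta>)" using \<phi>u[of x] by (simp add: u_def G_def)
        ultimately show ?thesis unfolding dist_real_def by linarith
      next
        case False
        then show ?thesis using supp[of x] e by (simp add: add_nonneg_nonneg)
      qed
      ultimately show ?thesis unfolding V_def using W by linarith
    qed
  qed (use n s \<eta> N in auto)
  have "Q 0 (1 + \<eta>) = poisson_integral \<phi> N \<i>"
    using Q[of "1 + \<eta>" 0] by (simp add: Complex_eq)
  moreover have "exp (u 0 (1 + \<eta>)) * k 0 (1 + \<eta>) \<le> exp (u 0 (1 + \<eta>)) * 2"
    using k(2)[of "1 + \<eta>" 0] \<eta> by (intro mult_left_mono) auto
  ultimately have "poisson_integral \<phi> N \<i> \<le> exp (u 0 (1 + \<eta>)) * 2 + 2 * e"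
    using Vpos unfolding V_def by linarith
  then show ?thesis unfolding u_def G_def by linarith
qed

text \<open>
  Apply the comparison to \<open>exp (Re (\<kappa> g))\<close> times continuous cut-off functions that increase to \<open>1\<close>.  At the
  point \<open>i (1 + \<eta>)\<close> the Poisson kernel of the line at height \<open>\<eta>\<close> is \<open>1 / (\<pi> (1 + t\<^sup>2))\<close>.
\<close>
lemma exp_nn_integral_bound:
  assumes \<eta>: "0 < \<eta>" and \<kappa>: "1100 * exp_constant * (cmod \<kappa>)\<^sup>2 \<le> 1"
  shows "(\<integral>\<^sup>+t. ennreal (exp (Re (\<kappa> * g (Complex t \<eta>))) / (1 + t\<^sup>2)) \<partial>lborel)
     \<le> ennreal (2 * pi * exp (Re (\<kappa> * g (Complex 0 (1 + \<eta>)))))"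
proof -
  define v where "v = (\<lambda>t. exp (Re (\<kappa> * g (Complex t \<eta>))))"
  define E where "E = exp (Re (\<kappa> * g (Complex 0 (1 + \<eta>))))"
  have cg: "continuous_on S (\<lambda>t. g (Complex t \<eta>))" for S
    by (rule continuous_on_compose2[OF holomorphic_on_imp_continuous_on[OF hol]]) (use \<eta> in \<open>auto intro!: continuous_intros\<close>)
  then have cv: "continuous_on S v" for S unfolding v_def by (intro continuous_intros)
  have v0: "0 < v t" for t by (simp add: v_def)
  have nz: "1 + t\<^sup>2 \<noteq> 0" "0 < 1 + t\<^sup>2" for t :: real by (simp_all add: add_pos_nonneg) (metis add_pos_nonneg less_irrefl zero_le_power2 zero_less_one)
  have fin: "(\<integral>\<^sup>+t. ennreal (v t / (1 + t\<^sup>2)) * indicator {- real n..real n} t \<partial>lborel) \<le> ennreal (2 * pi * E)" for n :: nat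
  proof -
    define N where "N = real n + 1"
    have N: "0 < N" by (simp add: N_def)
    define \<phi> where "\<phi> = (\<lambda>t. v t * max 0 (min 1 (N - \<bar>t\<bar>)))"
    have c\<phi>: "continuous_on S \<phi>" for S unfolding \<phi>_def by (intro continuous_intros cv)
    have \<phi>0: "0 \<le> \<phi> t" for t using v0[of t] by (simp add: \<phi>_def)
    have \<phi>v: "\<phi> t \<le> v t" for t using v0[of t] by (auto simp: \<phi>_def intro: mult_left_le)
    have supp: "\<phi> t = 0" if "N \<le> \<bar>t\<bar>" for t using that by (simp add: \<phi>_def)
    have "{-N..N} \<noteq> {}" using N by simp
    from continuous_attains_sup[OF compact_Icc this cv]
    obtain m where m: "\<And>t. t \<in> {-N..N} \<Longrightarrow> v t \<le> v m" by blast
    have \<phi>M: "\<phi> t \<le> v m" for t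
    proof (cases "N \<le> \<bar>t\<bar>")
      case True
      then show ?thesis using supp[OF True] v0[of m] by simp
    next
      case False
      then have "t \<in> {-N..N}" by (auto simp: abs_le_iff not_le)
      from m[OF this] \<phi>v[of t] show ?thesis by linarith
    qed
    have "poisson_integral \<phi> N \<i> \<le> 2 * E + e" if "0 < e" for e
      using poisson_exp_bound[OF \<eta> \<kappa> N, of "e / 2" \<phi> "v m"] that c\<phi> \<phi>0 \<phi>M supp \<phi>v by (simp add: v_def E_def)
    then have P: "poisson_integral \<phi> N \<i> \<le> 2 * E" by (rule field_le_epsilon)
    have i1: "(\<lambda>t. \<phi> t / (1 + t\<^sup>2)) integrable_on {-N..N}"
      by (intro integrable_continuous_interval continuous_intros c\<phi>) (use nz in auto)
    have "poisson_integral \<phi> N \<i> = integral {-N..N} (\<lambda>t. \<phi> t / (1 + t\<^sup>2)) / pi"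
      by (simp add: poisson_integral_def add.commute)
    then have I: "integral {-N..N} (\<lambda>t. \<phi> t / (1 + t\<^sup>2)) \<le> 2 * pi * E" using P by (simp add: divide_le_eq mult_ac)
    have "(\<integral>\<^sup>+t. ennreal (v t / (1 + t\<^sup>2)) * indicator {- real n..real n} t \<partial>lborel)
       \<le> (\<integral>\<^sup>+t. ennreal (\<phi> t / (1 + t\<^sup>2)) * indicator {-N..N} t \<partial>lborel)"
    proof (rule nn_integral_mono)
      fix t
      have "v t = \<phi> t" "t \<in> {-N..N}" if "t \<in> {- real n..real n}"
        using that by (auto simp: \<phi>_def N_def)
      then show "ennreal (v t / (1 + t\<^sup>2)) * indicator {- real n..real n} t \<le> ennreal (\<phi> t / (1 + t\<^sup>2)) * indicator {-N..N} t"
        by (auto simp: indicator_def)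
    qed
    also have "\<dots> = ennreal (integral {-N..N} (\<lambda>t. \<phi> t / (1 + t\<^sup>2)))"
      using \<phi>0 nz by (intro nn_integral_has_integral_lebesgue' integrable_integral i1) auto
    also have "\<dots> \<le> ennreal (2 * pi * E)" using I by (rule ennreal_leI)
    finally show ?thesis .
  qed
  have "(\<lambda>t. ennreal (v t / (1 + t\<^sup>2))) = (\<lambda>t. SUP n::nat. ennreal (v t / (1 + t\<^sup>2)) * indicator {- real n..real n} t)"
  proof
    fix t
    obtain n :: nat where n: "\<bar>t\<bar> \<le> real n" using real_arch_simple by blast
    show "ennreal (v t / (1 + t\<^sup>2)) = (SUP n::nat. ennreal (v t / (1 + t\<^sup>2)) * indicator {- real n..real n} t)"
    proof (rule antisym)
      show "ennreal (v t / (1 + t\<^sup>2)) \<le> (SUP n::nat. ennreal (v t / (1 + t\<^sup>2)) * indicator {- real n..real n} t)"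
        using n by (intro SUP_upper2[of n]) (auto simp: indicator_def abs_le_iff)
      show "(SUP n::nat. ennreal (v t / (1 + t\<^sup>2)) * indicator {- real n..real n} t) \<le> ennreal (v t / (1 + t\<^sup>2))"
        by (intro SUP_least) (auto simp: indicator_def)
    qed
  qed
  then have "(\<integral>\<^sup>+t. ennreal (v t / (1 + t\<^sup>2)) \<partial>lborel) = (\<integral>\<^sup>+t. (SUP n::nat. ennreal (v t / (1 + t\<^sup>2)) * indicator {- real n..real n} t) \<partial>lborel)"
    by simp
  also have "\<dots> = (SUP n::nat. \<integral>\<^sup>+t. ennreal (v t / (1 + t\<^sup>2)) * indicator {- real n..real n} t \<partial>lborel)"
  proof (rule nn_integral_monotone_convergence_SUP)
    show "incseq (\<lambda>n t. ennreal (v t / (1 + t\<^sup>2)) * indicator {- real n..real n} t)"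
      by (intro incseq_SucI le_funI mult_left_mono) (auto simp: indicator_def)
    have [measurable]: "v \<in> borel_measurable borel" by (intro borel_measurable_continuous_onI cv)
    show "(\<lambda>t. ennreal (v t / (1 + t\<^sup>2)) * indicator {- real n..real n} t) \<in> borel_measurable lborel" for n :: nat
      by measurable
  qed
  also have "\<dots> \<le> ennreal (2 * pi * E)" by (intro SUP_least fin)
  finally show ?thesis by (simp add: v_def E_def)
qed

text \<open>
  The modulus of \<open>g\<close> is controlled by the real parts of \<open>\<alpha> g\<close> for \<open>\<alpha> = \<plusminus>1, \<plusminus>\<i>\<close>, and the values of \<open>g\<close> at
  the points \<open>i (1 + \<eta>)\<close> stay bounded for \<open>\<eta> \<le> 1\<close>.
\<close>
lemma john_nirenberg:
  obtains c C where "0 < c" "0 \<le> C"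
    "\<And>\<eta>. 0 < \<eta> \<Longrightarrow> \<eta> \<le> 1 \<Longrightarrow> (\<integral>\<^sup>+t. ennreal (exp (c * cmod (g (Complex t \<eta>))) / (1 + t\<^sup>2)) \<partial>lborel) \<le> ennreal C"
proof -
  define c where "c = 1 / sqrt (1100 * exp_constant)"
  have K: "0 < 1100 * exp_constant" using exp_constant_pos by simp
  have c: "0 < c" using K by (simp add: c_def)
  have c2: "1100 * exp_constant * c\<^sup>2 = 1" using K by (simp add: c_def power_divide)
  have "compact ((\<lambda>y. Complex 0 y) ` {1..2})" by (intro compact_continuous_image continuous_intros) auto
  moreover have "continuous_on ((\<lambda>y. Complex 0 y) ` {1..2}) g"
    by (rule continuous_on_subset[OF holomorphic_on_imp_continuous_on[OF hol]]) auto
  ultimately have "bounded (g ` (\<lambda>y. Complex 0 y) ` {1..2})"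
    using compact_imp_bounded[OF compact_continuous_image] by blast
  then obtain B where B: "\<And>y. 1 \<le> y \<Longrightarrow> y \<le> 2 \<Longrightarrow> cmod (g (Complex 0 y)) \<le> B"
    unfolding bounded_iff by (metis (no_types, lifting) atLeastAtMost_iff imageI)
  define C where "C = 4 * (2 * pi * exp (c * B))"
  show ?thesis
  proof (rule that[of "c / 2" C])
    fix \<eta> :: real assume \<eta>: "0 < \<eta>" "\<eta> \<le> 1"
    let ?g = "\<lambda>t. g (Complex t \<eta>)"
    let ?I = "\<lambda>\<alpha>. \<integral>\<^sup>+t. ennreal (exp (Re (\<alpha> * ?g t)) / (1 + t\<^sup>2)) \<partial>lborel"
    have I: "?I (of_real c * \<alpha>) \<le> ennreal (2 * pi * exp (c * B))" if "cmod \<alpha> = 1" for \<alpha>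
    proof -
      have "?I (of_real c * \<alpha>) \<le> ennreal (2 * pi * exp (Re (of_real c * \<alpha> * g (Complex 0 (1 + \<eta>)))))"
        by (rule exp_nn_integral_bound[OF \<eta>(1)]) (use c2 c that in \<open>simp add: norm_mult\<close>)
      also have "\<dots> \<le> ennreal (2 * pi * exp (c * B))"
      proof -
        have "Re (of_real c * \<alpha> * g (Complex 0 (1 + \<eta>))) \<le> c * cmod (g (Complex 0 (1 + \<eta>)))"
          using complex_Re_le_cmod[of "of_real c * \<alpha> * g (Complex 0 (1 + \<eta>))"] c that by (simp add: norm_mult)
        also have "\<dots> \<le> c * B" using B[of "1 + \<eta>"] \<eta> c by (intro mult_left_mono) auto
        finally show ?thesis by (intro ennreal_leI mult_left_mono) auto
      qed
      finally show ?thesis .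
    qed
    have cg: "continuous_on UNIV ?g"
      by (rule continuous_on_compose2[OF holomorphic_on_imp_continuous_on[OF hol]]) (use \<eta> in \<open>auto intro!: continuous_intros\<close>)
    then have [measurable]: "?g \<in> borel_measurable borel" by (rule borel_measurable_continuous_onI)
    let ?e = "\<lambda>\<alpha> t. ennreal (exp (Re (of_real c * \<alpha> * ?g t)) / (1 + t\<^sup>2))"
    have ptw: "ennreal (exp (c / 2 * cmod (?g t)) / (1 + t\<^sup>2)) \<le> ?e 1 t + ?e (-1) t + ?e \<i> t + ?e (-\<i>) t" for t
    proof -
      define p q where "p = c * \<bar>Re (?g t)\<bar>" and "q = c * \<bar>Im (?g t)\<bar>"
      have pos: "0 < 1 + t\<^sup>2" by (simp add: add_pos_nonneg)
      have "c / 2 * cmod (?g t) \<le> c / 2 * (\<bar>Re (?g t)\<bar> + \<bar>Im (?g t)\<bar>)"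
        using c cmod_le[of "?g t"] by (intro mult_left_mono) auto
      also have "\<dots> \<le> max p q" by (simp add: p_def q_def algebra_simps)
      finally have "exp (c / 2 * cmod (?g t)) \<le> exp (max p q)" by simp
      also have "\<dots> \<le> exp p + exp q" by (simp add: max_def)
      also have "exp p \<le> exp (c * Re (?g t)) + exp (- (c * Re (?g t)))" by (auto simp: p_def abs_if)
      also have "exp q \<le> exp (c * Im (?g t)) + exp (- (c * Im (?g t)))" by (auto simp: q_def abs_if)
      finally have "exp (c / 2 * cmod (?g t)) \<le> exp (c * Re (?g t)) + exp (- (c * Re (?g t))) + exp (- (c * Im (?g t))) + exp (c * Im (?g t))"
        by simp
      then have "exp (c / 2 * cmod (?g t)) / (1 + t\<^sup>2) \<le> (exp (c * Re (?g t)) + exp (- (c * Re (?g t))) + exp (- (c * Im (?g t))) + exp (c * Im (?g t))) / (1 + t\<^sup>2)"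
        using pos by (intro divide_right_mono) auto
      then have "ennreal (exp (c / 2 * cmod (?g t)) / (1 + t\<^sup>2)) \<le> ennreal (exp (c * Re (?g t)) / (1 + t\<^sup>2) + exp (- (c * Re (?g t))) / (1 + t\<^sup>2)
          + exp (- (c * Im (?g t))) / (1 + t\<^sup>2) + exp (c * Im (?g t)) / (1 + t\<^sup>2))"
        by (intro ennreal_leI) (simp add: add_divide_distrib)
      also have "\<dots> = ?e 1 t + ?e (-1) t + ?e \<i> t + ?e (-\<i>) t"
        using pos by (simp add: less_imp_le)
      finally show ?thesis .
    qed
    have "(\<integral>\<^sup>+t. ennreal (exp (c / 2 * cmod (?g t)) / (1 + t\<^sup>2)) \<partial>lborel) \<le> (\<integral>\<^sup>+t. ?e 1 t + ?e (-1) t + ?e \<i> t + ?e (-\<i>) t \<partial>lborel)"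
      by (intro nn_integral_mono ptw)
    also have "\<dots> = ?I (of_real c * 1) + ?I (of_real c * (-1)) + ?I (of_real c * \<i>) + ?I (of_real c * (- \<i>))"
    proof -
      have [measurable]: "?e \<alpha> \<in> borel_measurable lborel" for \<alpha> by measurable
      show ?thesis by (subst nn_integral_add; (measurable)?)+ 
    qed
    also have "\<dots> \<le> ennreal (2 * pi * exp (c * B)) + ennreal (2 * pi * exp (c * B)) + ennreal (2 * pi * exp (c * B)) + ennreal (2 * pi * exp (c * B))"
      by (intro add_mono I) auto
    also have "\<dots> = ennreal C" by (simp add: C_def flip: ennreal_plus)
    finally show "(\<integral>\<^sup>+t. ennreal (exp (c / 2 * cmod (?g t)) / (1 + t\<^sup>2)) \<partial>lborel) \<le> ennreal C" .
  qed (use c in \<open>auto simp: C_def\<close>)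
qed

end

section \<open>The weight and the Luxemburg norm\<close>

lemma log_plus_nonneg [simp]: "0 \<le> log_plus s"
  by (simp add: log_plus_def)

lemma log_plus_ge_ln: "ln s \<le> log_plus s"
  by (simp add: log_plus_def)

lemma le_exp_log_plus: "0 \<le> t \<Longrightarrow> t \<le> exp (log_plus t)"
  by (cases "t = 0") (auto simp: log_plus_def max_def ln_ge_iff not_le)

lemma log_plus_mult: 
  assumes "1 \<le> m" "0 \<le> t" shows "log_plus (t * m) \<le> log_plus t + ln m"
proof (cases "t = 0")
  case False
  then show ?thesis using assms by (auto simp: log_plus_def ln_mult max_def)
qed (use assms in \<open>simp add: log_plus_def\<close>)

lemma theta_denominator_pos: "0 < 1 + log_plus \<bar>x\<bar> + log_plus t / 2"
  using log_plus_nonneg[of "\<bar>x\<bar>"] log_plus_nonneg[of t] by linarith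

lemma theta_nonneg: "0 \<le> t \<Longrightarrow> 0 \<le> theta x t"
  using theta_denominator_pos[of x t] by (simp add: theta_def)

lemma theta_le: "0 \<le> t \<Longrightarrow> theta x t \<le> t"
  using theta_denominator_pos[of x t] by (simp add: theta_def divide_le_eq mult_left_mono mult_le_cancel_left1)

lemma theta_mono:
  assumes "0 \<le> s" "s \<le> t" shows "theta x s \<le> theta x t"
proof (cases "s = 0")
  case True
  then show ?thesis using theta_nonneg[of t x] assms by (simp add: theta_def)
next
  case False
  then have s: "0 < s" using assms by simp
  define a where "a = 1 + log_plus \<bar>x\<bar>"
  have a: "1 \<le> a" by (simp add: a_def)
  have "log_plus t \<le> log_plus s + ln (t / s)"
    using log_plus_mult[of "t / s" s] s assms by simp
  also have "ln (t / s) \<le> t / s - 1" using s assms by (intro ln_le_minus_one) auto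
  finally have "s * log_plus t \<le> s * (log_plus s + (t / s - 1))" using s by (intro mult_left_mono) auto
  then have 1: "s * log_plus t \<le> s * log_plus s + (t - s)" using s by (simp add: algebra_simps)
  have 2: "s * log_plus s \<le> t * log_plus s" using assms by (intro mult_right_mono) auto
  have 3: "(t - s) * 1 \<le> (t - s) * a" using a assms by (intro mult_left_mono) auto
  have "s * (a + log_plus t / 2) \<le> t * (a + log_plus s / 2)"
    using 1 2 3 assms by (simp add: algebra_simps)
  then show ?thesis
    using theta_denominator_pos[of x s] theta_denominator_pos[of x t] by (simp add: theta_def frac_le_eq a_def divide_le_eq pos_divide_le_eq pos_le_divide_eq)
qed

text \<open>
  The factor tends to \<open>0\<close> as \<open>m \<rightarrow> \<infinity>\<close>.  Therefore finiteness of the integral of \<open>\<theta>\<close> already bounds the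
  Luxemburg norm, although \<open>\<theta>\<close> is not homogeneous in \<open>t\<close>.
\<close>
lemma theta_divide_le:
  assumes "1 \<le> m" "0 \<le> t" shows "theta x (t / m) \<le> (1 + ln m / 2) / m * theta x t"
proof -
  define a where "a = 1 + log_plus \<bar>x\<bar>"
  have a: "1 \<le> a" by (simp add: a_def)
  have l0: "0 \<le> ln m" using assms by simp
  have l: "log_plus t \<le> log_plus (t / m) + ln m" using log_plus_mult[of m "t / m"] assms by simp
  have p: "0 < a + log_plus (t / m) / 2" "0 < a + log_plus t / 2"
    using theta_denominator_pos[of x] by (simp_all add: a_def)
  have "0 \<le> (ln m / 2) * (a - 1 + log_plus (t / m) / 2)" using l0 a by (intro mult_nonneg_nonneg) auto
  then have "a + log_plus t / 2 \<le> (1 + ln m / 2) * (a + log_plus (t / m) / 2)"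
  proof -
    have "(1 + ln m / 2) * (a + log_plus (t / m) / 2) = a + log_plus (t / m) / 2 + (ln m / 2) * (a - 1 + log_plus (t / m) / 2) + ln m / 2"
      by (simp add: field_simps)
    then show ?thesis using l \<open>0 \<le> (ln m / 2) * (a - 1 + log_plus (t / m) / 2)\<close> by linarith
  qed
  then have "1 / (a + log_plus (t / m) / 2) \<le> (1 + ln m / 2) / (a + log_plus t / 2)"
  proof -
    have "1 / X \<le> c / Y" if "0 < X" "0 < Y" "Y \<le> c * X" for X Y c :: real
      using that by (simp add: field_simps)
    then show ?thesis using p \<open>a + log_plus t / 2 \<le> (1 + ln m / 2) * (a + log_plus (t / m) / 2)\<close> by blast
  qed
  then have "t / m * (1 / (a + log_plus (t / m) / 2)) \<le> t / m * ((1 + ln m / 2) / (a + log_plus t / 2))"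
    using assms by (intro mult_left_mono) auto
  then show ?thesis by (simp add: theta_def a_def mult.commute)
qed

lemma measurable_theta [measurable]:
  assumes [measurable]: "f \<in> borel_measurable M" "g \<in> borel_measurable M"
  shows "(\<lambda>z. theta (f z) (g z)) \<in> borel_measurable M"
  unfolding theta_def log_plus_def by measurable

text \<open>Divide by \<open>M\<^sup>2\<close>: the factor of the preceding lemma is then \<open>(1 + ln M) / M\<^sup>2 \<le> 1 / M\<close>.\<close>
lemma Llog_norm_le:
  assumes f [measurable]: "f \<in> borel_measurable borel" and M: "1 \<le> M"
    and le: "(\<integral>\<^sup>+x. ennreal (theta x (cmod (f x))) \<partial>lborel) \<le> ennreal M"
  shows "Llog_norm f \<le> ennreal (M\<^sup>2)"
proof -
  have "1 + ln (M\<^sup>2) / 2 \<le> M" using ln_le_minus_one[of M] M by (simp add: ln_realpow)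
  then have c: "(1 + ln (M\<^sup>2) / 2) / M\<^sup>2 \<le> 1 / M"
    using M by (simp add: power2_eq_square divide_simps)
  have "(\<integral>\<^sup>+x. ennreal (theta x (cmod (f x) / M\<^sup>2)) \<partial>lborel) \<le> (\<integral>\<^sup>+x. ennreal (1 / M) * ennreal (theta x (cmod (f x))) \<partial>lborel)"
  proof (rule nn_integral_mono)
    fix x
    have "theta x (cmod (f x) / M\<^sup>2) \<le> (1 + ln (M\<^sup>2) / 2) / M\<^sup>2 * theta x (cmod (f x))"
      using M by (intro theta_divide_le) auto
    also have "\<dots> \<le> 1 / M * theta x (cmod (f x))" by (intro mult_right_mono c theta_nonneg) auto
    finally show "ennreal (theta x (cmod (f x) / M\<^sup>2)) \<le> ennreal (1 / M) * ennreal (theta x (cmod (f x)))"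
      using M theta_nonneg[of "cmod (f x)" x] by (simp add: ennreal_leI flip: ennreal_mult)
  qed
  also have "\<dots> = ennreal (1 / M) * (\<integral>\<^sup>+x. ennreal (theta x (cmod (f x))) \<partial>lborel)"
    by (intro nn_integral_cmult) measurable
  also have "\<dots> \<le> ennreal (1 / M) * ennreal M" by (intro mult_left_mono le) auto
  also have "\<dots> = 1" using M by (simp flip: ennreal_mult)
  finally show ?thesis
    unfolding Llog_norm_def using M by (intro Inf_lower CollectI exI[of _ "M\<^sup>2"]) auto
qed

section \<open>Products\<close>

lemma continuous_on_line:
  assumes "f holomorphic_on upper_half_plane" "0 < y"
  shows "continuous_on S (\<lambda>x. f (Complex x y))"
  by (rule continuous_on_compose2[OF holomorphic_on_imp_continuous_on[OF assms(1)]]) (use assms(2) in \<open>auto intro!: continuous_intros\<close>)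

lemma measurable_on_line:
  assumes "f holomorphic_on upper_half_plane" "0 < y"
  shows "(\<lambda>x. f (Complex x y)) \<in> borel_measurable borel"
  by (intro borel_measurable_continuous_onI continuous_on_line assms)

lemma strip_nn_integral_le:
  fixes F :: "complex \<Rightarrow> ennreal"
  assumes [measurable]: "F \<in> borel_measurable borel"
    and le: "\<And>y. a \<le> y \<Longrightarrow> y \<le> b \<Longrightarrow> (\<integral>\<^sup>+x. F (Complex x y) \<partial>lborel) \<le> C"
    and zero: "\<And>x y. y < a \<or> b < y \<Longrightarrow> F (Complex x y) = 0" and ab: "a \<le> b"
  shows "(\<integral>\<^sup>+z. F z \<partial>lborel) \<le> C * ennreal (b - a)"
proof -
  have "(\<integral>\<^sup>+z. F z \<partial>lborel) = (\<integral>\<^sup>+y. \<integral>\<^sup>+x. F (Complex x y) \<partial>lborel \<partial>lborel)"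
    by (rule nn_integral_complex(2)) measurable
  also have "\<dots> \<le> (\<integral>\<^sup>+y. C * indicator {a..b} y \<partial>lborel)"
  proof (rule nn_integral_mono)
    fix y
    show "(\<integral>\<^sup>+x. F (Complex x y) \<partial>lborel) \<le> C * indicator {a..b} y"
      using le[of y] zero[of y] by (cases "y \<in> {a..b}") (auto simp: not_le)
  qed
  also have "\<dots> = C * ennreal (b - a)" using ab by (simp add: nn_integral_cmult_indicator)
  finally show ?thesis .
qed

text \<open>The area mean over a square that occupies the strip \<open>[Im z / 2, 3 Im z / 2]\<close>.\<close>
lemma hardy1_pointwise:
  assumes hol: "f holomorphic_on upper_half_plane" and A: "0 \<le> A"
    and le: "\<And>y. 0 < y \<Longrightarrow> (\<integral>\<^sup>+x. ennreal (cmod (f (Complex x y))) \<partial>lborel) \<le> ennreal A"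
    and z: "0 < Im z"
  shows "cmod (f z) \<le> 12 * A / Im z"
proof -
  define y where "y = Im z"
  have y: "0 < y" using z by (simp add: y_def)
  let ?sq = "csquare z (y / 2)"
  have sub: "?sq \<subseteq> upper_half_plane" using y by (intro csquare_half_subset_uhp) (auto simp: y_def)
  let ?F = "\<lambda>w. ennreal (cmod (f w)) * indicator ?sq w"
  have meas: "?F \<in> borel_measurable borel"
    by (rule measurable_continuous_times_indicator[OF _ open_upper_half_plane _ sub])
       (auto intro!: continuous_intros holomorphic_on_imp_continuous_on hol)
  have "ennreal ((y / 2)\<^sup>2 * cmod (f z)) \<le> 3 * (\<integral>\<^sup>+w. ?F w \<partial>lborel)"
    using y by (intro area_mean_bound holomorphic_on_subset[OF hol sub]) auto
  also have "(\<integral>\<^sup>+w. ?F w \<partial>lborel) \<le> ennreal A * ennreal (3 / 2 * y - y / 2)"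
  proof (rule strip_nn_integral_le[OF meas])
    show "(\<integral>\<^sup>+x. ?F (Complex x t) \<partial>lborel) \<le> ennreal A" if "y / 2 \<le> t" for t
    proof -
      have "(\<integral>\<^sup>+x. ?F (Complex x t) \<partial>lborel) \<le> (\<integral>\<^sup>+x. ennreal (cmod (f (Complex x t))) \<partial>lborel)"
        by (intro nn_integral_mono) (auto simp: indicator_def)
      also have "\<dots> \<le> ennreal A" using that y by (intro le) auto
      finally show ?thesis .
    qed
    show "?F (Complex x t) = 0" if "t < y / 2 \<or> 3 / 2 * y < t" for x t
    proof -
      have "Complex x t \<notin> ?sq" using that unfolding mem_csquare complex.sel y_def[symmetric] abs_le_iff by linarith
      then show ?thesis by simp
    qed
  qed (use y in auto)
  finally have "ennreal ((y / 2)\<^sup>2 * cmod (f z)) \<le> 3 * ennreal (A * y)"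
    using A y by (simp add: ennreal_mult mult_left_mono)
  also have "\<dots> = ennreal (3 * (A * y))" using ennreal_mult[of 3 "A * y"] A y by simp
  finally have "(y / 2)\<^sup>2 * cmod (f z) \<le> 3 * (A * y)" using A y by simp
  then show ?thesis using y by (simp add: y_def[symmetric] field_simps power2_eq_square)
qed

context carleson_function
begin

lemma norm_deriv_le: "0 < Im z \<Longrightarrow> cmod (deriv g z) \<le> sqrt (48 * A) / Im z"
  using real_le_rsqrt[OF bloch[of z]] by (simp add: real_sqrt_divide)

lemma vertical_growth:
  assumes "0 < y1" "y1 \<le> y2"
  shows "cmod (g (Complex x y2) - g (Complex x y1)) \<le> sqrt (48 * A) * (ln y2 - ln y1)"
proof (cases "y1 = y2")
  case False
  then have "y1 < y2" using assms by simp
  then have "cmod (g (Complex x y2) - g (Complex x y1)) \<le> sqrt (48 * A) * ln y2 - sqrt (48 * A) * ln y1"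
  proof (rule differentiable_bound_general[where f' = "\<lambda>y. \<i> * deriv g (Complex x y)" and \<phi>' = "\<lambda>y. sqrt (48 * A) / y"])
    show "continuous_on {y1..y2} (\<lambda>y. g (Complex x y))"
      by (rule continuous_on_compose2[OF holomorphic_on_imp_continuous_on[OF hol]]) (use assms in \<open>auto intro!: continuous_intros\<close>)
    show "continuous_on {y1..y2} (\<lambda>y. sqrt (48 * A) * ln y)"
      using assms by (intro continuous_intros) auto
    fix y assume y: "y1 < y" "y < y2"
    then have y0: "0 < y" using assms by simp
    have h: "((\<lambda>t. of_real x + of_real t * \<i>) has_vector_derivative \<i>) (at y)"
      by (auto intro!: derivative_eq_intros)
    have eq: "of_real x + of_real t * \<i> = Complex x t" for t by (simp add: complex_eq_iff)
    have "(g has_field_derivative deriv g (Complex x y)) (at (Complex x y))"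
      using y0 by (intro holomorphic_derivI[OF hol]) auto
    then show "((\<lambda>y. g (Complex x y)) has_vector_derivative \<i> * deriv g (Complex x y)) (at y)"
      using field_vector_diff_chain_at[OF h, of g "deriv g (Complex x y)"] by (simp add: eq o_def)
    show "((\<lambda>y. sqrt (48 * A) * ln y) has_vector_derivative sqrt (48 * A) / y) (at y)"
      using y0 by (auto intro!: derivative_eq_intros simp flip: has_real_derivative_iff_has_vector_derivative)
    show "norm (\<i> * deriv g (Complex x y)) \<le> sqrt (48 * A) / y"
      using norm_deriv_le[of "Complex x y"] y0 by (simp add: norm_mult)
  qed
  then show ?thesis by (simp add: algebra_simps)
qed simp

lemma horizontal_growth:
  assumes "0 < y"
  shows "cmod (g (Complex x y) - g (Complex 0 y)) \<le> sqrt (48 * A) / y * \<bar>x\<bar>"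
proof -
  let ?S = "{z. y \<le> Im z}"
  have "cmod (g (Complex x y) - g (Complex 0 y)) \<le> sqrt (48 * A) / y * cmod (Complex x y - Complex 0 y)"
  proof (rule field_differentiable_bound[of ?S])
    show "convex ?S" by (rule convex_halfspace_Im_ge)
    fix z assume z: "z \<in> ?S"
    then have z0: "0 < Im z" using assms by simp
    then show "(g has_field_derivative deriv g z) (at z within ?S)"
      using has_field_derivative_at_within[OF holomorphic_derivI[OF hol open_upper_half_plane]] by (simp add: upper_half_plane_def)
    have "sqrt (48 * A) / Im z \<le> sqrt (48 * A) / y" using z assms z0 A0 by (intro divide_left_mono) auto
    then show "cmod (deriv g z) \<le> sqrt (48 * A) / y" using norm_deriv_le[OF z0] by linarith
  qed auto
  also have "cmod (Complex x y - Complex 0 y) = \<bar>x\<bar>" by (simp add: cmod_def)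
  finally show ?thesis .
qed

text \<open>
  Move from \<open>\<i>\<close> up to the height \<open>Y = max y |x|\<close>, then sideways, then down: at height \<open>Y \<ge> |x|\<close> the
  derivative is \<open>O(1 / Y)\<close>, so that the sideways step costs \<open>O(1)\<close>, and the vertical steps cost logarithms.
\<close>
lemma log_growth:
  assumes y: "1 \<le> y"
  shows "cmod (g (Complex x y)) \<le> (cmod (g \<i>) + 2 * sqrt (48 * A)) * (1 + log_plus \<bar>x\<bar> + ln y)"
proof -
  define B where "B = sqrt (48 * A)"
  have B: "0 \<le> B" using A0 by (simp add: B_def)
  define Y where "Y = max y \<bar>x\<bar>"
  have Y: "1 \<le> Y" "y \<le> Y" "\<bar>x\<bar> \<le> Y" using y by (auto simp: Y_def)
  have lnY: "ln Y \<le> ln y + log_plus \<bar>x\<bar>"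
  proof (cases "\<bar>x\<bar> \<le> y")
    case True then show ?thesis by (simp add: Y_def max_def)
  next
    case False
    then have "Y = \<bar>x\<bar>" by (simp add: Y_def)
    then show ?thesis using log_plus_ge_ln[of "\<bar>x\<bar>"] y by (simp add: add_increasing)
  qed
  have 1: "cmod (g (Complex 0 Y) - g (Complex 0 1)) \<le> B * ln Y"
    using vertical_growth[of 1 Y 0] Y by (simp add: B_def)
  have 2: "cmod (g (Complex x Y) - g (Complex 0 Y)) \<le> B"
  proof -
    have "B / Y * \<bar>x\<bar> \<le> B / Y * Y" using Y B by (intro mult_left_mono) auto
    then show ?thesis using horizontal_growth[of Y x] Y by (simp add: B_def)
  qed
  have 3: "cmod (g (Complex x Y) - g (Complex x y)) \<le> B * ln Y"
  proof -
    have "B * (ln Y - ln y) \<le> B * ln Y" using B y by (intro mult_left_mono) auto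
    then show ?thesis using vertical_growth[of y Y x] Y y by (simp add: B_def)
  qed
  have "cmod (g (Complex x y)) \<le> cmod (g (Complex 0 1)) + cmod (g (Complex 0 Y) - g (Complex 0 1)) + cmod (g (Complex x Y) - g (Complex 0 Y)) + cmod (g (Complex x Y) - g (Complex x y))"
    using norm_triangle_sub[of "g (Complex x y)" "g (Complex x Y)"] norm_triangle_sub[of "g (Complex x Y)" "g (Complex 0 Y)"]
      norm_triangle_sub[of "g (Complex 0 Y)" "g (Complex 0 1)"] norm_minus_commute[of "g (Complex x y)" "g (Complex x Y)"] by linarith
  also have "Complex 0 1 = \<i>" by (simp add: complex_eq_iff)
  finally have "cmod (g (Complex x y)) \<le> cmod (g \<i>) + B + 2 * B * ln Y" using 1 2 3 by (simp add: \<open>Complex 0 1 = \<i>\<close>)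
  also have "\<dots> \<le> cmod (g \<i>) + B + 2 * B * (ln y + log_plus \<bar>x\<bar>)"
    using lnY B by (intro add_left_mono mult_left_mono) auto
  also have "\<dots> \<le> (cmod (g \<i>) + 2 * B) * (1 + log_plus \<bar>x\<bar> + ln y)"
  proof -
    have "0 \<le> cmod (g \<i>) * (log_plus \<bar>x\<bar> + ln y)" using y by (intro mult_nonneg_nonneg add_nonneg_nonneg) auto
    then show ?thesis using B by (simp add: algebra_simps)
  qed
  finally show ?thesis by (simp add: B_def)
qed

end

text \<open>
  Either \<open>q\<close> is at most \<open>K\<close> times the denominator of \<open>\<theta>(x, p q)\<close>, which gives the first term, or
  \<open>log\<^sub>+ (p q) \<le> 2 q / K - 2 log\<^sub>+ |x|\<close>, which bounds \<open>p q\<close> itself by the second term.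
\<close>
lemma theta_product_le:
  assumes K: "0 < K" and f: "0 \<le> p" and g: "0 \<le> q"
  shows "theta x (p * q) \<le> K * p + 2 * (exp (2 / K * q) / (1 + x\<^sup>2))"
proof -
  define a where "a = 1 + log_plus \<bar>x\<bar> + log_plus (p * q) / 2"
  have a: "0 < a" "1 \<le> a" unfolding a_def by (simp_all add: add_pos_nonneg)
  have pos: "0 < 1 + x\<^sup>2" by (simp add: add_pos_nonneg)
  show ?thesis
  proof (cases "q \<le> K * a")
    case True
    then have "p * q \<le> p * (K * a)" using f by (intro mult_left_mono)
    then have "theta x (p * q) \<le> K * p" using a by (simp add: theta_def a_def[symmetric] divide_le_eq mult_ac)
    moreover have "0 \<le> 2 * (exp (2 / K * q) / (1 + x\<^sup>2))" using pos by simp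
    ultimately show ?thesis by linarith
  next
    case False
    then have "a \<le> q / K" using K by (simp add: field_simps)
    then have "log_plus (p * q) \<le> 2 / K * q - 2 * log_plus \<bar>x\<bar>"
      using log_plus_nonneg[of "\<bar>x\<bar>"] unfolding a_def by (simp add: field_simps)
    then have "exp (log_plus (p * q)) \<le> exp (2 / K * q) * exp (- 2 * log_plus \<bar>x\<bar>)"
      by (simp flip: exp_add)
    also have "exp (- 2 * log_plus \<bar>x\<bar>) \<le> 2 / (1 + x\<^sup>2)"
    proof (cases "1 \<le> \<bar>x\<bar>")
      case True
      then have "log_plus \<bar>x\<bar> = ln \<bar>x\<bar>" by (simp add: log_plus_def)
      then have "exp (- 2 * log_plus \<bar>x\<bar>) = 1 / x\<^sup>2"
        using True by (simp add: exp_minus exp_double inverse_eq_divide)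
      moreover have "1 \<le> x\<^sup>2" using True by (simp add: abs_le_square_iff[of 1 x, simplified, symmetric])
      moreover have "1 / x\<^sup>2 \<le> 2 / (1 + x\<^sup>2)" if "1 \<le> x\<^sup>2"
        using that pos by (simp add: divide_simps)
      ultimately show ?thesis by (simp only:)
    next
      case False
      then have "x\<^sup>2 \<le> 1" using abs_le_square_iff[of x 1] by simp
      then have "1 \<le> 2 / (1 + x\<^sup>2)" using pos by (simp add: divide_simps)
      moreover have "exp (- 2 * log_plus \<bar>x\<bar>) \<le> 1" by simp
      ultimately show ?thesis by linarith
    qed
    finally have "exp (log_plus (p * q)) \<le> exp (2 / K * q) * (2 / (1 + x\<^sup>2))" by simp
    then have "theta x (p * q) \<le> 2 * (exp (2 / K * q) / (1 + x\<^sup>2))"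
    proof -
      have "0 \<le> p * q" using f g by simp
      then have "theta x (p * q) \<le> exp (2 / K * q) * (2 / (1 + x\<^sup>2))"
        using theta_le[of "p * q" x] le_exp_log_plus[of "p * q"] \<open>exp (log_plus (p * q)) \<le> exp (2 / K * q) * (2 / (1 + x\<^sup>2))\<close>
        by linarith
      then show ?thesis by (simp add: mult.commute)
    qed
    then show ?thesis using K f by (simp add: add_increasing)
  qed
qed

text \<open>
  For \<open>|x| \<ge> \<surd>y\<close> the term \<open>ln y\<close> is dominated by \<open>2 log\<^sub>+ |x|\<close>, which is part of the denominator.  On the
  remaining interval of length \<open>2 \<surd>y\<close> the bound \<open>p \<le> A / y\<close> leaves \<open>O(1 / \<surd>y)\<close>, which has a bounded integral.
\<close>
lemma theta_product_le_high:
  assumes y: "1 \<le> y" and p: "0 \<le> p" "p \<le> A / y" and q: "0 \<le> q" "q \<le> C * (1 + log_plus \<bar>x\<bar> + ln y)" and C: "0 \<le> C" and A: "0 \<le> A"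
  shows "theta x (p * q) \<le> 3 * C * p + 3 * A * C / sqrt y * indicator {- sqrt y..sqrt y} x"
proof (cases "sqrt y \<le> \<bar>x\<bar>")
  case True
  define a where "a = 1 + log_plus \<bar>x\<bar> + log_plus (p * q) / 2"
  have a: "0 < a" unfolding a_def by (simp add: add_pos_nonneg)
  have "0 < sqrt y" using y by simp
  then have "ln (sqrt y) \<le> ln \<bar>x\<bar>" using True by (subst ln_le_cancel_iff) auto
  then have "ln y \<le> 2 * log_plus \<bar>x\<bar>" using y log_plus_ge_ln[of "\<bar>x\<bar>"] by (simp add: ln_sqrt)
  then have "1 + log_plus \<bar>x\<bar> + ln y \<le> 3 * a" using log_plus_nonneg[of "p * q"] log_plus_nonneg[of "\<bar>x\<bar>"] unfolding a_def by argo
  then have "C * (1 + log_plus \<bar>x\<bar> + ln y) \<le> C * (3 * a)" using C by (intro mult_left_mono)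
  then have "q \<le> 3 * C * a" using q by simp
  then have "p * q \<le> p * (3 * C * a)" using p by (intro mult_left_mono) auto
  then have "theta x (p * q) \<le> 3 * C * p" using a by (simp add: theta_def a_def[symmetric] divide_le_eq mult_ac)
  moreover have "0 \<le> 3 * A * C / sqrt y * indicator {- sqrt y..sqrt y} x" using A C y by simp
  ultimately show ?thesis by linarith
next
  case False
  have s: "0 < sqrt y" "1 \<le> sqrt y" using y by auto
  have "log_plus \<bar>x\<bar> \<le> ln (sqrt y)"
    using False s by (cases "x = 0") (auto simp: log_plus_def)
  then have "1 + log_plus \<bar>x\<bar> + ln y \<le> 1 + 3 * ln (sqrt y)" using y by (simp add: ln_sqrt)
  also have "\<dots> \<le> 3 * sqrt y" using ln_le_minus_one[of "sqrt y"] s by linarith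
  finally have "C * (1 + log_plus \<bar>x\<bar> + ln y) \<le> C * (3 * sqrt y)" using C by (intro mult_left_mono)
  then have "q \<le> C * (3 * sqrt y)" using q by simp
  then have "p * q \<le> A / y * (C * (3 * sqrt y))" using p q A y by (intro mult_mono) auto
  also have "\<dots> = 3 * A * C / sqrt y" using y by (simp add: field_simps)
  finally have "theta x (p * q) \<le> 3 * A * C / sqrt y" using theta_le[of "p * q" x] p q by simp
  moreover have "x \<in> {- sqrt y..sqrt y}" using False by auto
  ultimately show ?thesis using p C by (simp add: add_increasing)
qed

theorem hardy1_times_bmoa:
  assumes f: "f \<in> hardy1" and g: "g \<in> bmoa"
  shows "(\<lambda>z. f z * g z) \<in> hardy_log"
proof -
  have holf: "f holomorphic_on upper_half_plane" using f by (simp add: hardy1_def)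
  from g obtain A where g': "g holomorphic_on upper_half_plane" "0 \<le> A"
    "\<And>a b. a < b \<Longrightarrow> (\<integral>\<^sup>+z. ennreal ((cmod (deriv g z))\<^sup>2 * Im z) * indicator (carleson_box a b) z \<partial>lborel) \<le> ennreal (A * (b - a))"
    unfolding bmoa_iff by blast
  interpret carleson_function g A by unfold_locales (use g' in auto)
  obtain F where F: "hardy1_norm f = ennreal F" "0 \<le> F"
    using f by (cases "hardy1_norm f" rule: ennreal_cases) (auto simp: hardy1_def)
  have Fle: "(\<integral>\<^sup>+x. ennreal (cmod (f (Complex x y))) \<partial>lborel) \<le> ennreal F" if "0 < y" for y
    unfolding F(1)[symmetric] hardy1_norm_def using that by (intro SUP_upper) auto
  obtain c C where c: "0 < c" "0 \<le> C" and JN: "\<And>\<eta>. 0 < \<eta> \<Longrightarrow> \<eta> \<le> 1 \<Longrightarrow>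
      (\<integral>\<^sup>+t. ennreal (exp (c * cmod (g (Complex t \<eta>))) / (1 + t\<^sup>2)) \<partial>lborel) \<le> ennreal C"
    by (rule john_nirenberg) blast
  define G where "G = cmod (g \<i>) + 2 * sqrt (48 * A)"
  have G: "0 \<le> G" using A0 by (simp add: G_def)
  define M where "M = max 1 (max (2 / c * F + 2 * C) (3 * G * F + 72 * F * G))"
  have holfg: "(\<lambda>z. f z * g z) holomorphic_on upper_half_plane" by (intro holomorphic_intros holf hol)
  have bound: "(\<integral>\<^sup>+x. ennreal (theta x (cmod (f (Complex x y) * g (Complex x y)))) \<partial>lborel) \<le> ennreal M" if y: "0 < y" for y
  proof -
    let ?f = "\<lambda>x. cmod (f (Complex x y))" and ?g = "\<lambda>x. cmod (g (Complex x y))"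
    have [measurable]: "(\<lambda>x. f (Complex x y)) \<in> borel_measurable borel" "(\<lambda>x. g (Complex x y)) \<in> borel_measurable borel"
      using measurable_on_line[OF holf y] measurable_on_line[OF hol y] .
    show ?thesis
    proof (cases "y \<le> 1")
      case True
      have "(\<integral>\<^sup>+x. ennreal (theta x (cmod (f (Complex x y) * g (Complex x y)))) \<partial>lborel)
        \<le> (\<integral>\<^sup>+x. ennreal (2 / c) * ennreal (?f x) + ennreal 2 * ennreal (exp (c * ?g x) / (1 + x\<^sup>2)) \<partial>lborel)"
      proof (rule nn_integral_mono)
        fix x :: real
        have pos: "0 < 1 + x\<^sup>2" by (simp add: add_pos_nonneg)
        have "theta x (cmod (f (Complex x y) * g (Complex x y))) \<le> 2 / c * ?f x + 2 * (exp (c * ?g x) / (1 + x\<^sup>2))"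
          using theta_product_le[of "2 / c" "?f x" "?g x" x] c by (simp add: norm_mult)
        then have "ennreal (theta x (cmod (f (Complex x y) * g (Complex x y)))) \<le> ennreal (2 / c * ?f x + 2 * (exp (c * ?g x) / (1 + x\<^sup>2)))"
          by (rule ennreal_leI)
        also have "\<dots> = ennreal (2 / c) * ennreal (?f x) + ennreal 2 * ennreal (exp (c * ?g x) / (1 + x\<^sup>2))"
          using c pos by (subst ennreal_plus) (auto simp del: ennreal_numeral simp flip: ennreal_mult)
        finally show "ennreal (theta x (cmod (f (Complex x y) * g (Complex x y)))) \<le> \<dots>" .
      qed
      also have "\<dots> = ennreal (2 / c) * (\<integral>\<^sup>+x. ennreal (?f x) \<partial>lborel) + ennreal 2 * (\<integral>\<^sup>+x. ennreal (exp (c * ?g x) / (1 + x\<^sup>2)) \<partial>lborel)"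
        by (subst nn_integral_add) (auto simp: nn_integral_cmult)
      also have "\<dots> \<le> ennreal (2 / c) * ennreal F + ennreal 2 * ennreal C"
        by (intro add_mono mult_left_mono Fle JN y True) auto
      also have "\<dots> = ennreal (2 / c * F + 2 * C)"
        using c F by (subst ennreal_plus) (auto simp del: ennreal_numeral simp flip: ennreal_mult)
      also have "\<dots> \<le> ennreal M" by (intro ennreal_leI) (simp add: M_def)
      finally show ?thesis .
    next
      case False
      then have y1: "1 \<le> y" by simp
      have s: "0 < sqrt y" using y by simp
      have "(\<integral>\<^sup>+x. ennreal (theta x (cmod (f (Complex x y) * g (Complex x y)))) \<partial>lborel)
        \<le> (\<integral>\<^sup>+x. ennreal (3 * G) * ennreal (?f x) + ennreal (36 * F * G / sqrt y) * indicator {- sqrt y..sqrt y} x \<partial>lborel)"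
      proof (rule nn_integral_mono)
        fix x
        have "theta x (cmod (f (Complex x y) * g (Complex x y))) \<le> 3 * G * ?f x + 3 * (12 * F) * G / sqrt y * indicator {- sqrt y..sqrt y} x"
          unfolding norm_mult
          by (rule theta_product_le_high[OF y1]) (use hardy1_pointwise[OF holf F(2) Fle, of "Complex x y"] log_growth[OF y1, of x] y G F in \<open>auto simp: G_def\<close>)
        then have "ennreal (theta x (cmod (f (Complex x y) * g (Complex x y)))) \<le> ennreal (3 * G * ?f x + 36 * F * G / sqrt y * indicator {- sqrt y..sqrt y} x)"
          by (intro ennreal_leI) simp
        also have "\<dots> = ennreal (3 * G) * ennreal (?f x) + ennreal (36 * F * G / sqrt y) * indicator {- sqrt y..sqrt y} x"
          using G F s by (subst ennreal_plus) (auto simp: indicator_def ennreal_mult)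
        finally show "ennreal (theta x (cmod (f (Complex x y) * g (Complex x y)))) \<le> \<dots>" .
      qed
      also have "\<dots> = ennreal (3 * G) * (\<integral>\<^sup>+x. ennreal (?f x) \<partial>lborel) + ennreal (36 * F * G / sqrt y) * ennreal (2 * sqrt y)"
        using s by (subst nn_integral_add) (auto simp: nn_integral_cmult nn_integral_cmult_indicator)
      also have "\<dots> \<le> ennreal (3 * G) * ennreal F + ennreal (36 * F * G / sqrt y) * ennreal (2 * sqrt y)"
        by (intro add_mono mult_left_mono Fle y) auto
      also have "\<dots> = ennreal (3 * G * F + 72 * F * G)"
        using G F s by (subst ennreal_plus) (auto simp flip: ennreal_mult)
      also have "\<dots> \<le> ennreal M" by (intro ennreal_leI) (simp add: M_def)
      finally show ?thesis .
    qed
  qed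
  have "hardy_log_norm (\<lambda>z. f z * g z) \<le> ennreal (M\<^sup>2)"
    unfolding hardy_log_norm_def
    by (intro SUP_least Llog_norm_le measurable_on_line[OF holfg] bound) (auto simp: M_def)
  also have "\<dots> < \<infinity>" by simp
  finally show ?thesis using holfg by (simp add: hardy_log_def)
qed

section \<open>Majorants by squares of functions with positive real part\<close>

text \<open>
  For \<open>t \<ge> 1\<close> the denominator of \<open>\<theta>(x, t)\<close> is at most \<open>(1 + log\<^sub>+ |x|) \<surd>t\<close>, because
  \<open>ln (\<surd>t) \<le> \<surd>t - 1\<close>.
\<close>
lemma sqrt_le_theta:
  assumes "0 \<le> t" shows "t \<le> theta x t * (1 + log_plus \<bar>x\<bar>) * (1 + sqrt t)"
    and "sqrt t \<le> 1 + (1 + log_plus \<bar>x\<bar>) * theta x t"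
proof -
  define L where "L = log_plus \<bar>x\<bar>"
  have L: "0 \<le> L" by (simp add: L_def)
  have eq: "t = theta x t * (1 + L + log_plus t / 2)"
    using theta_denominator_pos[of x t] by (simp add: theta_def L_def)
  have "(1 + L) * (1 + log_plus t / 2) = 1 + L + log_plus t / 2 + L * (log_plus t / 2)" by (simp add: algebra_simps)
  moreover have "0 \<le> L * (log_plus t / 2)" using L by simp
  ultimately have "1 + L + log_plus t / 2 \<le> (1 + L) * (1 + log_plus t / 2)" by linarith
  then have le: "theta x t * (1 + L + log_plus t / 2) \<le> theta x t * ((1 + L) * (1 + log_plus t / 2))"
    using theta_nonneg[OF assms] by (intro mult_left_mono) auto
  have big: "1 + log_plus t / 2 \<le> sqrt t" if "1 \<le> t"
  proof -
    have "ln (sqrt t) \<le> sqrt t - 1" using that by (intro ln_le_minus_one) auto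
    moreover have "log_plus t = 2 * ln (sqrt t)" using that by (simp add: log_plus_def ln_sqrt)
    ultimately show ?thesis by simp
  qed
  have small: "log_plus t = 0" if "t < 1" using that assms by (cases "t = 0") (auto simp: log_plus_def)
  have "1 + log_plus t / 2 \<le> 1 + sqrt t" using big small assms by (cases "1 \<le> t") auto
  then have "theta x t * ((1 + L) * (1 + log_plus t / 2)) \<le> theta x t * ((1 + L) * (1 + sqrt t))"
    using theta_nonneg[OF assms] L by (intro mult_left_mono) auto
  then show "t \<le> theta x t * (1 + log_plus \<bar>x\<bar>) * (1 + sqrt t)"
    using le eq by (simp add: L_def mult.assoc)
  have "0 \<le> (1 + L) * theta x t" using theta_nonneg[OF assms] L by simp
  show "sqrt t \<le> 1 + (1 + log_plus \<bar>x\<bar>) * theta x t"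
  proof (cases "1 \<le> t")
    case True
    have "theta x t * ((1 + L) * (1 + log_plus t / 2)) \<le> theta x t * ((1 + L) * sqrt t)"
      using theta_nonneg[OF assms] L big[OF True] by (intro mult_left_mono) auto
    then have "sqrt t * sqrt t \<le> ((1 + L) * theta x t) * sqrt t" using le eq assms by (simp add: mult_ac)
    then have "sqrt t \<le> (1 + L) * theta x t" using True by (subst (asm) mult_le_cancel_right) auto
    then show ?thesis by (simp add: L_def)
  next
    case False
    then have "sqrt t \<le> 1" by simp
    then show ?thesis using \<open>0 \<le> (1 + L) * theta x t\<close> unfolding L_def by linarith
  qed
qed

lemma log_plus_mono: "0 \<le> s \<Longrightarrow> s \<le> t \<Longrightarrow> log_plus s \<le> log_plus t"
  by (cases "s = 0") (auto simp: log_plus_def intro: max.coboundedI1 max.mono)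

lemma log_plus_le_self: "0 \<le> s \<Longrightarrow> log_plus s \<le> s"
  using ln_le_minus_one[of s] by (cases "s = 0") (auto simp: log_plus_def)

text \<open>
  A growth bound, needed to apply the maximum modulus principle in an unbounded region.  Locally in \<open>x\<close>, the
  integral of \<open>\<theta>(x, |h|)\<close> controls that of \<open>|h| / (1 + \<surd>|h|)\<close>, so an a priori bound for \<open>h\<close> must enter.
  The area mean estimate is applied at a point \<open>z1\<close> where \<open>|h(z)| (R - |z - z0|)\<^sup>4\<close> is maximal, with value \<open>N\<close>: near \<open>z1\<close> the function
  is at most \<open>16 N / d\<^sup>4\<close>, and the resulting inequality \<open>N \<le> C \<surd>N\<close> bounds \<open>N\<close>.
\<close>
lemma theta_growth:
  assumes hol: "h holomorphic_on upper_half_plane"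
    and T: "\<And>y. 0 < y \<Longrightarrow> (\<integral>\<^sup>+x. ennreal (theta x (cmod (h (Complex x y)))) \<partial>lborel) \<le> 1"
    and R: "0 < R" "R \<le> 1" "R < Im z0"
  shows "cmod (h z0) \<le> 14400 * (2 + cmod z0)\<^sup>2 / R ^ 4"
proof -
  define \<Lambda> where "\<Lambda> = 1 + log_plus (\<bar>Re z0\<bar> + R)"
  have \<Lambda>: "1 \<le> \<Lambda>" "\<Lambda> \<le> 2 + cmod z0"
    using log_plus_le_self[of "\<bar>Re z0\<bar> + R"] abs_Re_le_cmod[of z0] R by (auto simp: \<Lambda>_def)
  have B: "cball z0 R \<subseteq> upper_half_plane"
  proof
    fix w assume "w \<in> cball z0 R"
    then have "\<bar>Im (z0 - w)\<bar> \<le> R" using abs_Im_le_cmod[of "z0 - w"] by (simp add: dist_norm)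
    then show "w \<in> upper_half_plane" using R by (auto simp: upper_half_plane_def)
  qed
  let ?G = "\<lambda>z. cmod (h z) * (R - cmod (z - z0)) ^ 4"
  have "continuous_on (cball z0 R) ?G"
    by (intro continuous_intros holomorphic_on_imp_continuous_on holomorphic_on_subset[OF hol B])
  moreover have "cball z0 R \<noteq> {}" using R by simp
  ultimately obtain z1 where z1: "z1 \<in> cball z0 R" "\<And>z. z \<in> cball z0 R \<Longrightarrow> ?G z \<le> ?G z1"
    using continuous_attains_sup[OF compact_cball] by blast
  define N where "N = ?G z1"
  define d where "d = R - cmod (z1 - z0)"
  have d: "0 \<le> d" "d \<le> R" using z1(1) by (auto simp: d_def dist_norm norm_minus_commute)
  have N0: "0 \<le> N" using d by (simp add: N_def)
  have hz0: "cmod (h z0) * R ^ 4 \<le> N" using z1(2)[of z0] R by (simp add: N_def)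
  have Nle: "N \<le> 14400 * \<Lambda>\<^sup>2"
  proof (cases "d = 0 \<or> N \<le> 1")
    case True
    have "1 \<le> \<Lambda>\<^sup>2" using \<Lambda> by (simp add: one_le_power)
    moreover have "N \<le> 1" using True by (auto simp: N_def d_def[symmetric])
    ultimately show ?thesis by linarith
  next
    case False
    then have d0: "0 < d" and N1: "1 < N" using d by auto
    let ?sq = "csquare z1 (d / 4)"
    have near: "w \<in> cball z0 R \<and> d / 2 \<le> R - cmod (w - z0)" if w: "w \<in> ?sq" for w
    proof -
      have "cmod (w - z1) \<le> d / 2"
        using cmod_le[of "w - z1"] w unfolding mem_csquare by simp
      then have "cmod (w - z0) \<le> d / 2 + cmod (z1 - z0)"
        using norm_triangle_ineq[of "w - z1" "z1 - z0"] by simp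
      moreover have "cmod (z1 - z0) = R - d" by (simp add: d_def)
      ultimately have "cmod (w - z0) \<le> R" "d / 2 \<le> R - cmod (w - z0)" using d0 by linarith+
      then show ?thesis by (simp add: dist_norm norm_minus_commute)
    qed
    have sub: "?sq \<subseteq> upper_half_plane" using near B by blast
    have hle: "cmod (h w) \<le> theta (Re w) (cmod (h w)) * (\<Lambda> * (1 + 4 * sqrt N / d\<^sup>2))" if w: "w \<in> ?sq" for w
    proof -
      have w': "w \<in> cball z0 R" "d / 2 \<le> R - cmod (w - z0)" using near[OF w] by auto
      have "cmod (h w) * (d / 2) ^ 4 \<le> ?G w" using w' d0 by (intro mult_left_mono power_mono) auto
      then have "cmod (h w) * (d / 2) ^ 4 \<le> N" using z1(2)[OF w'(1)] by (simp add: N_def)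
      then have "cmod (h w) \<le> 16 * N / d ^ 4" using d0 by (simp add: field_simps power_divide)
      then have "sqrt (cmod (h w)) \<le> sqrt (16 * N / d ^ 4)" by simp
      also have "sqrt (16 * N / d ^ 4) = 4 * sqrt N / d\<^sup>2"
      proof -
        have "16 * N / d ^ 4 = (4 * sqrt N / d\<^sup>2)\<^sup>2" using N0 by (simp add: power_divide power_mult_distrib flip: power_mult)
        then show ?thesis using N0 by (simp add: real_sqrt_unique)
      qed
      finally have 1: "1 + sqrt (cmod (h w)) \<le> 1 + 4 * sqrt N / d\<^sup>2" by simp
      have "\<bar>Re w\<bar> \<le> \<bar>Re z0\<bar> + R"
        using w'(1) abs_Re_le_cmod[of "z0 - w"] by (simp add: dist_norm)
      then have 2: "1 + log_plus \<bar>Re w\<bar> \<le> \<Lambda>" by (simp add: \<Lambda>_def log_plus_mono)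
      have "cmod (h w) \<le> theta (Re w) (cmod (h w)) * (1 + log_plus \<bar>Re w\<bar>) * (1 + sqrt (cmod (h w)))"
        by (rule sqrt_le_theta) simp
      also have "\<dots> \<le> theta (Re w) (cmod (h w)) * \<Lambda> * (1 + 4 * sqrt N / d\<^sup>2)"
        using 1 2 \<Lambda> theta_nonneg[of "cmod (h w)" "Re w"] by (intro mult_mono mult_nonneg_nonneg) auto
      finally show ?thesis by (simp add: mult.assoc)
    qed
    define Q where "Q = \<Lambda> * (1 + 4 * sqrt N / d\<^sup>2)"
    have Q0: "0 \<le> Q" using \<Lambda> N0 by (simp add: Q_def)
    have mh: "(\<lambda>z. indicator ?sq z *\<^sub>R h z) \<in> borel_measurable borel"
      by (intro borel_measurable_continuous_on_indicator holomorphic_on_imp_continuous_on holomorphic_on_subset[OF hol sub]) auto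
    let ?F = "\<lambda>w. ennreal (theta (Re w) (cmod (indicator ?sq w *\<^sub>R h w)))"
    have mF: "?F \<in> borel_measurable borel"
      using mh by measurable
    have Feq: "?F w = ennreal (theta (Re w) (cmod (h w))) * indicator ?sq w" for w
      by (auto simp: indicator_def theta_def)
    have "ennreal ((d / 4)\<^sup>2 * cmod (h z1)) \<le> 3 * (\<integral>\<^sup>+w. ennreal (cmod (h w)) * indicator ?sq w \<partial>lborel)"
      using d0 by (intro area_mean_bound holomorphic_on_subset[OF hol sub]) auto
    also have "(\<integral>\<^sup>+w. ennreal (cmod (h w)) * indicator ?sq w \<partial>lborel) \<le> (\<integral>\<^sup>+w. ennreal Q * ?F w \<partial>lborel)"
    proof (rule nn_integral_mono)
      fix w
      show "ennreal (cmod (h w)) * indicator ?sq w \<le> ennreal Q * ?F w"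
      proof (cases "w \<in> ?sq")
        case True
        have "cmod (h w) \<le> Q * theta (Re w) (cmod (h w))"
          using hle[OF True] unfolding Q_def[symmetric] by (subst mult.commute)
        then show ?thesis using True Q0 theta_nonneg[of "cmod (h w)" "Re w"]
          unfolding Feq by (simp add: ennreal_leI flip: ennreal_mult)
      qed simp
    qed
    also have "\<dots> = ennreal Q * (\<integral>\<^sup>+w. ?F w \<partial>lborel)" using mF by (intro nn_integral_cmult) simp
    also have "(\<integral>\<^sup>+w. ?F w \<partial>lborel) \<le> 1 * ennreal ((Im z1 + d / 4) - (Im z1 - d / 4))"
    proof (rule strip_nn_integral_le[OF mF])
      fix y assume y: "Im z1 - d / 4 \<le> y" "y \<le> Im z1 + d / 4"
      have "\<bar>y - Im z1\<bar> \<le> d / 4" using y unfolding abs_le_iff by linarith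
      then have "Complex (Re z1) y \<in> ?sq" using d0 unfolding mem_csquare by simp
      then have y0: "0 < y" using sub by auto
      have "(\<integral>\<^sup>+x. ?F (Complex x y) \<partial>lborel) \<le> (\<integral>\<^sup>+x. ennreal (theta x (cmod (h (Complex x y)))) \<partial>lborel)"
        unfolding Feq by (intro nn_integral_mono) (auto simp: indicator_def)
      also have "\<dots> \<le> 1" by (rule T[OF y0])
      finally show "(\<integral>\<^sup>+x. ?F (Complex x y) \<partial>lborel) \<le> 1" .
    next
      fix x y assume y: "y < Im z1 - d / 4 \<or> Im z1 + d / 4 < y"
      have "Complex x y \<notin> ?sq" using y unfolding mem_csquare complex.sel abs_le_iff by linarith
      then show "?F (Complex x y) = 0" unfolding Feq by simp
    qed (use d0 in auto)
    finally have "ennreal ((d / 4)\<^sup>2 * cmod (h z1)) \<le> 3 * (ennreal Q * ennreal (d / 2))"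
      by (simp add: mult_left_mono)
    also have "\<dots> = ennreal (3 * (Q * (d / 2)))"
      using ennreal_mult[of 3 "Q * (d / 2)"] ennreal_mult[of Q "d / 2"] Q0 d0 by simp
    finally have a: "(d / 4)\<^sup>2 * cmod (h z1) \<le> 3 * (Q * (d / 2))" using Q0 d0 by simp
    have "N = cmod (h z1) * d ^ 4" by (simp add: N_def d_def)
    also have "\<dots> = 16 * d\<^sup>2 * ((d / 4)\<^sup>2 * cmod (h z1))" by (simp add: power2_eq_square power4_eq_xxxx)
    also have "\<dots> \<le> 16 * d\<^sup>2 * (3 * (Q * (d / 2)))" using a by (intro mult_left_mono) auto
    also have "\<dots> = 24 * \<Lambda> * (d ^ 3 + 4 * d * sqrt N)"
      using d0 by (simp add: Q_def field_simps power2_eq_square power3_eq_cube)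
    also have "\<dots> \<le> 24 * \<Lambda> * (sqrt N + 4 * sqrt N)"
    proof -
      have "d ^ 3 \<le> 1" using d d0 R by (intro power_le_one) auto
      moreover have "1 \<le> sqrt N" using N1 by simp
      moreover have "d * sqrt N \<le> 1 * sqrt N" using d R N0 by (intro mult_right_mono) auto
      ultimately have "d ^ 3 + 4 * d * sqrt N \<le> sqrt N + 4 * sqrt N" by linarith
      then show ?thesis using \<Lambda> by (intro mult_left_mono) auto
    qed
    finally have "sqrt N * sqrt N \<le> 120 * \<Lambda> * sqrt N" using N0 by simp
    then have "sqrt N \<le> 120 * \<Lambda>" using N1 by (subst (asm) mult_le_cancel_right) auto
    then have "(sqrt N)\<^sup>2 \<le> (120 * \<Lambda>)\<^sup>2" using N0 by (intro power_mono) auto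
    then show ?thesis using N0 by (simp add: power_mult_distrib)
  qed
  also have "14400 * \<Lambda>\<^sup>2 \<le> 14400 * (2 + cmod z0)\<^sup>2" using \<Lambda> by (intro mult_left_mono power_mono) auto
  finally show ?thesis using hz0 R by (simp add: pos_le_divide_eq)
qed

text \<open>
  One step of the construction, for a function that is continuous up to the real line and small at infinity.
  With \<open>S\<close> the Schwarz integral of \<open>\<surd>|k|\<close> on the line, cut off outside \<open>[-N, N]\<close>, put \<open>F = 2 \<eta> + S\<close>.  Then
  \<open>\<surd>|k| \<le> Re F\<close> slightly above \<open>[-N, N]\<close> by the boundary behaviour of \<open>Re S\<close>, and wherever \<open>|z| \<ge> N\<close> by the
  assumed decay; so \<open>|k / F\<^sup>2| \<le> 1\<close> on the frontier of a rectangle.  Comparing \<open>k\<close> with \<open>F\<^sup>2\<close> replaces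
  the subharmonicity of \<open>\<surd>|k|\<close>.
\<close>
lemma schwarz_majorant:
  assumes contk: "continuous_on {z. 0 \<le> Im z} k" and holk: "k holomorphic_on upper_half_plane"
    and \<eta>: "0 < \<eta>" and N: "0 < N"
    and decay: "\<And>z. 0 \<le> Im z \<Longrightarrow> N \<le> cmod z \<Longrightarrow> cmod (k z) \<le> \<eta>\<^sup>2"
    and P: "(\<integral>\<^sup>+t. ennreal (sqrt (cmod (k (of_real t))) / (1 + t\<^sup>2)) \<partial>lborel) \<le> ennreal (pi * P)" "0 \<le> P"
  obtains F where "F holomorphic_on upper_half_plane"
    "\<And>z. z \<in> upper_half_plane \<Longrightarrow> 0 \<le> Re (F z)"
    "\<And>z. z \<in> upper_half_plane \<Longrightarrow> cmod (k z) \<le> (cmod (F z))\<^sup>2"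
    "\<And>z. z \<in> upper_half_plane \<Longrightarrow> cmod (F z) \<le> 2 * \<eta> + (cmod z + cmod (1 + z\<^sup>2) / Im z) * P"
proof -
  define \<psi> where "\<psi> = (\<lambda>z. sqrt (cmod (k z)))"
  have c\<psi>: "continuous_on S (\<lambda>z. \<psi> (f z))" if "continuous_on S f" "\<And>z. z \<in> S \<Longrightarrow> 0 \<le> Im (f z)" for S and f :: "'a::topological_space \<Rightarrow> complex"
  proof -
    have "continuous_on S (\<lambda>z. k (f z))" by (rule continuous_on_compose2[OF contk that(1)]) (use that in auto)
    then show ?thesis unfolding \<psi>_def by (intro continuous_intros)
  qed
  have \<psi>0: "0 \<le> \<psi> z" for z by (simp add: \<psi>_def)
  define \<phi> where "\<phi> = (\<lambda>t. \<psi> (of_real t) * max 0 (min 1 (N + 1 - \<bar>t\<bar>)))"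
  have c\<phi>: "continuous_on S \<phi>" for S unfolding \<phi>_def by (intro continuous_intros c\<psi>) auto
  have \<phi>0: "0 \<le> \<phi> t" for t using \<psi>0 by (simp add: \<phi>_def)
  have \<phi>le: "\<phi> t \<le> \<psi> (of_real t)" for t using \<psi>0[of "of_real t"] by (auto simp: \<phi>_def intro: mult_left_le)
  have \<phi>eq: "\<phi> t = \<psi> (of_real t)" if "\<bar>t\<bar> \<le> N" for t using that by (simp add: \<phi>_def)
  have supp: "\<phi> t = 0" if "N + 1 \<le> \<bar>t\<bar>" for t using that by (simp add: \<phi>_def)
  have N1: "0 < N + 1" using N by simp
  have "{-(N+1)..N+1} \<noteq> {}" using N by simp
  from continuous_attains_sup[OF compact_Icc this c\<phi>]
  obtain m where m: "\<And>t. t \<in> {-(N+1)..N+1} \<Longrightarrow> \<phi> t \<le> \<phi> m" by blast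
  have \<phi>M: "\<phi> t \<le> \<phi> m" for t
  proof (cases "N + 1 \<le> \<bar>t\<bar>")
    case True
    then show ?thesis using supp[OF True] \<phi>0[of m] by simp
  next
    case False
    then have "t \<in> {-(N+1)..N+1}" by (auto simp: abs_le_iff not_le)
    from m[OF this] show ?thesis .
  qed
  define S where "S = schwarz_integral \<phi> (N + 1)"
  have holS: "S holomorphic_on upper_half_plane" unfolding S_def by (rule schwarz_holomorphic[OF c\<phi>])
  have ReS: "Re (S z) = poisson_integral \<phi> (N + 1) z" if "z \<in> upper_half_plane" for z
    unfolding S_def by (rule Re_schwarz[OF c\<phi> that])
  have ReS0: "0 \<le> Re (S z)" if "z \<in> upper_half_plane" for z
    unfolding ReS[OF that] by (rule poisson_integral_bounds(1)[OF c\<phi> \<phi>0 _ N1]) (use that in \<open>simp add: upper_half_plane_def\<close>)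
  define F where "F = (\<lambda>z. of_real (2 * \<eta>) + S z)"
  have holF: "F holomorphic_on upper_half_plane" unfolding F_def by (intro holomorphic_intros holS)
  have ReF: "2 * \<eta> \<le> Re (F z)" if "z \<in> upper_half_plane" for z using ReS0[OF that] by (simp add: F_def)
  have key: "cmod (k z) \<le> (cmod (F z))\<^sup>2" if "\<psi> z \<le> Re (F z)" for z
  proof -
    have "(\<psi> z)\<^sup>2 \<le> (cmod (F z))\<^sup>2"
      using that complex_Re_le_cmod[of "F z"] \<psi>0[of z] by (intro power_mono) auto
    then show ?thesis by (simp add: \<psi>_def)
  qed
  have far: "\<psi> z \<le> Re (F z)" if "z \<in> upper_half_plane" "N \<le> cmod z" for z
  proof -
    have "cmod (k z) \<le> \<eta>\<^sup>2" using that by (intro decay) (auto simp: upper_half_plane_def)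
    then have "\<psi> z \<le> sqrt (\<eta>\<^sup>2)" unfolding \<psi>_def by (rule real_sqrt_le_mono)
    then have "\<psi> z \<le> \<eta>" using \<eta> by simp
    then show ?thesis using ReF[OF that(1)] \<eta> by linarith
  qed
  have maj: "cmod (k z) \<le> (cmod (F z))\<^sup>2" if z: "z \<in> upper_half_plane" for z
  proof (cases "N \<le> cmod z")
    case True
    then show ?thesis by (intro key far z)
  next
    case False
    obtain d where d: "0 < d" "\<And>x y. 0 < y \<Longrightarrow> y < d \<Longrightarrow> \<bar>poisson_integral \<phi> (N + 1) (Complex x y) - \<phi> x\<bar> < \<eta>"
      using poisson_boundary_uniform[OF c\<phi> \<phi>0 \<phi>M supp N1 \<eta>] by blast
    have "uniformly_continuous_on (cbox (Complex (-N) 0) (Complex N 1)) \<psi>"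
      by (intro compact_uniformly_continuous c\<psi>[of _ "\<lambda>z. z"]) (auto simp: in_cbox_complex_iff)
    then obtain d' where d': "0 < d'" "\<And>p q. p \<in> cbox (Complex (-N) 0) (Complex N 1) \<Longrightarrow> q \<in> cbox (Complex (-N) 0) (Complex N 1) \<Longrightarrow> dist p q < d'
      \<Longrightarrow> dist (\<psi> p) (\<psi> q) < \<eta>"
      unfolding uniformly_continuous_on_def using \<eta> by blast
    have Imz: "0 < Im z" using z by (simp add: upper_half_plane_def)
    define s where "s = min (min d d') (min 1 (Im z)) / 2"
    have s: "0 < s" "s < d" "s < d'" "s < 1" "s < Im z" using d d' Imz by (auto simp: s_def min_def)
    let ?R = "cbox (Complex (-N) s) (Complex N N)"
    have sub: "?R \<subseteq> upper_half_plane" using s by (auto simp: in_cbox_complex_iff upper_half_plane_def)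
    have zR: "z \<in> ?R"
      using abs_Re_le_cmod[of z] abs_Im_le_cmod[of z] False s Imz by (auto simp: in_cbox_complex_iff)
    have Fnz: "F w \<noteq> 0" if "w \<in> upper_half_plane" for w using ReF[OF that] \<eta> by auto
    have hq: "(\<lambda>w. k w / (F w)\<^sup>2) holomorphic_on upper_half_plane"
      by (intro holomorphic_intros holk holF) (use Fnz in auto)
    have "cmod (k z / (F z)\<^sup>2) \<le> 1"
    proof (rule maximum_modulus_frontier[OF _ _ _ _ zR])
      show "(\<lambda>w. k w / (F w)\<^sup>2) holomorphic_on interior ?R"
        by (rule holomorphic_on_subset[OF hq]) (use sub interior_subset in blast)
      show "continuous_on (closure ?R) (\<lambda>w. k w / (F w)\<^sup>2)"
        using holomorphic_on_imp_continuous_on[OF hq] sub by (auto intro: continuous_on_subset)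
      show "bounded ?R" by (rule bounded_cbox)
      fix w assume w: "w \<in> frontier ?R"
      then have wR: "w \<in> ?R" "w \<notin> box (Complex (-N) s) (Complex N N)"
        by (auto simp: frontier_def)
      have wu: "w \<in> upper_half_plane" using wR sub by auto
      have "\<psi> w \<le> Re (F w)"
      proof (cases "Im w = s")
        case True
        have wx: "\<bar>Re w\<bar> \<le> N" using wR by (auto simp: in_cbox_complex_iff abs_le_iff)
        have weq: "w = Complex (Re w) s" using True by (simp add: complex_eq_iff)
        have "cmod (w - of_real (Re w)) = s"
          using s True by (simp add: cmod_def)
        then have "dist (\<psi> w) (\<psi> (of_real (Re w))) < \<eta>"
          using s wx True by (intro d') (auto simp: in_cbox_complex_iff abs_le_iff dist_norm)
        moreover have "\<bar>Re (S w) - \<phi> (Re w)\<bar> < \<eta>"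
          using d(2)[of s "Re w"] s ReS[OF wu] weq by simp
        ultimately show ?thesis
          using \<phi>eq[OF wx] unfolding dist_real_def F_def by simp
      next
        case False
        then have "N \<le> \<bar>Re w\<bar> \<or> N \<le> \<bar>Im w\<bar>" using wR by (auto simp: in_cbox_complex_iff in_box_complex_iff abs_if)
        then have "N \<le> cmod w" using abs_Re_le_cmod[of w] abs_Im_le_cmod[of w] by linarith
        then show ?thesis by (rule far[OF wu])
      qed
      then have "cmod (k w) \<le> (cmod (F w))\<^sup>2" by (rule key)
      then show "cmod (k w / (F w)\<^sup>2) \<le> 1"
        using Fnz[OF wu] by (simp add: norm_divide norm_power divide_le_eq)
    qed
    then show ?thesis using Fnz[OF z] by (simp add: norm_divide norm_power divide_le_eq)
  qed
  have Pi: "poisson_integral \<phi> (N + 1) \<i> \<le> P"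
  proof -
    have nz: "0 < 1 + t\<^sup>2" for t :: real by (simp add: add_pos_nonneg)
    have i1: "(\<lambda>t. \<phi> t / (1 + t\<^sup>2)) integrable_on {-(N+1)..N+1}"
      by (intro integrable_continuous_interval continuous_intros c\<phi>) (use nz in \<open>auto simp: less_imp_neq[symmetric]\<close>)
    have "ennreal (integral {-(N+1)..N+1} (\<lambda>t. \<phi> t / (1 + t\<^sup>2))) = (\<integral>\<^sup>+t. ennreal (\<phi> t / (1 + t\<^sup>2)) * indicator {-(N+1)..N+1} t \<partial>lborel)"
      using \<phi>0 nz by (intro nn_integral_has_integral_lebesgue'[symmetric] integrable_integral i1) (auto intro: divide_nonneg_pos)
    also have "\<dots> \<le> (\<integral>\<^sup>+t. ennreal (sqrt (cmod (k (of_real t))) / (1 + t\<^sup>2)) \<partial>lborel)"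
    proof (rule nn_integral_mono)
      fix t :: real
      have "\<phi> t / (1 + t\<^sup>2) \<le> sqrt (cmod (k (of_real t))) / (1 + t\<^sup>2)"
        using \<phi>le[of t] nz[of t] by (intro divide_right_mono) (auto simp: \<psi>_def)
      then show "ennreal (\<phi> t / (1 + t\<^sup>2)) * indicator {-(N+1)..N+1} t \<le> ennreal (sqrt (cmod (k (of_real t))) / (1 + t\<^sup>2))"
        by (auto simp: indicator_def intro: ennreal_leI)
    qed
    also have "\<dots> \<le> ennreal (pi * P)" by (rule P(1))
    finally have "integral {-(N+1)..N+1} (\<lambda>t. \<phi> t / (1 + t\<^sup>2)) \<le> pi * P" using P(2) by simp
    then show ?thesis by (simp add: poisson_integral_def divide_le_eq add.commute mult.commute)
  qed
  have Fb: "cmod (F z) \<le> 2 * \<eta> + (cmod z + cmod (1 + z\<^sup>2) / Im z) * P" if z: "z \<in> upper_half_plane" for z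
  proof -
    have "0 < Im z" using z by (simp add: upper_half_plane_def)
    then have "(cmod z + cmod (1 + z\<^sup>2) / Im z) * poisson_integral \<phi> (N + 1) \<i> \<le> (cmod z + cmod (1 + z\<^sup>2) / Im z) * P"
      by (intro mult_left_mono Pi) auto
    moreover have "cmod (S z) \<le> (cmod z + cmod (1 + z\<^sup>2) / Im z) * poisson_integral \<phi> (N + 1) \<i>"
      unfolding S_def by (rule norm_schwarz[OF c\<phi> z \<phi>0])
    moreover have "cmod (F z) \<le> 2 * \<eta> + cmod (S z)"
      using norm_triangle_ineq[of "of_real (2 * \<eta>)" "S z"] \<eta> by (simp add: F_def)
    ultimately show ?thesis by linarith
  qed
  show ?thesis
  proof (rule that[OF holF _ maj Fb])
    show "0 \<le> Re (F z)" if "z \<in> upper_half_plane" for z using ReF[OF that] \<eta> by linarith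
  qed
qed

lemma nn_integral_inverse_1_plus_square: "(\<integral>\<^sup>+t. ennreal (1 / (1 + t\<^sup>2)) \<partial>lborel) \<le> ennreal pi"
proof -
  let ?f = "\<lambda>t::real. 1 / (1 + t\<^sup>2)"
  have half: "(\<integral>\<^sup>+t. ennreal (?f t) * indicator {0..} t \<partial>lborel) = ennreal (pi / 2 - arctan 0)"
    by (rule nn_integral_FTC_atLeast)
      (auto intro!: derivative_eq_intros tendsto_arctan_at_top simp: inverse_eq_divide)
  have "(\<integral>\<^sup>+t. ennreal (?f t) * indicator {..0} t \<partial>lborel) = (\<integral>\<^sup>+t. ennreal (?f t) * indicator {0..} t \<partial>lborel)"
    using nn_integral_real_affine[of "\<lambda>t. ennreal (?f t) * indicator {..0} t" "-1" 0]
    by (simp add: indicator_def cong: if_cong)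
  then have "ennreal (pi / 2) + ennreal (pi / 2) = (\<integral>\<^sup>+t. ennreal (?f t) * indicator {0..} t + ennreal (?f t) * indicator {..0} t \<partial>lborel)"
    using half by (subst nn_integral_add) auto
  moreover have "(\<integral>\<^sup>+t. ennreal (?f t) \<partial>lborel) \<le> (\<integral>\<^sup>+t. ennreal (?f t) * indicator {0..} t + ennreal (?f t) * indicator {..0} t \<partial>lborel)"
    by (intro nn_integral_mono) (auto simp: indicator_def)
  moreover have "ennreal (pi / 2) + ennreal (pi / 2) = ennreal pi" by (simp flip: ennreal_plus)
  ultimately show ?thesis by simp
qed

text \<open>The weight \<open>1 / (1 + x\<^sup>2)\<close> compensates the factor \<open>1 + log\<^sub>+ |x|\<close> in \<open>sqrt_le_theta\<close>.\<close>
lemma sqrt_line_integral: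
  assumes hol: "h holomorphic_on upper_half_plane" and y: "0 < y"
    and T: "(\<integral>\<^sup>+x. ennreal (theta x (cmod (h (Complex x y)))) \<partial>lborel) \<le> 1"
  shows "(\<integral>\<^sup>+x. ennreal (sqrt (cmod (h (Complex x y))) / (1 + x\<^sup>2)) \<partial>lborel) \<le> ennreal (pi * 2)"
proof -
  have [measurable]: "(\<lambda>x. h (Complex x y)) \<in> borel_measurable borel" by (rule measurable_on_line[OF hol y])
  have "(\<integral>\<^sup>+x. ennreal (sqrt (cmod (h (Complex x y))) / (1 + x\<^sup>2)) \<partial>lborel)
      \<le> (\<integral>\<^sup>+x. ennreal (1 / (1 + x\<^sup>2)) + ennreal (theta x (cmod (h (Complex x y)))) \<partial>lborel)"
  proof (rule nn_integral_mono)
    fix x :: real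
    let ?t = "cmod (h (Complex x y))"
    have pos: "0 < 1 + x\<^sup>2" by (simp add: add_pos_nonneg)
    have "log_plus \<bar>x\<bar> \<le> x\<^sup>2"
    proof (cases "\<bar>x\<bar> \<le> 1")
      case True
      then show ?thesis by (cases "x = 0") (auto simp: log_plus_def)
    next
      case False
      then have "\<bar>x\<bar> * 1 \<le> \<bar>x\<bar> * \<bar>x\<bar>" by (intro mult_left_mono) auto
      then show ?thesis using log_plus_le_self[of "\<bar>x\<bar>"] by (simp add: power2_eq_square)
    qed
    then have "(1 + log_plus \<bar>x\<bar>) * theta x ?t \<le> (1 + x\<^sup>2) * theta x ?t"
      using theta_nonneg[of ?t x] by (intro mult_right_mono) auto
    then have "sqrt ?t \<le> 1 + (1 + x\<^sup>2) * theta x ?t" using sqrt_le_theta(2)[of ?t x] by simp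
    then have "sqrt ?t / (1 + x\<^sup>2) \<le> (1 + (1 + x\<^sup>2) * theta x ?t) / (1 + x\<^sup>2)"
      using pos by (intro divide_right_mono) auto
    also have "\<dots> = 1 / (1 + x\<^sup>2) + theta x ?t"
      unfolding add_divide_distrib using less_imp_neq[OF pos] by simp
    finally have "sqrt ?t / (1 + x\<^sup>2) \<le> 1 / (1 + x\<^sup>2) + theta x ?t" .
    then show "ennreal (sqrt ?t / (1 + x\<^sup>2)) \<le> ennreal (1 / (1 + x\<^sup>2)) + ennreal (theta x ?t)"
      using pos theta_nonneg[of ?t x] by (simp add: ennreal_leI less_imp_le flip: ennreal_plus)
  qed
  also have "\<dots> = (\<integral>\<^sup>+x. ennreal (1 / (1 + x\<^sup>2)) \<partial>lborel) + (\<integral>\<^sup>+x. ennreal (theta x (cmod (h (Complex x y)))) \<partial>lborel)"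
    by (rule nn_integral_add) auto
  also have "\<dots> \<le> ennreal pi + ennreal 1"
    using T by (intro add_mono nn_integral_inverse_1_plus_square) simp
  also have "\<dots> \<le> ennreal (pi * 2)"
  proof -
    have "ennreal pi + ennreal 1 = ennreal (pi + 1)" by (rule ennreal_plus[symmetric]) auto
    moreover have "ennreal (pi + 1) \<le> ennreal (pi * 2)" using pi_gt3 by (intro ennreal_leI) auto
    ultimately show ?thesis by (simp only:)
  qed
  finally show ?thesis .
qed

text \<open>
  Apply the preceding construction to \<open>k\<^sub>n(z) = h(z + i e) / (1 - i e z)\<^sup>3\<close> with \<open>e = 1 / (n + 1)\<close>.  The
  shift makes \<open>k\<^sub>n\<close> continuous up to the real line, and the damping factor, which has modulus at least \<open>1\<close> and
  at least \<open>(e |z|)\<^sup>3\<close>, beats the quadratic growth of \<open>h\<close>.  The majorants are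
  locally bounded uniformly in \<open>n\<close>, and \<open>k\<^sub>n\<close> converges to \<open>h\<close> pointwise.
\<close>
lemma hardy_log_majorant:
  assumes hol: "h holomorphic_on upper_half_plane"
    and T: "\<And>y. 0 < y \<Longrightarrow> (\<integral>\<^sup>+x. ennreal (theta x (cmod (h (Complex x y)))) \<partial>lborel) \<le> 1"
  obtains G where "G holomorphic_on upper_half_plane"
    "\<And>z. z \<in> upper_half_plane \<Longrightarrow> 0 \<le> Re (G z)"
    "\<And>z. z \<in> upper_half_plane \<Longrightarrow> cmod (h z) \<le> (cmod (G z))\<^sup>2"
proof -
  define e where "e = (\<lambda>n. inverse (real (Suc n)))"
  have e: "0 < e n" "e n \<le> 1" for n by (auto simp: e_def field_simps)
  have e0: "e \<longlonglongrightarrow> 0" unfolding e_def by (rule LIMSEQ_inverse_real_of_nat)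
  define k where "k = (\<lambda>n z. h (z + \<i> * of_real (e n)) / (1 - \<i> * of_real (e n) * z) ^ 3)"
  have den: "1 \<le> cmod (1 - \<i> * of_real (e n) * z)" "e n * cmod z \<le> cmod (1 - \<i> * of_real (e n) * z)" if "0 \<le> Im z" for n z
  proof -
    have eq: "(cmod (1 - \<i> * of_real (e n) * z))\<^sup>2 = (1 + e n * Im z)\<^sup>2 + (e n * Re z)\<^sup>2"
      by (simp add: cmod_power2)
    have p: "0 \<le> e n * Im z" using e[of n] that by simp
    have "1\<^sup>2 \<le> (1 + e n * Im z)\<^sup>2" using p by (intro power_mono) auto
    then have "1\<^sup>2 \<le> (cmod (1 - \<i> * of_real (e n) * z))\<^sup>2" unfolding eq using zero_le_power2[of "e n * Re z"] by linarith
    then show "1 \<le> cmod (1 - \<i> * of_real (e n) * z)" by (rule power2_le_imp_le) simp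
    have "(e n * Im z)\<^sup>2 \<le> (1 + e n * Im z)\<^sup>2" using p by (intro power_mono) auto
    moreover have "(e n * cmod z)\<^sup>2 = (e n * Im z)\<^sup>2 + (e n * Re z)\<^sup>2"
      by (simp add: power_mult_distrib cmod_power2 algebra_simps)
    ultimately have "(e n * cmod z)\<^sup>2 \<le> (cmod (1 - \<i> * of_real (e n) * z))\<^sup>2" unfolding eq by linarith
    then show "e n * cmod z \<le> cmod (1 - \<i> * of_real (e n) * z)" by (rule power2_le_imp_le) simp
  qed
  have kle: "cmod (k n z) \<le> cmod (h (z + \<i> * of_real (e n)))" if "0 \<le> Im z" for n z
  proof -
    have "1 \<le> cmod (1 - \<i> * of_real (e n) * z) ^ 3" using den(1)[OF that] by (rule one_le_power)
    then have "cmod (h (z + \<i> * of_real (e n))) / cmod (1 - \<i> * of_real (e n) * z) ^ 3 \<le> cmod (h (z + \<i> * of_real (e n))) / 1"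
      by (intro divide_left_mono) auto
    then show ?thesis by (simp add: k_def norm_divide norm_power)
  qed
  have "\<exists>F. F holomorphic_on upper_half_plane \<and> (\<forall>z\<in>upper_half_plane. 0 \<le> Re (F z) \<and> cmod (k n z) \<le> (cmod (F z))\<^sup>2
      \<and> cmod (F z) \<le> 2 * e n + (cmod z + cmod (1 + z\<^sup>2) / Im z) * 2)" for n
  proof -
    define C where "C = 14400 * 16 / e n ^ 4"
    have C: "0 \<le> C" using e[of n] by (simp add: C_def)
    define N where "N = max 3 (4 * C / e n ^ 5)"
    have shift: "z + \<i> * of_real (e n) \<in> upper_half_plane" if "0 \<le> Im z" for z
      using that e[of n] by (simp add: upper_half_plane_def)
    have nz: "1 - \<i> * of_real (e n) * z \<noteq> 0" if "0 \<le> Im z" for z using den(1)[OF that, of n] by auto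
    have contk: "continuous_on {z. 0 \<le> Im z} (k n)"
      unfolding k_def using nz
      by (intro continuous_intros continuous_on_compose2[OF holomorphic_on_imp_continuous_on[OF hol]]) (auto simp: shift)
    have holk: "k n holomorphic_on upper_half_plane"
      unfolding k_def using nz
      by (intro holomorphic_intros holomorphic_on_compose_gen[OF _ hol, unfolded o_def])
         (use e[of n] in \<open>auto simp: upper_half_plane_def intro: add_pos_pos\<close>)
    have decay: "cmod (k n z) \<le> (e n)\<^sup>2" if z: "0 \<le> Im z" "N \<le> cmod z" for z
    proof -
      have z3: "3 \<le> cmod z" "4 * C / e n ^ 5 \<le> cmod z" using z by (auto simp: N_def)
      have "cmod (h (z + \<i> * of_real (e n))) \<le> 14400 * (2 + cmod (z + \<i> * of_real (e n)))\<^sup>2 / (e n / 2) ^ 4"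
        using e[of n] z by (intro theta_growth[OF hol T]) auto
      also have "\<dots> = C * (2 + cmod (z + \<i> * of_real (e n)))\<^sup>2" by (simp add: C_def power_divide)
      also have "\<dots> \<le> C * (2 * cmod z)\<^sup>2"
      proof -
        have "cmod (z + \<i> * of_real (e n)) \<le> cmod z + 1"
          using norm_triangle_ineq[of z "\<i> * of_real (e n)"] e[of n] by (simp add: norm_mult)
        then show ?thesis using z3 C by (intro mult_left_mono power_mono) auto
      qed
      finally have hl: "cmod (h (z + \<i> * of_real (e n))) \<le> 4 * C * (cmod z)\<^sup>2" by (simp add: power_mult_distrib)
      have "(e n * cmod z) ^ 3 \<le> cmod (1 - \<i> * of_real (e n) * z) ^ 3"
        using den(2)[OF z(1)] e[of n] by (intro power_mono) auto
      moreover have p: "0 < (e n * cmod z) ^ 3" using e[of n] z3 by (intro zero_less_power mult_pos_pos) auto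
      ultimately have "cmod (k n z) \<le> 4 * C * (cmod z)\<^sup>2 / (e n * cmod z) ^ 3"
        unfolding k_def norm_divide norm_power using hl C by (intro frac_le) auto
      also have "\<dots> = 4 * C / (e n ^ 3 * cmod z)" using z3 e[of n] by (simp add: power_mult_distrib power2_eq_square power3_eq_cube)
      also have "\<dots> \<le> (e n)\<^sup>2"
      proof -
        have "4 * C \<le> cmod z * e n ^ 5" using z3(2) e[of n] by (simp add: pos_divide_le_eq)
        also have "cmod z * e n ^ 5 = (e n)\<^sup>2 * (e n ^ 3 * cmod z)" by (simp flip: power_add mult.assoc)
        finally have "4 * C \<le> (e n)\<^sup>2 * (e n ^ 3 * cmod z)" .
        moreover have "0 < e n ^ 3 * cmod z" using e[of n] z3 by (intro mult_pos_pos zero_less_power) auto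
        ultimately show ?thesis by (subst pos_divide_le_eq)
      qed
      finally show ?thesis .
    qed
    have P: "(\<integral>\<^sup>+t. ennreal (sqrt (cmod (k n (of_real t))) / (1 + t\<^sup>2)) \<partial>lborel) \<le> ennreal (pi * 2)"
    proof -
      have "(\<integral>\<^sup>+t. ennreal (sqrt (cmod (k n (of_real t))) / (1 + t\<^sup>2)) \<partial>lborel) \<le> (\<integral>\<^sup>+t. ennreal (sqrt (cmod (h (Complex t (e n)))) / (1 + t\<^sup>2)) \<partial>lborel)"
      proof (intro nn_integral_mono ennreal_leI divide_right_mono real_sqrt_le_mono)
        fix t :: real
        have "of_real t + \<i> * of_real (e n) = Complex t (e n)" by (simp add: complex_eq_iff)
        then show "cmod (k n (of_real t)) \<le> cmod (h (Complex t (e n)))" using kle[of "of_real t" n] by simp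
      qed auto
      also have "\<dots> \<le> ennreal (pi * 2)" by (rule sqrt_line_integral[OF hol e(1) T[OF e(1)]])
      finally show ?thesis .
    qed
    have N: "0 < N" by (simp add: N_def)
    show ?thesis by (rule schwarz_majorant[OF contk holk e(1) N decay P]) auto
  qed
  then obtain F where F: "\<And>n. F n holomorphic_on upper_half_plane" "\<And>n z. z \<in> upper_half_plane \<Longrightarrow> 0 \<le> Re (F n z)"
    "\<And>n z. z \<in> upper_half_plane \<Longrightarrow> cmod (k n z) \<le> (cmod (F n z))\<^sup>2"
    "\<And>n z. z \<in> upper_half_plane \<Longrightarrow> cmod (F n z) \<le> 2 * e n + (cmod z + cmod (1 + z\<^sup>2) / Im z) * 2"
    by metis
  have bounded: "\<exists>B. \<forall>f\<in>range F. \<forall>z\<in>K. cmod (f z) \<le> B" if K: "compact K" "K \<subseteq> upper_half_plane" for K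
  proof -
    have "continuous_on K (\<lambda>z. cmod z + cmod (1 + z\<^sup>2) / Im z)"
      by (intro continuous_intros) (use K in \<open>auto simp: upper_half_plane_def\<close>)
    then have "bounded ((\<lambda>z. cmod z + cmod (1 + z\<^sup>2) / Im z) ` K)"
      by (intro compact_imp_bounded compact_continuous_image K)
    then obtain B where B: "\<And>z. z \<in> K \<Longrightarrow> \<bar>cmod z + cmod (1 + z\<^sup>2) / Im z\<bar> \<le> B"
      unfolding bounded_iff by auto
    have "cmod (F n z) \<le> 2 + B * 2" if "z \<in> K" for n z
      by (rule order_trans[OF F(4)[OF subsetD[OF K(2) that]]], intro add_mono mult_right_mono abs_le_D1[OF B[OF that]])
        (use e(2)[of n] in auto)
    then show ?thesis by blast
  qed
  have holF: "f holomorphic_on upper_half_plane" if "f \<in> range F" for f using F(1) that by auto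
  obtain G r where G: "G holomorphic_on upper_half_plane" "strict_mono (r :: nat \<Rightarrow> nat)"
      "\<And>z. z \<in> upper_half_plane \<Longrightarrow> (\<lambda>n. F (r n) z) \<longlonglongrightarrow> G z"
    by (rule Montel[OF open_upper_half_plane holF bounded order_refl]) blast+
  have er: "(\<lambda>n. e (r n)) \<longlonglongrightarrow> 0" using LIMSEQ_subseq_LIMSEQ[OF e0 G(2)] by (simp add: o_def)
  show ?thesis
  proof (rule that[OF G(1)])
    fix z assume z: "z \<in> upper_half_plane"
    have "(\<lambda>n. Re (F (r n) z)) \<longlonglongrightarrow> Re (G z)" by (intro tendsto_intros G(3) z)
    then show "0 \<le> Re (G z)" by (rule tendsto_lowerbound) (auto simp: F(2)[OF z])
    have cont: "isCont h z"
      using holomorphic_on_imp_continuous_on[OF hol] z by (simp add: continuous_on_eq_continuous_at)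
    have "(\<lambda>n. z + \<i> * of_real (e (r n))) \<longlonglongrightarrow> z + \<i> * of_real 0" by (intro tendsto_intros er)
    then have lim: "(\<lambda>n. z + \<i> * of_real (e (r n))) \<longlonglongrightarrow> z" by simp
    have 1: "(\<lambda>n. h (z + \<i> * of_real (e (r n)))) \<longlonglongrightarrow> h z" by (rule isCont_tendsto_compose[OF cont lim])
    have 2: "(\<lambda>n. (1 - \<i> * of_real (e (r n)) * z) ^ 3) \<longlonglongrightarrow> (1 - \<i> * of_real 0 * z) ^ 3" by (intro tendsto_intros er)
    have "(\<lambda>n. k (r n) z) \<longlonglongrightarrow> h z / (1 - \<i> * of_real 0 * z) ^ 3"
      unfolding k_def by (intro tendsto_divide 1 2) simp
    then have 3: "(\<lambda>n. cmod (k (r n) z)) \<longlonglongrightarrow> cmod (h z)" by (intro tendsto_norm) simp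
    have 4: "(\<lambda>n. (cmod (F (r n) z))\<^sup>2) \<longlonglongrightarrow> (cmod (G z))\<^sup>2" by (intro tendsto_intros G(3) z)
    show "cmod (h z) \<le> (cmod (G z))\<^sup>2"
      by (rule tendsto_le[OF _ 4 3]) (auto simp: F(3)[OF z])
  qed
qed

section \<open>Factorization\<close>

lemma hardy_log_scale:
  assumes "h \<in> hardy_log"
  obtains l where "0 < l" "\<And>y. 0 < y \<Longrightarrow> (\<integral>\<^sup>+x. ennreal (theta x (cmod (h (Complex x y) / of_real l))) \<partial>lborel) \<le> 1"
proof -
  obtain c where c: "hardy_log_norm h = ennreal c" "0 \<le> c"
    using assms by (cases "hardy_log_norm h" rule: ennreal_cases) (auto simp: hardy_log_def)
  show ?thesis
  proof (rule that[of "c + 1"])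
    fix y :: real assume y: "0 < y"
    have "Llog_norm (\<lambda>x. h (Complex x y)) \<le> ennreal c"
      unfolding c(1)[symmetric] hardy_log_norm_def using y by (intro SUP_upper) auto
    also have "\<dots> < ennreal (c + 1)" using c by (simp add: ennreal_less_iff)
    finally obtain l where l: "ennreal l < ennreal (c + 1)" "0 < l" "(\<integral>\<^sup>+x. ennreal (theta x (cmod (h (Complex x y)) / l)) \<partial>lborel) \<le> 1"
      unfolding Llog_norm_def Inf_less_iff by auto
    have lc: "l \<le> c + 1" using l(1,2) by (subst (asm) ennreal_less_iff) auto
    have "(\<integral>\<^sup>+x. ennreal (theta x (cmod (h (Complex x y) / of_real (c + 1)))) \<partial>lborel) \<le> (\<integral>\<^sup>+x. ennreal (theta x (cmod (h (Complex x y)) / l)) \<partial>lborel)"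
    proof (intro nn_integral_mono ennreal_leI theta_mono)
      fix x
      have "cmod (h (Complex x y)) / (c + 1) \<le> cmod (h (Complex x y)) / l"
        using lc l c by (intro divide_left_mono) auto
      moreover have "cmod (h (Complex x y) / of_real (c + 1)) = cmod (h (Complex x y)) / (c + 1)"
        unfolding norm_divide norm_of_real using c by simp
      ultimately show "cmod (h (Complex x y) / of_real (c + 1)) \<le> cmod (h (Complex x y)) / l" by simp
    qed simp
    then show "(\<integral>\<^sup>+x. ennreal (theta x (cmod (h (Complex x y) / of_real (c + 1)))) \<partial>lborel) \<le> 1" using l(3) by simp
  qed (use c in simp)
qed

text \<open>
  The two logarithms produce the two terms of the denominator of \<open>\<theta>\<close>: \<open>|1 - i z| \<ge> max 1 |x|\<close>, and
  \<open>|1 + G| \<ge> max 1 |G| \<ge> max 1 (\<surd>|h|)\<close> after normalization.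
\<close>
theorem hardy_log_factorization:
  assumes h: "h \<in> hardy_log"
  obtains f g where "f \<in> hardy1" "g \<in> bmoa" "\<And>z. z \<in> upper_half_plane \<Longrightarrow> h z = f z * g z"
proof -
  have hol: "h holomorphic_on upper_half_plane" using h by (simp add: hardy_log_def)
  obtain l where l: "0 < l" and T: "\<And>y. 0 < y \<Longrightarrow> (\<integral>\<^sup>+x. ennreal (theta x (cmod (h (Complex x y) / of_real l))) \<partial>lborel) \<le> 1"
    using hardy_log_scale[OF h] by blast
  have hol': "(\<lambda>z. h z / of_real l) holomorphic_on upper_half_plane" using l by (intro holomorphic_intros hol) auto
  obtain G where G: "G holomorphic_on upper_half_plane"
    "\<And>z. z \<in> upper_half_plane \<Longrightarrow> 0 \<le> Re (G z)"
    "\<And>z. z \<in> upper_half_plane \<Longrightarrow> cmod (h z / of_real l) \<le> (cmod (G z))\<^sup>2"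
    using hardy_log_majorant[OF hol' T] by blast
  define g where "g = (\<lambda>z. 1 + Ln (1 - \<i> * z) + Ln (1 + G z))"
  have Re1: "0 < Re (1 - \<i> * z)" "0 < Re (1 + G z)" "1 - \<i> * z \<noteq> 0" "1 + G z \<noteq> 0" if "z \<in> upper_half_plane" for z
  proof -
    show 1: "0 < Re (1 - \<i> * z)" using that by (simp add: upper_half_plane_def)
    show 2: "0 < Re (1 + G z)" using G(2)[OF that] by simp
    show "1 - \<i> * z \<noteq> 0" "1 + G z \<noteq> 0" using 1 2 by force+
  qed
  have holg: "g holomorphic_on upper_half_plane"
    unfolding g_def
    by (intro holomorphic_intros G(1)) (use Re1(1,2) in \<open>auto simp: complex_nonpos_Reals_iff not_le[symmetric] dest!: less_le_not_le[THEN iffD1]\<close>)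
  have "g \<in> bmoa"
  proof (rule bounded_Im_bmoa[OF holg])
    fix z assume z: "z \<in> upper_half_plane"
    show "\<bar>Im (g z)\<bar> \<le> pi"
      using Re_Ln_pos_lt_imp[OF Re1(1)[OF z]] Re_Ln_pos_lt_imp[OF Re1(2)[OF z]] by (simp add: g_def)
  qed
  have glow: "1 + log_plus \<bar>Re z\<bar> + log_plus (cmod (h z / of_real l)) / 2 \<le> cmod (g z)" if z: "z \<in> upper_half_plane" for z
  proof -
    have a: "log_plus \<bar>Re z\<bar> \<le> ln (cmod (1 - \<i> * z))"
    proof -
      have "1 \<le> cmod (1 - \<i> * z)" using complex_Re_le_cmod[of "1 - \<i> * z"] z by (simp add: upper_half_plane_def)
      moreover have "\<bar>Re z\<bar> \<le> cmod (1 - \<i> * z)" using abs_Im_le_cmod[of "1 - \<i> * z"] by simp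
      ultimately show ?thesis by (cases "Re z = 0") (auto simp: log_plus_def intro!: iffD2[OF ln_le_cancel_iff])
    qed
    have b: "log_plus (cmod (h z / of_real l)) / 2 \<le> ln (cmod (1 + G z))"
    proof -
      define t where "t = cmod (h z / of_real l)"
      have 1: "1 \<le> cmod (1 + G z)" using complex_Re_le_cmod[of "1 + G z"] G(2)[OF z] by simp
      have "(cmod (G z))\<^sup>2 \<le> (cmod (1 + G z))\<^sup>2" 
        unfolding cmod_power2 using G(2)[OF z] by (simp add: power2_eq_square algebra_simps)
      then have t: "t \<le> (cmod (1 + G z))\<^sup>2" using G(3)[OF z] unfolding t_def by linarith
      have "ln t \<le> 2 * ln (cmod (1 + G z))" if "0 < t"
      proof -
        have "ln t \<le> ln ((cmod (1 + G z))\<^sup>2)" by (rule iffD2[OF ln_le_cancel_iff]) (use t that in linarith)+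
        then show ?thesis using 1 by (simp add: ln_realpow)
      qed
      moreover have "0 \<le> ln (cmod (1 + G z))" using 1 by simp
      moreover have "0 \<le> t" by (simp add: t_def)
      ultimately show ?thesis unfolding t_def[symmetric] by (cases "t = 0") (auto simp: log_plus_def)
    qed
    have "Re (g z) = 1 + ln (cmod (1 - \<i> * z)) + ln (cmod (1 + G z))" using Re1(3,4)[OF z] by (simp add: g_def)
    then show ?thesis using a b complex_Re_le_cmod[of "g z"] by linarith
  qed
  have gnz: "g z \<noteq> 0" if "z \<in> upper_half_plane" for z
    using glow[OF that] theta_denominator_pos[of "Re z" "cmod (h z / of_real l)"] by auto
  define f where "f = (\<lambda>z. h z / g z)"
  have holf: "f holomorphic_on upper_half_plane" unfolding f_def by (intro holomorphic_intros hol holg) (use gnz in auto)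
  have "hardy1_norm f \<le> ennreal l"
    unfolding hardy1_norm_def
  proof (rule SUP_least)
    fix y :: real assume "y \<in> {0<..}"
    then have y: "0 < y" by simp
    have "(\<integral>\<^sup>+x. ennreal (cmod (f (Complex x y))) \<partial>lborel) \<le> (\<integral>\<^sup>+x. ennreal l * ennreal (theta x (cmod (h (Complex x y) / of_real l))) \<partial>lborel)"
    proof (rule nn_integral_mono)
      fix x
      let ?t = "cmod (h (Complex x y) / of_real l)"
      have z: "Complex x y \<in> upper_half_plane" using y by simp
      have "cmod (h (Complex x y)) / cmod (g (Complex x y)) \<le> cmod (h (Complex x y)) / (1 + log_plus \<bar>x\<bar> + log_plus ?t / 2)"
        using glow[OF z] theta_denominator_pos[of x ?t] gnz[OF z] by (intro divide_left_mono) auto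
      also have "\<dots> = l * theta x ?t" using l by (simp add: theta_def norm_divide)
      finally have "cmod (f (Complex x y)) \<le> l * theta x ?t" by (simp add: f_def norm_divide)
      then show "ennreal (cmod (f (Complex x y))) \<le> ennreal l * ennreal (theta x ?t)"
        using l theta_nonneg[of ?t x] by (simp add: ennreal_leI flip: ennreal_mult)
    qed
    also have "\<dots> = ennreal l * (\<integral>\<^sup>+x. ennreal (theta x (cmod (h (Complex x y) / of_real l))) \<partial>lborel)"
    proof -
      have [measurable]: "(\<lambda>x. h (Complex x y)) \<in> borel_measurable borel" by (rule measurable_on_line[OF hol y])
      show ?thesis by (intro nn_integral_cmult) measurable
    qed
    also have "\<dots> \<le> ennreal l * 1" by (intro mult_left_mono T y) auto
    finally show "(\<integral>\<^sup>+x. ennreal (cmod (f (Complex x y))) \<partial>lborel) \<le> ennreal l" by simp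
  qed
  also have "\<dots> < \<infinity>" by simp
  finally have "f \<in> hardy1" using holf by (simp add: hardy1_def)
  then show ?thesis using \<open>g \<in> bmoa\<close> gnz by (intro that[of f g]) (auto simp: f_def)
qed

text \<open>
  Membership in the two spaces depends only on the values in the half-plane.  This allows the factors to be
  redefined below it, where a member of the third space is arbitrary.
\<close>
lemma hardy1_cong: "(\<And>z. z \<in> upper_half_plane \<Longrightarrow> f z = f' z) \<Longrightarrow> f \<in> hardy1 \<Longrightarrow> f' \<in> hardy1"
proof -
  assume eq: "\<And>z. z \<in> upper_half_plane \<Longrightarrow> f z = f' z" and f: "f \<in> hardy1"
  have "f' holomorphic_on upper_half_plane"
    using f holomorphic_cong[OF refl, of upper_half_plane f f'] eq by (auto simp: hardy1_def)
  moreover have "hardy1_norm f' = hardy1_norm f"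
    unfolding hardy1_norm_def by (intro SUP_cong refl nn_integral_cong) (auto simp: eq)
  ultimately show ?thesis using f by (simp add: hardy1_def)
qed

lemma bmoa_cong: "(\<And>z. z \<in> upper_half_plane \<Longrightarrow> g z = g' z) \<Longrightarrow> g \<in> bmoa \<Longrightarrow> g' \<in> bmoa"
proof -
  assume eq: "\<And>z. z \<in> upper_half_plane \<Longrightarrow> g z = g' z" and g: "g \<in> bmoa"
  have "g' holomorphic_on upper_half_plane"
    using g holomorphic_cong[OF refl, of upper_half_plane g g'] eq by (auto simp: bmoa_def)
  moreover have d: "deriv g' z = deriv g z" if "z \<in> upper_half_plane" for z
  proof (rule deriv_cong_ev)
    show "\<forall>\<^sub>F w in nhds z. g' w = g w"
      using eventually_nhds_in_open[OF open_upper_half_plane that] by eventually_elim (simp add: eq)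
  qed simp
  moreover have "(\<integral>\<^sup>+z. ennreal ((cmod (deriv g' z))\<^sup>2 * Im z) * indicator (carleson_box a b) z \<partial>lborel)
     = (\<integral>\<^sup>+z. ennreal ((cmod (deriv g z))\<^sup>2 * Im z) * indicator (carleson_box a b) z \<partial>lborel)" for a b
    using carleson_box_subset_uhp[of a b] by (intro nn_integral_cong) (auto simp: indicator_def d)
  ultimately show ?thesis using g unfolding bmoa_iff by simp
qed

theorem theorem1p1:
  "(\<forall>f\<in>hardy1. \<forall>g\<in>bmoa. (\<lambda>z. f z * g z) \<in> hardy_log) \<and>
   (\<forall>h\<in>hardy_log. \<exists>f\<in>hardy1. \<exists>g\<in>bmoa. \<forall>z\<in>upper_half_plane. h z = f z * g z) \<and>
   {(\<lambda>z. f z * g z) | f g. f \<in> hardy1 \<and> g \<in> bmoa} = hardy_log"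
proof (intro conjI ballI)
  show "(\<lambda>z. f z * g z) \<in> hardy_log" if "f \<in> hardy1" "g \<in> bmoa" for f g
    by (rule hardy1_times_bmoa[OF that])
  show "\<exists>f\<in>hardy1. \<exists>g\<in>bmoa. \<forall>z\<in>upper_half_plane. h z = f z * g z" if "h \<in> hardy_log" for h
    by (rule hardy_log_factorization[OF that]) blast
  show "{(\<lambda>z. f z * g z) | f g. f \<in> hardy1 \<and> g \<in> bmoa} = hardy_log"
  proof
    show "{(\<lambda>z. f z * g z) | f g. f \<in> hardy1 \<and> g \<in> bmoa} \<subseteq> hardy_log"
      using hardy1_times_bmoa by blast
    show "hardy_log \<subseteq> {(\<lambda>z. f z * g z) | f g. f \<in> hardy1 \<and> g \<in> bmoa}"
    proof
      fix h assume "h \<in> hardy_log"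
      then obtain f g where fg: "f \<in> hardy1" "g \<in> bmoa" "\<And>z. z \<in> upper_half_plane \<Longrightarrow> h z = f z * g z"
        by (rule hardy_log_factorization) blast
      define f' where "f' = (\<lambda>z. if z \<in> upper_half_plane then f z else h z)"
      define g' where "g' = (\<lambda>z. if z \<in> upper_half_plane then g z else 1)"
      have "f' \<in> hardy1" by (rule hardy1_cong[OF _ fg(1)]) (simp add: f'_def)
      moreover have "g' \<in> bmoa" by (rule bmoa_cong[OF _ fg(2)]) (simp add: g'_def)
      moreover have "h = (\<lambda>z. f' z * g' z)" using fg(3) by (auto simp: f'_def g'_def)
      ultimately show "h \<in> {(\<lambda>z. f z * g z) | f g. f \<in> hardy1 \<and> g \<in> bmoa}" by blast
    qed
  qed
qed

end
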